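(* Let $\mathcal{W}$ be a good open cover of a $C^\infty$ manifold $Z$ and fix a cocycle $F\in \check{Z}^2(\mathcal{W},\underline{\mathbb{Z}}^n)$. Then there is a commuting diagram with exact columns and rows (extended in all degrees $k$) $$\begin{array}{ccccccccc} \to&\check{H}^k(\mathcal{W},\mathcal{R})&\xrightarrow{\pi^*}&\mathbb{H}^k_F(\mathcal{W},\mathcal{R})&\xrightarrow{\pi_*}&\overline{\mathbb{H}}^{k-1}_F(\mathcal{W},\mathcal{R})&\xrightarrow{\cup F}&\check{H}^{k+1}(\mathcal{W},\mathcal{R})&\to\\ &\downarrow&&\downarrow&&\downarrow&&\downarrow&\\ \to&\check{H}^k(\mathcal{W},\mathcal{S})&\xrightarrow{\pi^*}&\mathbb{H}^k_F(\mathcal{W},\mathcal{S})&\xrightarrow{\pi_*}&\overline{\mathbb{H}}^{k-1}_F(\mathcal{W},\mathcal{S})&\xrightarrow{\cup F}&\check{H}^{k+1}(\mathcal{W},\mathcal{S})&\to\\ &\downarrow&&\downarrow&&\downarrow&&\downarrow&\\ \to&\check{H}^{k+1}(\mathcal{W},\underline{\mathbb{Z}})&\xrightarrow{\pi^*}&\mathbb{H}^{k+1}_F(\mathcal{W},\underline{\mathbb{Z}})&\xrightarrow{\pi_*}&\overline{\mathbb{H}}^{k}_F(\mathcal{W},\underline{\mathbb{Z}})&\xrightarrow{\cup F}&\check{H}^{k+2}(\mathcal{W},\underline{\mathbb{Z}})&\to \end{array}$$ Here the columns are the long exact sequences (continuing below with the maps from $\underline{\mathbb{Z}}$ to $\mathcal{R}$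 coefficients) induced by the short exact sequences of cochain complexes coming from $0\to\mathbb{Z}\to\mathbb{R}\to\mathbb{R}/\mathbb{Z}\to 0$, and for each of the three coefficient systems the horizontal maps are $$\pi^*[\phi]=[\phi,0,0],\qquad \pi_*[\phi^{k0},\phi^{(k-1)1},\phi^{(k-2)2}]=[\phi^{(k-1)1},\phi^{(k-2)2}],$$ $$\cup F:\overline{\mathbb{H}}^{k-1}_F\to\check{H}^{k+1},\qquad [\phi^{(k-1)1},\phi^{(k-2)2}]\mapsto\big[(-1)^{k+2}\,\phi^{(k-1)1}\cup_1F+(-1)^{k+2}\,\phi^{(k-2)2}\cup_2C(F)\big].$$
   Context: A good open cover $\mathcal{W}=\{W_\lambda\}$ is one all of whose nonempty finite intersections $W_{\lambda_0\dots\lambda_p}=W_{\lambda_0}\cap\dots\cap W_{\lambda_p}$ are contractible. Let $G$ be one of $\mathbb{Z}$ (discrete), $\mathbb{R}$, $\mathbb{T}=\mathbb{R}/\mathbb{Z}$, all written additively; the corresponding sheaves of germs of continuous $G$-valued functions are denoted $\underline{\mathbb{Z}}$, $\mathcal{R}$, $\mathcal{S}$. $M_n^u(G)$ is the additive group of strictly upper triangular $n\times n$ matrices over $G$. For $A=G,G^n,M_n^u(G)$, $\check{C}^p(\mathcal{W},A)$ is the group of Čech $p$-cochains, i.e. families $\phi_{\lambda_0\dots\lambda_p}$ of continuous functions $W_{\lambda_0\dots\lambda_p}\to A$ (zero if $p<0$), with differential $(\check\partial\phi)_{\lambda_0\dots\lambda_{p+1}}=\sum_{i}(-1)^i\phi_{\lambda_0\dots\widehat{\lambda_i}\dots\lambda_{p+1}}$;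 $\check{H}^p(\mathcal{W},\cdot)$ is its cohomology for the cover $\mathcal{W}$ (no limit over covers) and $\check Z^p$ denotes cocycles. Subscripts $l$ and $ij$ ($1\le l\le n$, $1\le i<j\le n$) denote components in $G^n$ and $M_n^u(G)$, and $e_l\in\mathbb{Z}^n$ is the $l$-th standard basis vector. Define $C(F)\in\check{C}^3(\mathcal{W},\underline{M_n^u(\mathbb{Z})})$ by $C(F)_{\lambda_0\lambda_1\lambda_2\lambda_3}(z)_{ij}=F_{\lambda_0\lambda_1\lambda_2}(z)_iF_{\lambda_0\lambda_2\lambda_3}(z)_j-F_{\lambda_1\lambda_2\lambda_3}(z)_iF_{\lambda_0\lambda_1\lambda_3}(z)_j$, and products $$(\phi^{(k-1)1}\cup_1F)_{\lambda_0\dots\lambda_{k+1}}=\sum_{l=1}^n(\phi^{(k-1)1}_{\lambda_0\dots\lambda_{k-1}})_l\,(F_{\lambda_{k-1}\lambda_k\lambda_{k+1}})_l,$$ $$(\phi^{(k-2)2}\cup_1F)_{\lambda_0\dots\lambda_k,\,l}=\sum_{i<j}(\phi^{(k-2)2}_{\lambda_0\dots\lambda_{k-2}})_{ij}\big((F_{\lambda_{k-2}\lambda_{k-1}\lambda_k})_i(e_l)_j-(e_l)_i(F_{\lambda_{k-2}\lambda_{k-1}\lambda_k})_j\big),$$ $$(\phi^{(k-2)2}\cup_2C(F))_{\lambda_0\dots\lambda_{k+1}}=\sum_{i<j}(\phi^{(k-2)2}_{\lambda_0\dots\lambda_{k-2}})_{ij}\,(C(F)_{\lambda_{k-2}\lambda_{k-1}\lambda_k\lambda_{k+1}})_{ij},$$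 where $\phi^{(k-1)1}\in\check{C}^{k-1}(\mathcal{W},G^n)$ and $\phi^{(k-2)2}\in\check{C}^{k-2}(\mathcal{W},M_n^u(G))$. The complex $C^k_F(\mathcal{W},\cdot)$ with coefficients in $G$ consists of triples $(\phi^{k0},\phi^{(k-1)1},\phi^{(k-2)2})\in\check{C}^k(\mathcal{W},G)\oplus\check{C}^{k-1}(\mathcal{W},G^n)\oplus\check{C}^{k-2}(\mathcal{W},M_n^u(G))$ (entries of negative degree omitted), with differential $$D_F(\phi^{k0},\phi^{(k-1)1},\phi^{(k-2)2})=\big(\check\partial\phi^{k0}+(-1)^{k+1}\phi^{(k-1)1}\cup_1F+(-1)^{k+1}\phi^{(k-2)2}\cup_2C(F),\ \check\partial\phi^{(k-1)1}+(-1)^k\phi^{(k-2)2}\cup_1F,\ \check\partial\phi^{(k-2)2}\big).$$ Its cohomology is $\mathbb{H}^k_F(\mathcal{W},\underline{\mathbb{Z}})$, $\mathbb{H}^k_F(\mathcal{W},\mathcal{R})$, $\mathbb{H}^k_F(\mathcal{W},\mathcal{S})$ for $G=\mathbb{Z},\mathbb{R},\mathbb{T}$. The complex $\overline{C}^{k-1}_F(\mathcal{W},\cdot)$ is obtained from $C^k_F$ by removing the first entry: it consists of pairs $(\phi^{(k-1)1},\phi^{(k-2)2})$, with differential $\overline{D}_F(\phi^{(k-1)1},\phi^{(k-2)2})=(\check\partial\phi^{(k-1)1}+(-1)^k\phi^{(k-2)2}\cup_1F,\ \check\partial\phi^{(k-2)2})$. Its degree $k-1$ cohomology is $\overline{\mathbb{H}}^{k-1}_F(\mathcal{W},\cdot)$.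 All groups in negative degree are zero.
   Formalization: The connecting maps of the columns are taken as (-1)^k times the usual snake maps (k the total degree; degree k-1 for the reduced complex); with unsigned snake maps the square joining cup F and the connecting maps commutes only up to -1, e.g. on S^1 x S^2. *)

theory Defs
  imports
    "HOL-Analysis.Analysis"
    "HOL-Algebra.Coset"
    "HOL-Library.Function_Algebras"
begin

section \<open>Smooth manifolds\<close>

text \<open>\<open>Ck_on d k S f\<close>: on the open subset \<open>S\<close> of \<open>Euclidean_space d\<close>, all iterated partial
  derivatives of \<open>f\<close> of order at most \<open>k\<close> exist and are continuous.\<close>

primrec Ck_on :: "nat \<Rightarrow> nat \<Rightarrow> (nat \<Rightarrow> real) set \<Rightarrow> ((nat \<Rightarrow> real) \<Rightarrow> real) \<Rightarrow> bool" where
  "Ck_on d 0 S f \<longleftrightarrow> continuous_map (subtopology (Euclidean_space d) S) euclideanreal f"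
| "Ck_on d (Suc k) S f \<longleftrightarrow>
     continuous_map (subtopology (Euclidean_space d) S) euclideanreal f \<and>
     (\<forall>i<d. \<exists>g. (\<forall>x\<in>S. ((\<lambda>t. f (x(i := t))) has_real_derivative g x) (at (x i))) \<and> Ck_on d k S g)"

definition smooth_map_on :: "nat \<Rightarrow> (nat \<Rightarrow> real) set \<Rightarrow> ((nat \<Rightarrow> real) \<Rightarrow> (nat \<Rightarrow> real)) \<Rightarrow> bool" where
  "smooth_map_on d S f \<longleftrightarrow> (\<forall>j<d. \<forall>k. Ck_on d k S (\<lambda>x. f x j))"

text \<open>A chart is a pair of an open domain and a homeomorphism onto an open subset of
  \<open>Euclidean_space d\<close>; the dimension \<open>d = 0\<close> is allowed.\<close>

definition is_chart :: "nat \<Rightarrow> 'z topology \<Rightarrow> 'z set \<times> ('z \<Rightarrow> (nat \<Rightarrow> real)) \<Rightarrow> bool" where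
  "is_chart d Z c \<longleftrightarrow> (case c of (U, \<phi>) \<Rightarrow>
     openin Z U \<and> openin (Euclidean_space d) (\<phi> ` U) \<and>
     homeomorphic_map (subtopology Z U) (subtopology (Euclidean_space d) (\<phi> ` U)) \<phi>)"

definition smooth_manifold ::
  "nat \<Rightarrow> 'z topology \<Rightarrow> ('z set \<times> ('z \<Rightarrow> (nat \<Rightarrow> real))) set \<Rightarrow> bool" where
  "smooth_manifold d Z \<A> \<longleftrightarrow>
     Hausdorff_space Z \<and> second_countable Z \<and>
     (\<forall>c\<in>\<A>. is_chart d Z c) \<and> (\<Union>(U, \<phi>)\<in>\<A>. U) = topspace Z \<and>
     (\<forall>(U, \<phi>)\<in>\<A>. \<forall>(V, \<psi>)\<in>\<A>. smooth_map_on d (\<phi> ` (U \<inter> V)) (\<psi> \<circ> inv_into U \<phi>))"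


section \<open>Covers\<close>

text \<open>The overlap of the cover members indexed by a nonempty list of indices from \<open>\<Lambda>\<close>; it is
  set to be empty on lists that do not index a simplex.\<close>

definition overlap :: "'i set \<Rightarrow> ('i \<Rightarrow> 'z set) \<Rightarrow> 'i list \<Rightarrow> 'z set" where
  "overlap \<Lambda> W ls = (if ls \<noteq> [] \<and> set ls \<subseteq> \<Lambda> then (\<Inter>i\<in>set ls. W i) else {})"

definition good_open_cover :: "'z topology \<Rightarrow> 'i set \<Rightarrow> ('i \<Rightarrow> 'z set) \<Rightarrow> bool" where
  "good_open_cover Z \<Lambda> W \<longleftrightarrow>
     (\<forall>i\<in>\<Lambda>. openin Z (W i)) \<and> (\<Union>i\<in>\<Lambda>. W i) = topspace Z \<and>
     (\<forall>ls. overlap \<Lambda> W ls \<noteq> {} \<longrightarrow> contractible_space (subtopology Z (overlap \<Lambda> W ls)))"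


section \<open>Coefficients\<close>

quotient_type circle = real / "\<lambda>x y. x - y \<in> \<int>"
  morphisms rep_circle circle_of
proof (rule equivpI)
  show "reflp (\<lambda>x y :: real. x - y \<in> \<int>)"
    by (rule reflpI) simp
  show "symp (\<lambda>x y :: real. x - y \<in> \<int>)"
    by (rule sympI) (metis Ints_minus minus_diff_eq)
  show "transp (\<lambda>x y :: real. x - y \<in> \<int>)"
    by (rule transpI) (metis Ints_add diff_add_cancel add_diff_eq)
qed

instantiation circle :: ab_group_add
begin

lift_definition zero_circle :: circle is 0 .

lift_definition plus_circle :: "circle \<Rightarrow> circle \<Rightarrow> circle" is "(+)"
  by (metis Ints_add add_diff_add)

lift_definition uminus_circle :: "circle \<Rightarrow> circle" is uminus
  by (metis Ints_minus minus_diff_minus)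

lift_definition minus_circle :: "circle \<Rightarrow> circle \<Rightarrow> circle" is "(-)"
proof -
  fix a b c d :: real
  assume "a - b \<in> \<int>" "c - d \<in> \<int>"
  then have "(a - b) - (c - d) \<in> \<int>" by (rule Ints_diff)
  then show "(a - c) - (b - d) \<in> \<int>" by (simp add: algebra_simps)
qed

instance
  by standard (transfer; simp add: algebra_simps)+

end

instantiation circle :: topological_space
begin

text \<open>The quotient topology.\<close>

definition open_circle :: "circle set \<Rightarrow> bool" where
  "open_circle U \<longleftrightarrow> open (circle_of -` U)"

instance
proof
  show "open (UNIV :: circle set)"
    by (simp add: open_circle_def)
  show "open (S \<inter> T)" if "open S" "open T" for S T :: "circle set"
    using that by (simp add: open_circle_def open_Int)
  show "open (\<Union>K)" if "\<forall>S\<in>K. open S" for K :: "circle set set"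
    using that by (auto simp: open_circle_def vimage_Union)
qed

end

text \<open>The action of the integers on an abelian group, and the sign \<open>(-1)\<^sup>k\<close> of an integer \<open>k\<close>.\<close>

definition zmul :: "int \<Rightarrow> 'g::ab_group_add \<Rightarrow> 'g" where
  "zmul m x = (if 0 \<le> m then \<Sum>_<nat m. x else - (\<Sum>_<nat (- m). x))"

definition msign :: "int \<Rightarrow> int" where
  "msign k = (if even k then 1 else - 1)"

text \<open>\<open>G\<^sup>n\<close> and \<open>M\<^sub>n\<^sup>u(G)\<close> with components indexed by \<open>1, \<dots>, n\<close>, extended by zero. Their topology
  as subsets of a function space is the product topology.\<close>

definition vecs :: "nat \<Rightarrow> (nat \<Rightarrow> 'g::zero) set" where
  "vecs n = {v. \<forall>l. l \<notin> {1..n} \<longrightarrow> v l = 0}"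

definition upper_mats :: "nat \<Rightarrow> (nat \<Rightarrow> nat \<Rightarrow> 'g::zero) set" where
  "upper_mats n = {m. \<forall>i j. \<not> (1 \<le> i \<and> i < j \<and> j \<le> n) \<longrightarrow> m i j = 0}"


section \<open>Cech cochains\<close>

text \<open>A \<open>p\<close>-cochain is a function of a list of \<open>p + 1\<close> indices and a point, extended by zero to
  all other lists and to points outside the overlap, so that equality of families is equality of
  functions. In negative degree only the zero cochain remains.\<close>

type_synonym ('i, 'z, 'a) cochain = "'i list \<Rightarrow> 'z \<Rightarrow> 'a"

definition cochains :: "'z topology \<Rightarrow> 'i set \<Rightarrow> ('i \<Rightarrow> 'z set) \<Rightarrow> int \<Rightarrow>
    'a::{topological_space, zero} set \<Rightarrow> ('i, 'z, 'a) cochain set" where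
  "cochains Z \<Lambda> W p A = {\<phi>. \<forall>ls.
     if 0 \<le> p \<and> int (length ls) = p + 1
     then continuous_map (subtopology Z (overlap \<Lambda> W ls)) euclidean (\<phi> ls) \<and>
          (\<forall>z \<in> overlap \<Lambda> W ls. \<phi> ls z \<in> A) \<and> (\<forall>z. z \<notin> overlap \<Lambda> W ls \<longrightarrow> \<phi> ls z = 0)
     else (\<forall>z. \<phi> ls z = 0)}"

definition omit :: "nat \<Rightarrow> 'b list \<Rightarrow> 'b list" where
  "omit i ls = take i ls @ drop (Suc i) ls"

text \<open>The differential and the products below need no degree argument: a cochain vanishes on
  lists of the wrong length, so only the intended degree contributes. In a product the second
  factor is evaluated on the last three (or four) indices, and the last index of the first factor
  is the first index of the second.\<close>

definition cech_d :: "'i set \<Rightarrow> ('i \<Rightarrow> 'z set) \<Rightarrow> ('i, 'z, 'a::ab_group_add) cochain \<Rightarrow>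
    ('i, 'z, 'a) cochain" where
  "cech_d \<Lambda> W \<phi> = (\<lambda>ls z. if z \<in> overlap \<Lambda> W ls
     then \<Sum>i<length ls. zmul (msign (int i)) (\<phi> (omit i ls) z) else 0)"

definition cup1_vec :: "nat \<Rightarrow> 'i set \<Rightarrow> ('i \<Rightarrow> 'z set) \<Rightarrow> ('i, 'z, nat \<Rightarrow> int) cochain \<Rightarrow>
    ('i, 'z, nat \<Rightarrow> 'g::ab_group_add) cochain \<Rightarrow> ('i, 'z, 'g) cochain" where
  "cup1_vec n \<Lambda> W F \<phi> = (\<lambda>ls z. if z \<in> overlap \<Lambda> W ls
     then \<Sum>l\<in>{1..n}. zmul (F (drop (length ls - 3) ls) z l) (\<phi> (take (length ls - 2) ls) z l)
     else 0)"

definition std_basis :: "nat \<Rightarrow> nat \<Rightarrow> int" where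
  "std_basis l i = (if i = l then 1 else 0)"

definition cup1_mat :: "nat \<Rightarrow> 'i set \<Rightarrow> ('i \<Rightarrow> 'z set) \<Rightarrow> ('i, 'z, nat \<Rightarrow> int) cochain \<Rightarrow>
    ('i, 'z, nat \<Rightarrow> nat \<Rightarrow> 'g::ab_group_add) cochain \<Rightarrow> ('i, 'z, nat \<Rightarrow> 'g) cochain" where
  "cup1_mat n \<Lambda> W F \<phi> = (\<lambda>ls z l. if z \<in> overlap \<Lambda> W ls \<and> l \<in> {1..n}
     then \<Sum>(i, j) \<in> {(i, j). 1 \<le> i \<and> i < j \<and> j \<le> n}.
       zmul (F (drop (length ls - 3) ls) z i * std_basis l j
             - std_basis l i * F (drop (length ls - 3) ls) z j)
         (\<phi> (take (length ls - 2) ls) z i j)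
     else 0)"

definition C_of :: "nat \<Rightarrow> 'i set \<Rightarrow> ('i \<Rightarrow> 'z set) \<Rightarrow> ('i, 'z, nat \<Rightarrow> int) cochain \<Rightarrow>
    ('i, 'z, nat \<Rightarrow> nat \<Rightarrow> int) cochain" where
  "C_of n \<Lambda> W F = (\<lambda>ls z i j.
     if length ls = 4 \<and> z \<in> overlap \<Lambda> W ls \<and> 1 \<le> i \<and> i < j \<and> j \<le> n
     then F [ls!0, ls!1, ls!2] z i * F [ls!0, ls!2, ls!3] z j
        - F [ls!1, ls!2, ls!3] z i * F [ls!0, ls!1, ls!3] z j
     else 0)"

definition cup2 :: "nat \<Rightarrow> 'i set \<Rightarrow> ('i \<Rightarrow> 'z set) \<Rightarrow> ('i, 'z, nat \<Rightarrow> nat \<Rightarrow> int) cochain \<Rightarrow>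
    ('i, 'z, nat \<Rightarrow> nat \<Rightarrow> 'g::ab_group_add) cochain \<Rightarrow> ('i, 'z, 'g) cochain" where
  "cup2 n \<Lambda> W C \<phi> = (\<lambda>ls z. if z \<in> overlap \<Lambda> W ls
     then \<Sum>(i, j) \<in> {(i, j). 1 \<le> i \<and> i < j \<and> j \<le> n}.
       zmul (C (drop (length ls - 4) ls) z i j) (\<phi> (take (length ls - 3) ls) z i j)
     else 0)"

definition cech_2_cocycles :: "'z topology \<Rightarrow> 'i set \<Rightarrow> ('i \<Rightarrow> 'z set) \<Rightarrow> nat \<Rightarrow>
    ('i, 'z, nat \<Rightarrow> int) cochain set" where
  "cech_2_cocycles Z \<Lambda> W n = {F \<in> cochains Z \<Lambda> W 2 (vecs n). cech_d \<Lambda> W F = 0}"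


section \<open>Cochain complexes and their cohomology\<close>

record 'c cochain_complex =
  obj :: "int \<Rightarrow> 'c set"
  diff :: "int \<Rightarrow> 'c \<Rightarrow> 'c"

definition cocycle_group :: "'c::ab_group_add cochain_complex \<Rightarrow> int \<Rightarrow> 'c monoid" where
  "cocycle_group D k =
     \<lparr>carrier = {x \<in> obj D k. diff D k x = 0}, monoid.mult = (+), one = 0\<rparr>"

definition coboundaries :: "'c cochain_complex \<Rightarrow> int \<Rightarrow> 'c set" where
  "coboundaries D k = diff D (k - 1) ` obj D (k - 1)"

definition cohomology :: "'c::ab_group_add cochain_complex \<Rightarrow> int \<Rightarrow> 'c set monoid" where
  "cohomology D k = cocycle_group D k Mod coboundaries D k"

definition coh_class :: "'c::ab_group_add cochain_complex \<Rightarrow> int \<Rightarrow> 'c \<Rightarrow> 'c set" where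
  "coh_class D k x = coboundaries D k #>\<^bsub>cocycle_group D k\<^esub> x"

text \<open>The map of cohomology classes \<open>[x] \<mapsto> [f x]\<close> into \<open>cohomology D k\<close>. The union over all
  representatives is a single class exactly when the map is well defined.\<close>

definition coh_map :: "'d::ab_group_add cochain_complex \<Rightarrow> int \<Rightarrow> ('c \<Rightarrow> 'd) \<Rightarrow> 'c set \<Rightarrow> 'd set" where
  "coh_map D k f X = (\<Union>x\<in>X. coh_class D k (f x))"

definition exact_at :: "'a monoid \<Rightarrow> 'b monoid \<Rightarrow> 'c monoid \<Rightarrow> ('a \<Rightarrow> 'b) \<Rightarrow> ('b \<Rightarrow> 'c) \<Rightarrow> bool" where
  "exact_at A B C f g \<longleftrightarrow> group_hom A B f \<and> group_hom B C g \<and> kernel B C g = f ` carrier A"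

definition square_commutes ::
  "'a monoid \<Rightarrow> ('a \<Rightarrow> 'b) \<Rightarrow> ('b \<Rightarrow> 'd) \<Rightarrow> ('a \<Rightarrow> 'c) \<Rightarrow> ('c \<Rightarrow> 'd) \<Rightarrow> bool" where
  "square_commutes A f g f' g' \<longleftrightarrow> (\<forall>x\<in>carrier A. g (f x) = g' (f' x))"


section \<open>The three complexes\<close>

definition cech_complex :: "'z topology \<Rightarrow> 'i set \<Rightarrow> ('i \<Rightarrow> 'z set) \<Rightarrow>
    ('i, 'z, 'g::{topological_space, ab_group_add}) cochain cochain_complex" where
  "cech_complex Z \<Lambda> W = \<lparr>obj = (\<lambda>k. cochains Z \<Lambda> W k UNIV), diff = (\<lambda>k. cech_d \<Lambda> W)\<rparr>"

type_synonym ('i, 'z, 'g) pair_cochain =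
  "('i, 'z, nat \<Rightarrow> 'g) cochain \<times> ('i, 'z, nat \<Rightarrow> nat \<Rightarrow> 'g) cochain"

type_synonym ('i, 'z, 'g) triple_cochain =
  "('i, 'z, 'g) cochain \<times> ('i, 'z, 'g) pair_cochain"

text \<open>\<open>F_product\<close> is the common part, up to sign, of the first component of \<open>D\<^sub>F\<close> and of the cup
  product with \<open>F\<close>.\<close>

definition F_product :: "nat \<Rightarrow> 'i set \<Rightarrow> ('i \<Rightarrow> 'z set) \<Rightarrow> ('i, 'z, nat \<Rightarrow> int) cochain \<Rightarrow> int \<Rightarrow>
    ('i, 'z, 'g::ab_group_add) pair_cochain \<Rightarrow> ('i, 'z, 'g) cochain" where
  "F_product n \<Lambda> W F s = (\<lambda>(\<phi>1, \<phi>2).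
     zmul s (cup1_vec n \<Lambda> W F \<phi>1) + zmul s (cup2 n \<Lambda> W (C_of n \<Lambda> W F) \<phi>2))"

definition twisted_complex :: "'z topology \<Rightarrow> 'i set \<Rightarrow> ('i \<Rightarrow> 'z set) \<Rightarrow> nat \<Rightarrow>
    ('i, 'z, nat \<Rightarrow> int) cochain \<Rightarrow>
    ('i, 'z, 'g::{topological_space, ab_group_add}) triple_cochain cochain_complex" where
  "twisted_complex Z \<Lambda> W n F =
     \<lparr>obj = (\<lambda>k. cochains Z \<Lambda> W k UNIV \<times> cochains Z \<Lambda> W (k - 1) (vecs n)
                  \<times> cochains Z \<Lambda> W (k - 2) (upper_mats n)),
      diff = (\<lambda>k (\<phi>0, \<phi>1, \<phi>2).
        (cech_d \<Lambda> W \<phi>0 + F_product n \<Lambda> W F (msign (k + 1)) (\<phi>1, \<phi>2),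
         cech_d \<Lambda> W \<phi>1 + zmul (msign k) (cup1_mat n \<Lambda> W F \<phi>2),
         cech_d \<Lambda> W \<phi>2))\<rparr>"

text \<open>Degree \<open>m\<close> of the reduced complex belongs to degree \<open>k = m + 1\<close> of the twisted complex,
  whence the sign \<open>(-1)\<^sup>m\<^sup>+\<^sup>1 = (-1)\<^sup>k\<close>.\<close>

definition reduced_complex :: "'z topology \<Rightarrow> 'i set \<Rightarrow> ('i \<Rightarrow> 'z set) \<Rightarrow> nat \<Rightarrow>
    ('i, 'z, nat \<Rightarrow> int) cochain \<Rightarrow>
    ('i, 'z, 'g::{topological_space, ab_group_add}) pair_cochain cochain_complex" where
  "reduced_complex Z \<Lambda> W n F =
     \<lparr>obj = (\<lambda>m. cochains Z \<Lambda> W m (vecs n) \<times> cochains Z \<Lambda> W (m - 1) (upper_mats n)),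
      diff = (\<lambda>m (\<phi>1, \<phi>2).
        (cech_d \<Lambda> W \<phi>1 + zmul (msign (m + 1)) (cup1_mat n \<Lambda> W F \<phi>2), cech_d \<Lambda> W \<phi>2))\<rparr>"


section \<open>The rows\<close>

definition pi_up :: "'z topology \<Rightarrow> 'i set \<Rightarrow> ('i \<Rightarrow> 'z set) \<Rightarrow> nat \<Rightarrow>
    ('i, 'z, nat \<Rightarrow> int) cochain \<Rightarrow> int \<Rightarrow>
    ('i, 'z, 'g::{topological_space, ab_group_add}) cochain set \<Rightarrow>
    ('i, 'z, 'g) triple_cochain set" where
  "pi_up Z \<Lambda> W n F k = coh_map (twisted_complex Z \<Lambda> W n F) k (\<lambda>\<phi>. (\<phi>, 0, 0))"

definition pi_down :: "'z topology \<Rightarrow> 'i set \<Rightarrow> ('i \<Rightarrow> 'z set) \<Rightarrow> nat \<Rightarrow>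
    ('i, 'z, nat \<Rightarrow> int) cochain \<Rightarrow> int \<Rightarrow>
    ('i, 'z, 'g::{topological_space, ab_group_add}) triple_cochain set \<Rightarrow>
    ('i, 'z, 'g) pair_cochain set" where
  "pi_down Z \<Lambda> W n F k =
     coh_map (reduced_complex Z \<Lambda> W n F) (k - 1) (\<lambda>(\<phi>0, \<phi>1, \<phi>2). (\<phi>1, \<phi>2))"

text \<open>\<open>cup_F \<dots> k\<close> maps reduced cohomology of degree \<open>k - 1\<close> to Cech cohomology of degree
  \<open>k + 1\<close>.\<close>

definition cup_F :: "'z topology \<Rightarrow> 'i set \<Rightarrow> ('i \<Rightarrow> 'z set) \<Rightarrow> nat \<Rightarrow>
    ('i, 'z, nat \<Rightarrow> int) cochain \<Rightarrow> int \<Rightarrow>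
    ('i, 'z, 'g::{topological_space, ab_group_add}) pair_cochain set \<Rightarrow>
    ('i, 'z, 'g) cochain set" where
  "cup_F Z \<Lambda> W n F k =
     coh_map (cech_complex Z \<Lambda> W) (k + 1) (F_product n \<Lambda> W F (msign (k + 2)))"

definition row_exact :: "'g::{topological_space, ab_group_add} itself \<Rightarrow> 'z topology \<Rightarrow> 'i set \<Rightarrow>
    ('i \<Rightarrow> 'z set) \<Rightarrow> nat \<Rightarrow> ('i, 'z, nat \<Rightarrow> int) cochain \<Rightarrow> bool" where
  "row_exact (_ :: 'g itself) Z \<Lambda> W n F \<longleftrightarrow>
    (let H = cohomology (cech_complex Z \<Lambda> W :: ('i, 'z, 'g) cochain cochain_complex);
         HF = cohomology (twisted_complex Z \<Lambda> W n F :: ('i, 'z, 'g) triple_cochain cochain_complex);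
         HR = cohomology (reduced_complex Z \<Lambda> W n F :: ('i, 'z, 'g) pair_cochain cochain_complex)
     in \<forall>k.
       exact_at (H k) (HF k) (HR (k - 1)) (pi_up Z \<Lambda> W n F k) (pi_down Z \<Lambda> W n F k) \<and>
       exact_at (HF k) (HR (k - 1)) (H (k + 1)) (pi_down Z \<Lambda> W n F k) (cup_F Z \<Lambda> W n F k) \<and>
       exact_at (HR (k - 1)) (H (k + 1)) (HF (k + 1))
         (cup_F Z \<Lambda> W n F k) (pi_up Z \<Lambda> W n F (k + 1)))"


section \<open>The columns\<close>

text \<open>The complexes with coefficients \<open>\<int>\<close>, \<open>\<real>\<close>, \<open>\<real>/\<int>\<close> and the cochain maps between them.\<close>

record ('a, 'b, 'c) coefficient_sequence =
  sub_cx :: "'a cochain_complex"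
  mid_cx :: "'b cochain_complex"
  quo_cx :: "'c cochain_complex"
  inc :: "'a \<Rightarrow> 'b"
  prj :: "'b \<Rightarrow> 'c"

definition inc_coh where
  "inc_coh S k = coh_map (mid_cx S) k (inc S)"

definition prj_coh where
  "prj_coh S k = coh_map (quo_cx S) k (prj S)"

text \<open>The snake map: lift a representative to a cochain \<open>b\<close> of the middle complex and take the
  class of the preimage \<open>a\<close> of the differential of \<open>b\<close>.\<close>

definition snake :: "('a::ab_group_add, 'b, 'c) coefficient_sequence \<Rightarrow> int \<Rightarrow> 'c set \<Rightarrow> 'a set" where
  "snake S k X = (\<Union>b \<in> {b \<in> obj (mid_cx S) k. prj S b \<in> X}.
     \<Union>a \<in> {a \<in> obj (sub_cx S) (k + 1). inc S a = diff (mid_cx S) k b}.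
       coh_class (sub_cx S) (k + 1) a)"

text \<open>Sign convention: the connecting map is \<open>(-1)\<^sup>t\<close> times the snake map, where \<open>t\<close> is the total
  degree, i.e. the degree \<open>k\<close> for the Cech and twisted complexes, and \<open>m + 1\<close> in degree \<open>m\<close> of the
  reduced complex. Kernels and images do not depend on it. With the bare snake maps the squares
  involving the cup product with \<open>F\<close> and a connecting map commute only up to the sign \<open>-1\<close>,
  because the sign \<open>(-1)\<^sup>k\<^sup>+\<^sup>2\<close> in the cup product alternates with \<open>k\<close>.\<close>

definition conn_coh :: "('a::ab_group_add, 'b, 'c) coefficient_sequence \<Rightarrow> int \<Rightarrow> int \<Rightarrow>
    'c set \<Rightarrow> 'a set" where
  "conn_coh S t k X = snake S k X [^]\<^bsub>cohomology (sub_cx S) (k + 1)\<^esub> msign t"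

definition column_exact :: "('a::ab_group_add, 'b::ab_group_add, 'c::ab_group_add) coefficient_sequence \<Rightarrow>
    int \<Rightarrow> bool" where
  "column_exact S s \<longleftrightarrow>
    (let HZ = cohomology (sub_cx S); HR = cohomology (mid_cx S); HT = cohomology (quo_cx S)
     in \<forall>k.
       exact_at (HZ k) (HR k) (HT k) (inc_coh S k) (prj_coh S k) \<and>
       exact_at (HR k) (HT k) (HZ (k + 1)) (prj_coh S k) (conn_coh S (k + s) k) \<and>
       exact_at (HT k) (HZ (k + 1)) (HR (k + 1)) (conn_coh S (k + s) k) (inc_coh S (k + 1)))"

definition coeff0 :: "('g \<Rightarrow> 'h) \<Rightarrow> ('i, 'z, 'g) cochain \<Rightarrow> ('i, 'z, 'h) cochain" where
  "coeff0 h \<phi> = (\<lambda>ls z. h (\<phi> ls z))"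

definition coeff_pair :: "('g \<Rightarrow> 'h) \<Rightarrow> ('i, 'z, 'g) pair_cochain \<Rightarrow> ('i, 'z, 'h) pair_cochain" where
  "coeff_pair h = (\<lambda>(\<phi>1, \<phi>2). (\<lambda>ls z l. h (\<phi>1 ls z l), \<lambda>ls z i j. h (\<phi>2 ls z i j)))"

definition coeff_triple ::
  "('g \<Rightarrow> 'h) \<Rightarrow> ('i, 'z, 'g) triple_cochain \<Rightarrow> ('i, 'z, 'h) triple_cochain" where
  "coeff_triple h = (\<lambda>(\<phi>0, p). (coeff0 h \<phi>0, coeff_pair h p))"

definition cech_seq :: "'z topology \<Rightarrow> 'i set \<Rightarrow> ('i \<Rightarrow> 'z set) \<Rightarrow>
    (('i, 'z, int) cochain, ('i, 'z, real) cochain, ('i, 'z, circle) cochain)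
      coefficient_sequence" where
  "cech_seq Z \<Lambda> W =
     \<lparr>sub_cx = cech_complex Z \<Lambda> W, mid_cx = cech_complex Z \<Lambda> W, quo_cx = cech_complex Z \<Lambda> W,
      inc = coeff0 real_of_int, prj = coeff0 circle_of\<rparr>"

definition twisted_seq :: "'z topology \<Rightarrow> 'i set \<Rightarrow> ('i \<Rightarrow> 'z set) \<Rightarrow> nat \<Rightarrow>
    ('i, 'z, nat \<Rightarrow> int) cochain \<Rightarrow>
    (('i, 'z, int) triple_cochain, ('i, 'z, real) triple_cochain, ('i, 'z, circle) triple_cochain)
      coefficient_sequence" where
  "twisted_seq Z \<Lambda> W n F =
     \<lparr>sub_cx = twisted_complex Z \<Lambda> W n F, mid_cx = twisted_complex Z \<Lambda> W n F,
      quo_cx = twisted_complex Z \<Lambda> W n F,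
      inc = coeff_triple real_of_int, prj = coeff_triple circle_of\<rparr>"

definition reduced_seq :: "'z topology \<Rightarrow> 'i set \<Rightarrow> ('i \<Rightarrow> 'z set) \<Rightarrow> nat \<Rightarrow>
    ('i, 'z, nat \<Rightarrow> int) cochain \<Rightarrow>
    (('i, 'z, int) pair_cochain, ('i, 'z, real) pair_cochain, ('i, 'z, circle) pair_cochain)
      coefficient_sequence" where
  "reduced_seq Z \<Lambda> W n F =
     \<lparr>sub_cx = reduced_complex Z \<Lambda> W n F, mid_cx = reduced_complex Z \<Lambda> W n F,
      quo_cx = reduced_complex Z \<Lambda> W n F,
      inc = coeff_pair real_of_int, prj = coeff_pair circle_of\<rparr>"

end

theory Submission
  imports Defs
begin

text \<open>Every row and every column of the diagram is the long exact cohomology sequence of a short exact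
  sequence of cochain complexes, and every square comes from maps that commute on cochains. What
  has to be shown is that the sequences of complexes exist and are exact.

  Rows. The twisted complex is the mapping cone of the product with \<open>F\<close>: it contains the Cech
  complex, with quotient the reduced complex shifted by one degree. A reduced cocycle \<open>x\<close> lifts to
  \<open>(0, x)\<close>, whose differential is \<open>(-1)\<^sup>k\<^sup>+\<^sup>1\<close> times the product of \<open>x\<close> with \<open>F\<close>; so the cup
  product with \<open>F\<close> is minus the connecting map (\<open>cup_F_eq_conn\<close>). That \<open>D\<^sub>F\<close> is a
  differential amounts to the product with \<open>F\<close> being a cochain map (\<open>cech_d_F_product\<close>). By the
  Leibniz rule (\<open>cech_d_cup\<close>) and the cocycle condition for \<open>F\<close>, this reduces to the identity
  \<open>\<partial> C(F)\<^sub>i\<^sub>j = F\<^sub>i \<union> F\<^sub>j - F\<^sub>j \<union> F\<^sub>i\<close> (\<open>cech_d_C_of\<close>): the two summands of the double product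
  with \<open>F\<close> are compensated by the coboundary of \<open>C(F)\<close>.

  Columns. The coefficient maps \<open>\<int> \<rightarrow> \<real> \<rightarrow> \<real>/\<int>\<close> commute with all operations, since these are
  integral combinations of values. The sequence of cochain groups is exact if continuous functions
  on the overlaps lift. A real function with integral values is locally constant, hence a
  continuous integral one (\<open>lifts_int\<close>). A function with values in the circle lifts to a real one
  because the overlaps are contractible (\<open>lifts_circle\<close>).

  Squares. The coefficient maps commute on cochains with the maps of the rows, and the connecting
  maps are natural (\<open>square_commutes_conn\<close>). The signs \<open>(-1)\<^sup>k\<^sup>+\<^sup>2\<close> of consecutive cup products with
  \<open>F\<close> are opposite, and so are those of the connecting maps in consecutive total degrees; the two
  changes cancel (\<open>conn_cup_F\<close>).\<close>

section \<open>The integer action on an abelian group\<close>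

lemma zmul_add1: "zmul (m + 1) x = zmul m x + x" for x :: "'g::ab_group_add"
proof (cases "0 \<le> m")
  case True
  then have "nat (m + 1) = Suc (nat m)" by simp
  with True show ?thesis by (simp add: zmul_def)
next
  case False
  then have "nat (- m) = Suc (nat (- (m + 1)))" by simp
  then have "zmul m x = - (\<Sum>_<nat (- (m + 1)). x) - x"
    using False by (simp add: zmul_def)
  moreover have "zmul (m + 1) x = - (\<Sum>_<nat (- (m + 1)). x)"
    using False by (cases "m = -1") (simp_all add: zmul_def)
  ultimately show ?thesis by simp
qed

lemma zmul_0_left [simp]: "zmul 0 x = 0"
  by (simp add: zmul_def)

lemma zmul_1_left [simp]: "zmul 1 x = x"
  by (simp add: zmul_def)

lemma zmul_add_left: "zmul (m + k) x = zmul m x + zmul k x" for x :: "'g::ab_group_add"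
proof (induction k rule: int_induct [where k = 0])
  case base
  show ?case by simp
next
  case (step1 i)
  then show ?case using zmul_add1 [of "m + i" x] zmul_add1 [of i x] by (simp add: add.assoc)
next
  case (step2 i)
  then show ?case using zmul_add1 [of "m + (i - 1)" x] zmul_add1 [of "i - 1" x]
    by (simp add: algebra_simps)
qed

lemma zmul_minus_left: "zmul (- m) x = - zmul m x" for x :: "'g::ab_group_add"
  using zmul_add_left [of "- m" m x] by (simp add: eq_neg_iff_add_eq_0)

lemma zmul_diff_left: "zmul (m - k) x = zmul m x - zmul k x" for x :: "'g::ab_group_add"
  using zmul_add_left [of m "- k" x] by (simp add: zmul_minus_left)

lemma zmul_sum_left: "zmul (\<Sum>i\<in>I. f i) x = (\<Sum>i\<in>I. zmul (f i) x)"
  for x :: "'g::ab_group_add"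
  by (induction I rule: infinite_finite_induct) (simp_all add: zmul_add_left)

lemma additive_zmul:
  fixes h :: "'g::ab_group_add \<Rightarrow> 'h::ab_group_add"
  assumes "\<And>x y. h (x + y) = h x + h y"
  shows "h (zmul m x) = zmul m (h x)"
proof -
  interpret additive h by unfold_locales (rule assms)
  show ?thesis by (simp add: zmul_def minus sum)
qed

lemma zmul_add_right: "zmul m (x + y) = zmul m x + zmul m y" for x :: "'g::ab_group_add"
  by (simp add: zmul_def sum.distrib)

lemma zmul_0_right [simp]: "zmul m (0 :: 'g::ab_group_add) = 0"
  by (simp add: zmul_def)

lemma zmul_minus_right: "zmul m (- x) = - zmul m x" for x :: "'g::ab_group_add"
  by (simp add: zmul_def sum_negf)

lemma zmul_diff_right: "zmul m (x - y) = zmul m x - zmul m y" for x :: "'g::ab_group_add"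
  using zmul_add_right [of m x "- y"] by (simp add: zmul_minus_right)

lemma zmul_sum_right: "zmul m (\<Sum>i\<in>I. f i) = (\<Sum>i\<in>I. zmul m (f i))"
  for f :: "_ \<Rightarrow> 'g::ab_group_add"
  by (induction I rule: infinite_finite_induct) (simp_all add: zmul_add_right)

lemma zmul_zmul: "zmul m (zmul k x) = zmul (m * k) x" for x :: "'g::ab_group_add"
proof (induction m rule: int_induct [where k = 0])
  case base
  show ?case by simp
next
  case (step1 i)
  then show ?case by (simp add: zmul_add1 zmul_add_left distrib_right)
next
  case (step2 i)
  then show ?case by (simp add: zmul_diff_left left_diff_distrib)
qed

lemma zmul_int [simp]: "zmul m (x :: int) = m * x"
  by (simp add: zmul_def)

lemma zmul_msign: "zmul (msign k) x = (if even k then x else - x)" for x :: "'g::ab_group_add"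
  by (simp add: msign_def zmul_minus_left)

lemma msign_add: "msign (j + k) = msign j * msign k"
  by (simp add: msign_def)

lemma msign_square [simp]: "msign k * msign k = 1"
  by (simp add: msign_def)

lemma zmul_msign_msign [simp]: "zmul (msign k) (zmul (msign k) x) = x"
  for x :: "'g::ab_group_add"
  by (simp add: zmul_zmul)


section \<open>Cohomology classes\<close>

locale complex =
  fixes D :: "'c::ab_group_add cochain_complex"
  assumes zero_mem: "0 \<in> obj D k"
    and minus_mem: "x \<in> obj D k \<Longrightarrow> y \<in> obj D k \<Longrightarrow> x - y \<in> obj D k"
    and diff_mem: "x \<in> obj D k \<Longrightarrow> diff D k x \<in> obj D (k + 1)"
    and diff_minus: "x \<in> obj D k \<Longrightarrow> y \<in> obj D k \<Longrightarrow>
      diff D k (x - y) = diff D k x - diff D k y"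
    and diff_diff: "x \<in> obj D k \<Longrightarrow> diff D (k + 1) (diff D k x) = 0"
begin

lemma diff_0: "diff D k 0 = 0"
  using diff_minus [of 0 k 0] zero_mem [of k] by simp

lemma uminus_mem: "x \<in> obj D k \<Longrightarrow> - x \<in> obj D k"
  using minus_mem [of 0 k x] zero_mem [of k] by simp

lemma add_mem: "x \<in> obj D k \<Longrightarrow> y \<in> obj D k \<Longrightarrow> x + y \<in> obj D k"
  using minus_mem [of x k "- y"] uminus_mem [of y k] by simp

lemma diff_uminus: "x \<in> obj D k \<Longrightarrow> diff D k (- x) = - diff D k x"
  using diff_minus [of 0 k x] zero_mem [of k] diff_0 by simp

lemma diff_add: "x \<in> obj D k \<Longrightarrow> y \<in> obj D k \<Longrightarrow> diff D k (x + y) = diff D k x + diff D k y"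
  using diff_minus [of x k "- y"] uminus_mem [of y k] diff_uminus [of y k] by simp

lemma msign_mem: "x \<in> obj D k \<Longrightarrow> zmul (msign t) x \<in> obj D k"
  by (simp add: zmul_msign uminus_mem)

lemma diff_msign: "x \<in> obj D k \<Longrightarrow> diff D k (zmul (msign t) x) = zmul (msign t) (diff D k x)"
  by (simp add: zmul_msign diff_uminus)

lemma in_cocycles: "x \<in> carrier (cocycle_group D k) \<longleftrightarrow> x \<in> obj D k \<and> diff D k x = 0"
  by (simp add: cocycle_group_def)

lemma coboundaryI: "x \<in> obj D (k - 1) \<Longrightarrow> diff D (k - 1) x \<in> coboundaries D k"
  by (simp add: coboundaries_def)

lemma coboundary_cocycle: "x \<in> coboundaries D k \<Longrightarrow> x \<in> carrier (cocycle_group D k)"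
  using diff_mem [of _ "k - 1"] diff_diff [of _ "k - 1"]
  by (auto simp: coboundaries_def in_cocycles)

lemma coboundary_minus:
  assumes "x \<in> coboundaries D k" "y \<in> coboundaries D k"
  shows "x - y \<in> coboundaries D k"
proof -
  obtain u v where "u \<in> obj D (k - 1)" "v \<in> obj D (k - 1)"
    "x = diff D (k - 1) u" "y = diff D (k - 1) v"
    using assms by (auto simp: coboundaries_def)
  then show ?thesis
    using coboundaryI [of "u - v" k] minus_mem [of u "k - 1" v] diff_minus [of u "k - 1" v] by simp
qed

lemma coboundary_0: "0 \<in> coboundaries D k"
  using coboundaryI [OF zero_mem] diff_0 by metis

lemma coboundary_uminus: "x \<in> coboundaries D k \<Longrightarrow> - x \<in> coboundaries D k"
  using coboundary_minus [OF coboundary_0, of x k] by simp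

lemma coboundary_add:
  "x \<in> coboundaries D k \<Longrightarrow> y \<in> coboundaries D k \<Longrightarrow> x + y \<in> coboundaries D k"
  using coboundary_minus [of x k "- y"] coboundary_uminus [of y k] by simp

lemma comm_group_cocycles: "comm_group (cocycle_group D k)"
proof (rule comm_groupI)
  fix x assume x: "x \<in> carrier (cocycle_group D k)"
  then have "- x \<in> carrier (cocycle_group D k)"
    by (simp add: in_cocycles uminus_mem diff_uminus)
  then show "\<exists>y\<in>carrier (cocycle_group D k). y \<otimes>\<^bsub>cocycle_group D k\<^esub> x = \<one>\<^bsub>cocycle_group D k\<^esub>"
    by (rule bexI [rotated]) (simp add: cocycle_group_def)
qed (auto simp: cocycle_group_def zero_mem diff_0 add_mem diff_add algebra_simps)

lemma inv_cocycle:
  assumes "x \<in> carrier (cocycle_group D k)"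
  shows "inv\<^bsub>cocycle_group D k\<^esub> x = - x"
proof -
  interpret comm_group "cocycle_group D k" by (rule comm_group_cocycles)
  have "- x \<in> carrier (cocycle_group D k)"
    using assms by (simp add: in_cocycles uminus_mem diff_uminus)
  with assms show ?thesis
    by (intro inv_equality) (simp_all add: cocycle_group_def)
qed

lemma normal_coboundaries: "coboundaries D k \<lhd> cocycle_group D k"
proof -
  interpret comm_group "cocycle_group D k" by (rule comm_group_cocycles)
  show ?thesis
  proof (rule subgroup_imp_normal, rule subgroupI)
    show "coboundaries D k \<subseteq> carrier (cocycle_group D k)"
      using coboundary_cocycle by blast
    show "coboundaries D k \<noteq> {}"
      using coboundary_0 by blast
    fix x y assume x: "x \<in> coboundaries D k" and y: "y \<in> coboundaries D k"
    show "inv\<^bsub>cocycle_group D k\<^esub> x \<in> coboundaries D k"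
      using x by (simp add: inv_cocycle coboundary_cocycle coboundary_uminus)
    show "x \<otimes>\<^bsub>cocycle_group D k\<^esub> y \<in> coboundaries D k"
      using coboundary_add [OF x y] by (simp add: cocycle_group_def)
  qed
qed

lemma group_cohomology: "group (cohomology D k)"
  unfolding cohomology_def by (rule normal.factorgroup_is_group [OF normal_coboundaries])

lemma hom_class: "coh_class D k \<in> hom (cocycle_group D k) (cohomology D k)"
  using normal.r_coset_hom_Mod [OF normal_coboundaries]
  unfolding coh_class_def cohomology_def .

lemma carrier_cohomology: "carrier (cohomology D k) = coh_class D k ` carrier (cocycle_group D k)"
  by (auto simp: cohomology_def FactGroup_def RCOSETS_def coh_class_def)

lemma class_in_cohomology:
  "x \<in> obj D k \<Longrightarrow> diff D k x = 0 \<Longrightarrow> coh_class D k x \<in> carrier (cohomology D k)"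
  unfolding carrier_cohomology by (simp add: in_cocycles)

lemma cohomology_classE:
  assumes "X \<in> carrier (cohomology D k)"
  obtains x where "x \<in> obj D k" "diff D k x = 0" "X = coh_class D k x"
  using assms unfolding carrier_cohomology by (auto simp: in_cocycles)

lemma cohomology_imageE:
  assumes "Y \<in> f ` carrier (cohomology D k)"
  obtains x where "x \<in> obj D k" "diff D k x = 0" "Y = f (coh_class D k x)"
  using assms by (auto elim: cohomology_classE)

lemma mem_class: "y \<in> coh_class D k x \<longleftrightarrow> y - x \<in> coboundaries D k"
  by (force simp: coh_class_def r_coset_def cocycle_group_def intro: bexI [where x = "y - x"])

lemma class_eq_iff: "coh_class D k x = coh_class D k y \<longleftrightarrow> x - y \<in> coboundaries D k"
proof
  assume "coh_class D k x = coh_class D k y"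
  then show "x - y \<in> coboundaries D k"
    using mem_class [of x k x] coboundary_0 [of k] mem_class [of x k y] by simp
next
  assume *: "x - y \<in> coboundaries D k"
  have "z - x \<in> coboundaries D k \<longleftrightarrow> z - y \<in> coboundaries D k" for z
    using coboundary_add [OF * , of "z - x"] coboundary_minus [OF _ *, of "z - y"]
    by (auto simp: algebra_simps)
  then show "coh_class D k x = coh_class D k y"
    by (auto simp: mem_class)
qed

lemma class_add:
  assumes "x \<in> obj D k" "diff D k x = 0" "y \<in> obj D k" "diff D k y = 0"
  shows "coh_class D k x \<otimes>\<^bsub>cohomology D k\<^esub> coh_class D k y = coh_class D k (x + y)"
  using hom_mult [OF hom_class, of x k y] assms
  by (simp add: in_cocycles) (simp add: cocycle_group_def)

lemma one_cohomology: "\<one>\<^bsub>cohomology D k\<^esub> = coh_class D k 0"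
  using hom_one [OF hom_class, of k] comm_group_cocycles [of k] group_cohomology [of k]
  by (simp add: cocycle_group_def comm_group.axioms)

lemma class_eq_one_iff:
  "coh_class D k x = \<one>\<^bsub>cohomology D k\<^esub> \<longleftrightarrow> x \<in> coboundaries D k"
  by (simp add: one_cohomology class_eq_iff)

lemma class_msign:
  assumes "x \<in> obj D k" "diff D k x = 0"
  shows "coh_class D k x [^]\<^bsub>cohomology D k\<^esub> msign t = coh_class D k (zmul (msign t) x)"
proof -
  interpret group "cohomology D k" by (rule group_cohomology)
  note x = class_in_cohomology [OF assms]
  have mx: "- x \<in> obj D k" "diff D k (- x) = 0"
    using assms by (simp_all add: uminus_mem diff_uminus)
  have "coh_class D k (- x) \<otimes>\<^bsub>cohomology D k\<^esub> coh_class D k x = \<one>\<^bsub>cohomology D k\<^esub>"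
    using class_add [OF mx assms] by (simp add: one_cohomology)
  then have "inv\<^bsub>cohomology D k\<^esub> coh_class D k x = coh_class D k (- x)"
    by (rule inv_equality) (use x class_in_cohomology [OF mx] in simp_all)
  then show ?thesis
    using x int_pow_neg [OF x, of 1] int_pow_1 [OF x] by (simp add: msign_def zmul_minus_left)
qed

end


section \<open>Maps of cohomology classes\<close>

text \<open>A single degree on each side suffices, so that this also covers maps that change the degree,
  such as the cup product with \<open>F\<close>.\<close>

locale cohomology_map = C: complex C + D: complex D
  for C :: "'c::ab_group_add cochain_complex" and D :: "'d::ab_group_add cochain_complex" +
  fixes k m :: int and f :: "'c \<Rightarrow> 'd"
  assumes map_mem: "x \<in> obj C k \<Longrightarrow> f x \<in> obj D m"
    and map_minus: "x \<in> obj C k \<Longrightarrow> y \<in> obj C k \<Longrightarrow> f (x - y) = f x - f y"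
    and map_cocycle: "x \<in> obj C k \<Longrightarrow> diff C k x = 0 \<Longrightarrow> diff D m (f x) = 0"
    and map_coboundary: "x \<in> obj C (k - 1) \<Longrightarrow> f (diff C (k - 1) x) \<in> coboundaries D m"
begin

lemma map_add: "x \<in> obj C k \<Longrightarrow> y \<in> obj C k \<Longrightarrow> f (x + y) = f x + f y"
  using map_minus [of 0 y] map_minus [of 0 0] map_minus [of x "0 - y"] C.uminus_mem [of y k]
    C.zero_mem [of k] by simp

lemma coh_map_class:
  assumes "x \<in> obj C k" "diff C k x = 0"
  shows "coh_map D m f (coh_class C k x) = coh_class D m (f x)"
proof -
  have "coh_class D m (f y) = coh_class D m (f x)" if y: "y \<in> coh_class C k x" for y
  proof -
    have b: "y - x \<in> coboundaries C k"
      using y C.mem_class by blast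
    then have "y - x \<in> obj C k"
      using C.coboundary_cocycle C.in_cocycles by blast
    then have "f ((y - x) + x) = f (y - x) + f x"
      using assms by (intro map_add)
    then have "f y - f x = f (y - x)" by simp
    moreover have "f (y - x) \<in> coboundaries D m"
      using b map_coboundary by (auto simp: coboundaries_def [of C])
    ultimately show ?thesis
      by (simp add: D.class_eq_iff)
  qed
  moreover have "x \<in> coh_class C k x"
    by (simp add: C.mem_class C.coboundary_0)
  ultimately show ?thesis
    unfolding coh_map_def by blast
qed

lemma group_hom_coh_map: "group_hom (cohomology C k) (cohomology D m) (coh_map D m f)"
proof (intro group_hom.intro group_hom_axioms.intro homI C.group_cohomology D.group_cohomology)
  fix X assume "X \<in> carrier (cohomology C k)"
  then obtain x where "x \<in> obj C k" "diff C k x = 0" "X = coh_class C k x"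
    by (rule C.cohomology_classE)
  then show "coh_map D m f X \<in> carrier (cohomology D m)"
    by (simp add: coh_map_class D.class_in_cohomology map_mem map_cocycle)
next
  fix X Y assume "X \<in> carrier (cohomology C k)" "Y \<in> carrier (cohomology C k)"
  then obtain x y where "x \<in> obj C k" "diff C k x = 0" "X = coh_class C k x"
    and "y \<in> obj C k" "diff C k y = 0" "Y = coh_class C k y"
    by (auto elim!: C.cohomology_classE)
  then show "coh_map D m f (X \<otimes>\<^bsub>cohomology C k\<^esub> Y) =
      coh_map D m f X \<otimes>\<^bsub>cohomology D m\<^esub> coh_map D m f Y"
    by (simp add: coh_map_class C.class_add D.class_add C.add_mem C.diff_add map_mem map_cocycle
        map_add)
qed

lemma map_msign: "x \<in> obj C k \<Longrightarrow> f (zmul (msign t) x) = zmul (msign t) (f x)"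
  using map_minus [of 0 x] map_minus [of 0 0] C.zero_mem [of k] by (simp add: zmul_msign)

end

lemma square_commutes_coh_map:
  assumes "cohomology_map C D k m f" "cohomology_map D E m l g"
    and "cohomology_map C D' k m' f'" "cohomology_map D' E m' l g'"
    and "\<And>x. x \<in> obj C k \<Longrightarrow> g (f x) = g' (f' x)"
  shows "square_commutes (cohomology C k) (coh_map D m f) (coh_map E l g)
    (coh_map D' m' f') (coh_map E l g')"
  unfolding square_commutes_def
proof
  interpret f: cohomology_map C D k m f by fact
  interpret g: cohomology_map D E m l g by fact
  interpret f': cohomology_map C D' k m' f' by fact
  interpret g': cohomology_map D' E m' l g' by fact
  fix X assume "X \<in> carrier (cohomology C k)"
  then obtain x where x: "x \<in> obj C k" "diff C k x = 0" "X = coh_class C k x"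
    by (rule f.C.cohomology_classE)
  then show "coh_map E l g (coh_map D m f X) = coh_map E l g' (coh_map D' m' f' X)"
    using assms(5) by (simp add: f.coh_map_class g.coh_map_class f'.coh_map_class
        g'.coh_map_class f.map_mem f.map_cocycle f'.map_mem f'.map_cocycle)
qed


section \<open>The long exact sequence of a short exact sequence of complexes\<close>

locale short_exact =
  A: complex "sub_cx S" + B: complex "mid_cx S" + C: complex "quo_cx S"
  for S :: "('a::ab_group_add, 'b::ab_group_add, 'c::ab_group_add) coefficient_sequence" +
  assumes inc_mem: "a \<in> obj (sub_cx S) k \<Longrightarrow> inc S a \<in> obj (mid_cx S) k"
    and inc_minus: "a \<in> obj (sub_cx S) k \<Longrightarrow> a' \<in> obj (sub_cx S) k \<Longrightarrow>
      inc S (a - a') = inc S a - inc S a'"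
    and inc_diff: "a \<in> obj (sub_cx S) k \<Longrightarrow>
      inc S (diff (sub_cx S) k a) = diff (mid_cx S) k (inc S a)"
    and inc_inj: "a \<in> obj (sub_cx S) k \<Longrightarrow> inc S a = 0 \<Longrightarrow> a = 0"
    and prj_mem: "b \<in> obj (mid_cx S) k \<Longrightarrow> prj S b \<in> obj (quo_cx S) k"
    and prj_minus: "b \<in> obj (mid_cx S) k \<Longrightarrow> b' \<in> obj (mid_cx S) k \<Longrightarrow>
      prj S (b - b') = prj S b - prj S b'"
    and prj_diff: "b \<in> obj (mid_cx S) k \<Longrightarrow>
      prj S (diff (mid_cx S) k b) = diff (quo_cx S) k (prj S b)"
    and prj_surj: "c \<in> obj (quo_cx S) k \<Longrightarrow> \<exists>b\<in>obj (mid_cx S) k. prj S b = c"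
    and prj_inc: "a \<in> obj (sub_cx S) k \<Longrightarrow> prj S (inc S a) = 0"
    and prj_kernel: "b \<in> obj (mid_cx S) k \<Longrightarrow> prj S b = 0 \<Longrightarrow> \<exists>a\<in>obj (sub_cx S) k. inc S a = b"
begin

lemma inc_eqD:
  "inc S a = inc S a' \<Longrightarrow> a \<in> obj (sub_cx S) k \<Longrightarrow> a' \<in> obj (sub_cx S) k \<Longrightarrow> a = a'"
  using inc_inj [of "a - a'" k] inc_minus [of a k a'] A.minus_mem [of a k a'] by simp

sublocale inc: cohomology_map "sub_cx S" "mid_cx S" k k "inc S" for k
proof
  fix a assume a: "a \<in> obj (sub_cx S) k" "diff (sub_cx S) k a = 0"
  then show "diff (mid_cx S) k (inc S a) = 0"
    using inc_diff [of a k] inc_minus [of 0 k 0] A.zero_mem [of k] A.zero_mem [of "k + 1"]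
      inc_minus [of 0 "k + 1" 0] by simp
next
  fix a assume a: "a \<in> obj (sub_cx S) (k - 1)"
  then show "inc S (diff (sub_cx S) (k - 1) a) \<in> coboundaries (mid_cx S) k"
    by (simp add: inc_diff inc_mem B.coboundaryI)
qed (simp_all add: inc_mem inc_minus)

sublocale prj: cohomology_map "mid_cx S" "quo_cx S" k k "prj S" for k
proof
  fix b assume b: "b \<in> obj (mid_cx S) k" "diff (mid_cx S) k b = 0"
  then show "diff (quo_cx S) k (prj S b) = 0"
    using prj_diff [of b k] B.zero_mem [of "k + 1"] prj_minus [of 0 "k + 1" 0] by simp
next
  fix b assume b: "b \<in> obj (mid_cx S) (k - 1)"
  then show "prj S (diff (mid_cx S) (k - 1) b) \<in> coboundaries (quo_cx S) k"
    by (simp add: prj_diff prj_mem C.coboundaryI)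
qed (simp_all add: prj_mem prj_minus)

text \<open>\<open>connects k x b a\<close>: the zig-zag of the snake lemma from the cocycle \<open>x\<close> through its lift
  \<open>b\<close> to \<open>a\<close>.\<close>

definition connects :: "int \<Rightarrow> 'c \<Rightarrow> 'b \<Rightarrow> 'a \<Rightarrow> bool" where
  "connects k x b a \<longleftrightarrow> b \<in> obj (mid_cx S) k \<and> prj S b = x \<and>
     a \<in> obj (sub_cx S) (k + 1) \<and> inc S a = diff (mid_cx S) k b"

lemma connects_exists:
  assumes "x \<in> obj (quo_cx S) k" "diff (quo_cx S) k x = 0"
  obtains b a where "connects k x b a"
proof -
  obtain b where b: "b \<in> obj (mid_cx S) k" "prj S b = x"
    using prj_surj assms by blast
  then have "prj S (diff (mid_cx S) k b) = 0"
    using assms prj_diff by simp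
  then obtain a where "a \<in> obj (sub_cx S) (k + 1)" "inc S a = diff (mid_cx S) k b"
    using prj_kernel [OF B.diff_mem] b by blast
  with b that show thesis by (simp add: connects_def)
qed

lemma connects_cocycle:
  assumes "connects k x b a"
  shows "a \<in> obj (sub_cx S) (k + 1)" "diff (sub_cx S) (k + 1) a = 0"
proof -
  show a: "a \<in> obj (sub_cx S) (k + 1)"
    using assms by (simp add: connects_def)
  have "inc S (diff (sub_cx S) (k + 1) a) = 0"
    using assms inc_diff [OF a] B.diff_diff by (simp add: connects_def)
  then show "diff (sub_cx S) (k + 1) a = 0"
    using inc_inj A.diff_mem [OF a] by blast
qed

text \<open>The class of \<open>a\<close> depends only on the class of \<open>x\<close>: two lifts of cohomologous cocycles differ
  by a coboundary and an element of the subcomplex.\<close>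

lemma connects_unique:
  assumes "connects k x b a" "connects k x' b' a'" "x' - x \<in> coboundaries (quo_cx S) k"
  shows "coh_class (sub_cx S) (k + 1) a' = coh_class (sub_cx S) (k + 1) a"
proof -
  note b = assms(1,2) [unfolded connects_def]
  obtain c where c: "c \<in> obj (quo_cx S) (k - 1)" "x' - x = diff (quo_cx S) (k - 1) c"
    using assms(3) by (auto simp: coboundaries_def)
  obtain e where e: "e \<in> obj (mid_cx S) (k - 1)" "prj S e = c"
    using c prj_surj by blast
  have de: "diff (mid_cx S) (k - 1) e \<in> obj (mid_cx S) k"
    "diff (mid_cx S) k (diff (mid_cx S) (k - 1) e) = 0"
    using B.diff_mem [OF e(1)] B.diff_diff [OF e(1)] by simp_all
  let ?r = "b' - b - diff (mid_cx S) (k - 1) e"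
  have r: "?r \<in> obj (mid_cx S) k"
    using b de by (simp add: B.minus_mem)
  have "prj S ?r = 0"
    using b de e c by (simp add: prj_minus [of _ k] B.minus_mem prj_diff)
  then obtain q where q: "q \<in> obj (sub_cx S) k" "inc S q = ?r"
    using prj_kernel r by blast
  have "inc S (a' - a) = diff (mid_cx S) k ?r"
    using b de by (simp add: inc_minus [of _ "k + 1"] B.diff_minus B.minus_mem)
  also have "\<dots> = inc S (diff (sub_cx S) k q)"
    using q inc_diff by simp
  finally have "a' - a = diff (sub_cx S) k q"
    using b q by (auto intro!: inc_eqD [of _ _ "k + 1"] A.minus_mem A.diff_mem)
  then show ?thesis
    using q A.coboundaryI [of q "k + 1"] by (simp add: A.class_eq_iff)
qed

lemma snake_class:
  assumes "connects k x b a"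
  shows "snake S k (coh_class (quo_cx S) k x) = coh_class (sub_cx S) (k + 1) a"
proof -
  have "coh_class (sub_cx S) (k + 1) a' = coh_class (sub_cx S) (k + 1) a"
    if "b' \<in> obj (mid_cx S) k" "prj S b' \<in> coh_class (quo_cx S) k x"
      "a' \<in> obj (sub_cx S) (k + 1)" "inc S a' = diff (mid_cx S) k b'" for a' b'
    using connects_unique [OF assms, of "prj S b'" b' a'] that
    by (simp add: connects_def C.mem_class)
  moreover have "b \<in> obj (mid_cx S) k" "prj S b \<in> coh_class (quo_cx S) k x"
      "a \<in> obj (sub_cx S) (k + 1)" "inc S a = diff (mid_cx S) k b"
    using assms by (simp_all add: connects_def C.mem_class C.coboundary_0)
  ultimately show ?thesis
    unfolding snake_def by blast
qed

lemma conn_class: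
  assumes "connects k x b a"
  shows "conn_coh S t k (coh_class (quo_cx S) k x) =
    coh_class (sub_cx S) (k + 1) (zmul (msign t) a)"
  unfolding conn_coh_def snake_class [OF assms]
  by (rule A.class_msign [OF connects_cocycle [OF assms]])

lemma group_hom_conn:
  "group_hom (cohomology (quo_cx S) k) (cohomology (sub_cx S) (k + 1)) (conn_coh S t k)"
proof (intro group_hom.intro group_hom_axioms.intro homI C.group_cohomology A.group_cohomology)
  fix X assume "X \<in> carrier (cohomology (quo_cx S) k)"
  then obtain x where x: "x \<in> obj (quo_cx S) k" "diff (quo_cx S) k x = 0"
    "X = coh_class (quo_cx S) k x"
    by (rule C.cohomology_classE)
  then obtain b a where ba: "connects k x b a"
    using connects_exists by blast
  show "conn_coh S t k X \<in> carrier (cohomology (sub_cx S) (k + 1))"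
    using connects_cocycle [OF ba] x
    by (simp add: conn_class [OF ba] A.class_in_cohomology A.msign_mem A.diff_msign)
next
  fix X Y assume "X \<in> carrier (cohomology (quo_cx S) k)" "Y \<in> carrier (cohomology (quo_cx S) k)"
  then obtain x y where x: "x \<in> obj (quo_cx S) k" "diff (quo_cx S) k x = 0"
    "X = coh_class (quo_cx S) k x" and y: "y \<in> obj (quo_cx S) k" "diff (quo_cx S) k y = 0"
    "Y = coh_class (quo_cx S) k y"
    by (auto elim!: C.cohomology_classE)
  obtain b a where ba: "connects k x b a"
    using x connects_exists by blast
  obtain b' a' where ba': "connects k y b' a'"
    using y connects_exists by blast
  have sum: "connects k (x + y) (b + b') (a + a')"
    using ba ba' unfolding connects_def
    by (auto simp: B.add_mem A.add_mem prj.map_add inc.map_add [of _ "k + 1"] B.diff_add)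
  show "conn_coh S t k (X \<otimes>\<^bsub>cohomology (quo_cx S) k\<^esub> Y) =
      conn_coh S t k X \<otimes>\<^bsub>cohomology (sub_cx S) (k + 1)\<^esub> conn_coh S t k Y"
    using x y connects_cocycle [OF ba] connects_cocycle [OF ba']
    by (simp add: C.class_add conn_class [OF ba] conn_class [OF ba'] conn_class [OF sum]
        A.class_add A.msign_mem A.diff_msign zmul_add_right)
qed

lemma exact_at_mid:
  "exact_at (cohomology (sub_cx S) k) (cohomology (mid_cx S) k) (cohomology (quo_cx S) k)
     (inc_coh S k) (prj_coh S k)"
  unfolding exact_at_def inc_coh_def prj_coh_def
proof (intro conjI inc.group_hom_coh_map prj.group_hom_coh_map equalityI subsetI)
  fix Y assume "Y \<in> kernel (cohomology (mid_cx S) k) (cohomology (quo_cx S) k)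
    (coh_map (quo_cx S) k (prj S))"
  then have Y: "Y \<in> carrier (cohomology (mid_cx S) k)"
    "coh_map (quo_cx S) k (prj S) Y = \<one>\<^bsub>cohomology (quo_cx S) k\<^esub>"
    by (auto simp: kernel_def)
  then obtain b where b: "b \<in> obj (mid_cx S) k" "diff (mid_cx S) k b = 0"
    "Y = coh_class (mid_cx S) k b"
    by (auto elim!: B.cohomology_classE)
  with Y have "prj S b \<in> coboundaries (quo_cx S) k"
    by (simp add: prj.coh_map_class C.class_eq_one_iff)
  then obtain c where c: "c \<in> obj (quo_cx S) (k - 1)" "prj S b = diff (quo_cx S) (k - 1) c"
    by (auto simp: coboundaries_def)
  then obtain e where e: "e \<in> obj (mid_cx S) (k - 1)" "prj S e = c"
    using prj_surj by blast
  have de: "diff (mid_cx S) (k - 1) e \<in> obj (mid_cx S) k"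
    "diff (mid_cx S) k (diff (mid_cx S) (k - 1) e) = 0"
    using B.diff_mem [OF e(1)] B.diff_diff [OF e(1)] by simp_all
  let ?r = "b - diff (mid_cx S) (k - 1) e"
  have "prj S ?r = 0"
    using b c e de by (simp add: prj_minus [of _ k] prj_diff)
  then obtain a where a: "a \<in> obj (sub_cx S) k" "inc S a = ?r"
    using prj_kernel b de B.minus_mem by metis
  have "inc S (diff (sub_cx S) k a) = 0"
    using a b de by (simp add: inc_diff B.diff_minus)
  then have da: "diff (sub_cx S) k a = 0"
    using inc_inj A.diff_mem [OF a(1)] by blast
  have "Y = coh_class (mid_cx S) k (inc S a)"
    using a b B.coboundaryI [OF e(1)] by (simp add: B.class_eq_iff)
  then have "Y = coh_map (mid_cx S) k (inc S) (coh_class (sub_cx S) k a)"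
    using a da by (simp add: inc.coh_map_class)
  then show "Y \<in> coh_map (mid_cx S) k (inc S) ` carrier (cohomology (sub_cx S) k)"
    using a da A.class_in_cohomology by blast
next
  fix Y assume "Y \<in> coh_map (mid_cx S) k (inc S) ` carrier (cohomology (sub_cx S) k)"
  then obtain a where a: "a \<in> obj (sub_cx S) k" "diff (sub_cx S) k a = 0"
    "Y = coh_map (mid_cx S) k (inc S) (coh_class (sub_cx S) k a)"
    by (rule A.cohomology_imageE)
  then have "Y = coh_class (mid_cx S) k (inc S a)"
    by (simp add: inc.coh_map_class)
  then show "Y \<in> kernel (cohomology (mid_cx S) k) (cohomology (quo_cx S) k)
    (coh_map (quo_cx S) k (prj S))"
    using a by (simp add: kernel_def prj.coh_map_class inc.map_mem inc.map_cocycle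
        B.class_in_cohomology prj_inc C.one_cohomology)
qed

lemma exact_at_quo:
  "exact_at (cohomology (mid_cx S) k) (cohomology (quo_cx S) k) (cohomology (sub_cx S) (k + 1))
     (prj_coh S k) (conn_coh S t k)"
  unfolding exact_at_def prj_coh_def
proof (intro conjI prj.group_hom_coh_map group_hom_conn equalityI subsetI)
  fix X assume "X \<in> kernel (cohomology (quo_cx S) k) (cohomology (sub_cx S) (k + 1))
    (conn_coh S t k)"
  then have X: "X \<in> carrier (cohomology (quo_cx S) k)"
    "conn_coh S t k X = \<one>\<^bsub>cohomology (sub_cx S) (k + 1)\<^esub>"
    by (auto simp: kernel_def)
  then obtain x where x: "x \<in> obj (quo_cx S) k" "diff (quo_cx S) k x = 0"
    "X = coh_class (quo_cx S) k x"
    by (auto elim!: C.cohomology_classE)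
  obtain b a where ba: "connects k x b a"
    using x connects_exists by blast
  have "zmul (msign t) a \<in> coboundaries (sub_cx S) (k + 1)"
    using X x by (simp add: conn_class [OF ba] A.class_eq_one_iff)
  then have "a \<in> coboundaries (sub_cx S) (k + 1)"
    using A.coboundary_uminus [of "- a" "k + 1"] by (simp add: zmul_msign split: if_splits)
  then obtain q where q: "q \<in> obj (sub_cx S) k" "a = diff (sub_cx S) k q"
    by (auto simp: coboundaries_def)
  let ?b = "b - inc S q"
  note ba = ba [unfolded connects_def]
  have b: "?b \<in> obj (mid_cx S) k" "diff (mid_cx S) k ?b = 0" "prj S ?b = x"
    using ba q by (auto simp: B.minus_mem inc_mem B.diff_minus inc_diff prj_minus [of _ k] prj_inc)
  then have "X = coh_map (quo_cx S) k (prj S) (coh_class (mid_cx S) k ?b)"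
    using x by (simp add: prj.coh_map_class)
  then show "X \<in> coh_map (quo_cx S) k (prj S) ` carrier (cohomology (mid_cx S) k)"
    using B.class_in_cohomology [OF b(1,2)] by blast
next
  fix X assume "X \<in> coh_map (quo_cx S) k (prj S) ` carrier (cohomology (mid_cx S) k)"
  then obtain b where b: "b \<in> obj (mid_cx S) k" "diff (mid_cx S) k b = 0"
    "X = coh_map (quo_cx S) k (prj S) (coh_class (mid_cx S) k b)"
    by (rule B.cohomology_imageE)
  then have X: "X = coh_class (quo_cx S) k (prj S b)"
    by (simp add: prj.coh_map_class)
  have "connects k (prj S b) b 0"
    using b inc_minus [of 0 "k + 1" 0] A.zero_mem [of "k + 1"] by (simp add: connects_def)
  then have "conn_coh S t k X = \<one>\<^bsub>cohomology (sub_cx S) (k + 1)\<^esub>"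
    by (simp add: X conn_class A.one_cohomology)
  then show "X \<in> kernel (cohomology (quo_cx S) k) (cohomology (sub_cx S) (k + 1))
    (conn_coh S t k)"
    using b(1,2) by (simp add: X kernel_def C.class_in_cohomology prj_mem prj.map_cocycle)
qed

lemma exact_at_sub:
  "exact_at (cohomology (quo_cx S) k) (cohomology (sub_cx S) (k + 1)) (cohomology (mid_cx S) (k + 1))
     (conn_coh S t k) (inc_coh S (k + 1))"
  unfolding exact_at_def inc_coh_def
proof (intro conjI inc.group_hom_coh_map group_hom_conn equalityI subsetI)
  fix Y assume "Y \<in> kernel (cohomology (sub_cx S) (k + 1)) (cohomology (mid_cx S) (k + 1))
    (coh_map (mid_cx S) (k + 1) (inc S))"
  then have Y: "Y \<in> carrier (cohomology (sub_cx S) (k + 1))"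
    "coh_map (mid_cx S) (k + 1) (inc S) Y = \<one>\<^bsub>cohomology (mid_cx S) (k + 1)\<^esub>"
    by (auto simp: kernel_def)
  then obtain a where a: "a \<in> obj (sub_cx S) (k + 1)" "diff (sub_cx S) (k + 1) a = 0"
    "Y = coh_class (sub_cx S) (k + 1) a"
    by (auto elim!: A.cohomology_classE)
  with Y have "inc S a \<in> coboundaries (mid_cx S) (k + 1)"
    by (simp add: inc.coh_map_class B.class_eq_one_iff)
  then obtain b where b: "b \<in> obj (mid_cx S) k" "inc S a = diff (mid_cx S) k b"
    by (auto simp: coboundaries_def)
  let ?x = "prj S (zmul (msign t) b)"
  have mb: "zmul (msign t) b \<in> obj (mid_cx S) k"
    using b by (simp add: B.msign_mem)
  \<comment> \<open>Lifting \<open>(-1)\<^sup>t b\<close> instead of \<open>b\<close> cancels the sign of the connecting map.\<close>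
  have conn: "connects k ?x (zmul (msign t) b) (zmul (msign t) a)"
    using a b mb by (simp add: connects_def A.msign_mem inc.map_msign [of _ "k + 1"] B.diff_msign)
  have "diff (quo_cx S) k ?x = prj S (inc S (zmul (msign t) a))"
    using conn mb by (simp add: connects_def prj_diff)
  then have x: "?x \<in> obj (quo_cx S) k" "diff (quo_cx S) k ?x = 0"
    using mb a by (simp_all add: prj_mem prj_inc [of _ "k + 1"] A.msign_mem)
  have "Y = conn_coh S t k (coh_class (quo_cx S) k ?x)"
    using a by (simp add: conn_class [OF conn])
  then show "Y \<in> conn_coh S t k ` carrier (cohomology (quo_cx S) k)"
    using C.class_in_cohomology [OF x] by blast
next
  fix Y assume "Y \<in> conn_coh S t k ` carrier (cohomology (quo_cx S) k)"
  then obtain x where x: "x \<in> obj (quo_cx S) k" "diff (quo_cx S) k x = 0"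
    "Y = conn_coh S t k (coh_class (quo_cx S) k x)"
    by (rule C.cohomology_imageE)
  obtain b a where ba: "connects k x b a"
    using x connects_exists by blast
  let ?a = "zmul (msign t) a"
  have a: "?a \<in> obj (sub_cx S) (k + 1)" "diff (sub_cx S) (k + 1) ?a = 0"
    using connects_cocycle [OF ba] by (simp_all add: A.msign_mem A.diff_msign)
  have Y: "Y = coh_class (sub_cx S) (k + 1) ?a"
    using x by (simp add: conn_class [OF ba])
  have "inc S ?a = diff (mid_cx S) k (zmul (msign t) b)"
    using ba by (simp add: connects_def inc.map_msign [of _ "k + 1"] B.diff_msign)
  then have "inc S ?a \<in> coboundaries (mid_cx S) (k + 1)"
    using B.coboundaryI [of "zmul (msign t) b" "k + 1"] ba
    by (simp add: connects_def B.msign_mem)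
  then show "Y \<in> kernel (cohomology (sub_cx S) (k + 1)) (cohomology (mid_cx S) (k + 1))
    (coh_map (mid_cx S) (k + 1) (inc S))"
    using a by (simp add: Y kernel_def A.class_in_cohomology inc.coh_map_class B.class_eq_one_iff)
qed

lemma column_exact: "column_exact S s"
  unfolding column_exact_def Let_def
  using exact_at_mid exact_at_quo exact_at_sub by blast

end

text \<open>Naturality of the connecting maps. The degrees and the signs of the two sequences may
  differ; the zig-zag of \<open>S\<close> has to be carried to one of \<open>T\<close> up to the product of the signs.\<close>

lemma square_commutes_conn:
  assumes "short_exact S" "short_exact T"
    and "cohomology_map (quo_cx S) (quo_cx T) k m h"
    and "cohomology_map (sub_cx S) (sub_cx T) (k + 1) (m + 1) f"
    and "\<And>b. b \<in> obj (mid_cx S) k \<Longrightarrow> g b \<in> obj (mid_cx T) m"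
    and "\<And>b. b \<in> obj (mid_cx S) k \<Longrightarrow> prj T (g b) = h (prj S b)"
    and "\<And>a b. a \<in> obj (sub_cx S) (k + 1) \<Longrightarrow> b \<in> obj (mid_cx S) k \<Longrightarrow>
      inc S a = diff (mid_cx S) k b \<Longrightarrow>
      inc T (f a) = zmul (msign (t + u)) (diff (mid_cx T) m (g b))"
  shows "square_commutes (cohomology (quo_cx S) k)
    (coh_map (quo_cx T) m h) (conn_coh T u m)
    (conn_coh S t k) (coh_map (sub_cx T) (m + 1) f)"
  unfolding square_commutes_def
proof
  interpret S: short_exact S by fact
  interpret T: short_exact T by fact
  interpret h: cohomology_map "quo_cx S" "quo_cx T" k m h by fact
  interpret f: cohomology_map "sub_cx S" "sub_cx T" "k + 1" "m + 1" f by fact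
  fix X assume "X \<in> carrier (cohomology (quo_cx S) k)"
  then obtain x where x: "x \<in> obj (quo_cx S) k" "diff (quo_cx S) k x = 0"
    "X = coh_class (quo_cx S) k x"
    by (rule S.C.cohomology_classE)
  obtain b a where ba: "S.connects k x b a"
    using x S.connects_exists by blast
  note a = S.connects_cocycle [OF ba]
  let ?a = "zmul (msign (t + u)) (f a)"
  have "inc T (f a) = zmul (msign (t + u)) (diff (mid_cx T) m (g b))"
    using ba by (intro assms(7)) (simp_all add: S.connects_def)
  then have "T.connects m (h x) (g b) ?a"
    using ba a assms(5,6)
    by (simp add: S.connects_def T.connects_def T.A.msign_mem f.map_mem
        T.inc.map_msign [of _ "m + 1"])
  then have "conn_coh T u m (coh_map (quo_cx T) m h X) =
      coh_class (sub_cx T) (m + 1) (zmul (msign u) ?a)"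
    using x by (simp add: h.coh_map_class T.conn_class)
  also have "zmul (msign u) ?a = f (zmul (msign t) a)"
    using a by (simp add: f.map_msign zmul_zmul msign_add mult.left_commute)
  also have "coh_class (sub_cx T) (m + 1) \<dots> =
      coh_map (sub_cx T) (m + 1) f (conn_coh S t k X)"
    using x a by (simp add: S.conn_class [OF ba] f.coh_map_class S.A.msign_mem S.A.diff_msign)
  finally show "conn_coh T u m (coh_map (quo_cx T) m h X) =
      coh_map (sub_cx T) (m + 1) f (conn_coh S t k X)" .
qed


section \<open>Topological groups of coefficients\<close>

lemma circle_of_eq_iff: "circle_of x = circle_of y \<longleftrightarrow> x - y \<in> \<int>"
  by (simp add: circle.abs_eq_iff)

lemma circle_of_add: "circle_of (x + y) = circle_of x + circle_of y"
  by (simp add: plus_circle.abs_eq)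

lemma circle_of_uminus: "circle_of (- x) = - circle_of x"
  by (simp add: uminus_circle.abs_eq)

lemma circle_of_diff: "circle_of (x - y) = circle_of x - circle_of y"
  by (simp add: minus_circle.abs_eq)

lemma circle_of_eq_0_iff: "circle_of x = 0 \<longleftrightarrow> x \<in> \<int>"
  by (simp add: zero_circle_def circle_of_eq_iff)

lemma circle_of_surj: obtains r where "c = circle_of r"
  by (metis Quotient_abs_rep [OF Quotient_circle])

lemma isCont_circle_of: "isCont circle_of x"
proof -
  have "continuous_on UNIV circle_of"
    by (auto simp: continuous_on_open_vimage open_circle_def)
  then show ?thesis by (simp add: continuous_on_eq_continuous_at)
qed

lemma open_circle_of_image:
  assumes "open U"
  shows "open (circle_of ` U)"
proof -
  have "circle_of -` (circle_of ` U) = (\<Union>n\<in>\<int>. (+) n ` U)" (is "?L = ?R")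
  proof
    show "?L \<subseteq> ?R"
    proof
      fix x assume "x \<in> ?L"
      then obtain u where "u \<in> U" "x - u \<in> \<int>"
        by (auto simp: circle_of_eq_iff)
      then show "x \<in> ?R" by (intro UN_I [of "x - u"]) auto
    qed
    show "?R \<subseteq> ?L"
    proof
      fix x assume "x \<in> ?R"
      then obtain n u where "n \<in> \<int>" "u \<in> U" "x = n + u" by blast
      then show "x \<in> ?L" by (auto simp: circle_of_eq_iff intro!: image_eqI [of _ _ u])
    qed
  qed
  then show ?thesis
    using assms by (auto simp: open_circle_def open_translation)
qed

text \<open>As the quotient map is open as well as continuous, limits in the circle can be computed on real
  representatives; the continuity of the group operations follows.\<close>

lemma nhds_circle_of: "nhds (circle_of x) = filtermap circle_of (nhds x)"
  by (rule filtermap_nhds_open_map [symmetric, OF isCont_circle_of open_circle_of_image])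

instance circle :: topological_ab_group_add
proof
  fix a b :: circle
  obtain r s where rs: "a = circle_of r" "b = circle_of s"
    by (metis circle_of_surj)
  have "((\<lambda>x. circle_of (fst x + snd x)) \<longlongrightarrow> circle_of (r + s)) (nhds r \<times>\<^sub>F nhds s)"
    by (rule isCont_tendsto_compose [OF isCont_circle_of tendsto_add_Pair])
  then show "((\<lambda>x. fst x + snd x) \<longlongrightarrow> a + b) (nhds a \<times>\<^sub>F nhds b)"
    unfolding rs circle_of_add [symmetric] nhds_circle_of prod_filtermap1 prod_filtermap2 filterlim_filtermap
    by (simp add: circle_of_add)
  have "((\<lambda>x. circle_of (- x)) \<longlongrightarrow> circle_of (- r)) (nhds r)"
    by (rule isCont_tendsto_compose [OF isCont_circle_of tendsto_uminus_nhds])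
  then show "(uminus \<longlongrightarrow> - a) (nhds a)"
    unfolding rs circle_of_uminus [symmetric] nhds_circle_of filterlim_filtermap
    by (simp add: circle_of_uminus)
qed

instance int :: topological_ab_group_add
  by standard (simp_all add: nhds_discrete principal_prod_principal filterlim_principal
      eventually_principal tendsto_principal_singleton)

lemma tendsto_fun_iff:
  fixes f :: "'x \<Rightarrow> 'j \<Rightarrow> 'a::topological_space"
  shows "(f \<longlongrightarrow> l) F \<longleftrightarrow> (\<forall>i. ((\<lambda>x. f x i) \<longlongrightarrow> l i) F)"
  using limitin_componentwise [of "\<lambda>i. euclidean" UNIV f l F]
  by (simp add: euclidean_product_topology)

instance "fun" :: (type, topological_ab_group_add) topological_ab_group_add
proof
  fix a b :: "'a \<Rightarrow> 'b"
  have "((\<lambda>x :: ('a \<Rightarrow> 'b) \<times> ('a \<Rightarrow> 'b). fst x i) \<longlongrightarrow> a i) (nhds a \<times>\<^sub>F nhds b)" for i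
    using filterlim_fst [of "nhds a" "nhds b"] by (simp add: tendsto_fun_iff)
  moreover have "((\<lambda>x :: ('a \<Rightarrow> 'b) \<times> ('a \<Rightarrow> 'b). snd x i) \<longlongrightarrow> b i) (nhds a \<times>\<^sub>F nhds b)" for i
    using filterlim_snd [of "nhds b" "nhds a"] by (simp add: tendsto_fun_iff)
  ultimately show "((\<lambda>x. fst x + snd x) \<longlongrightarrow> a + b) (nhds a \<times>\<^sub>F nhds b)"
    by (simp add: tendsto_fun_iff tendsto_add)
  have "((\<lambda>x. x i) \<longlongrightarrow> a i) (nhds a)" for i
    using filterlim_ident [of "nhds a"] by (simp add: tendsto_fun_iff)
  then show "(uminus \<longlongrightarrow> - a) (nhds a)"
    by (simp add: tendsto_fun_iff tendsto_minus)
qed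

text \<open>Continuity on an abstract topological space in terms of limits, to which the limit laws of
  topological groups apply.\<close>

lemma continuous_map_tendsto:
  "continuous_map X euclidean f \<longleftrightarrow> (\<forall>x\<in>topspace X. (f \<longlongrightarrow> f x) (atin X x))"
  by (simp add: continuous_map_atin)

lemma continuous_map_fun_iff:
  fixes f :: "'z \<Rightarrow> 'j \<Rightarrow> 'a::topological_space"
  shows "continuous_map X euclidean f \<longleftrightarrow> (\<forall>i. continuous_map X euclidean (\<lambda>x. f x i))"
  unfolding continuous_map_tendsto tendsto_fun_iff [of f] by blast

lemma continuous_map_group_minus:
  fixes f g :: "'z \<Rightarrow> 'a::topological_ab_group_add"
  assumes "continuous_map X euclidean f" "continuous_map X euclidean g"
  shows "continuous_map X euclidean (\<lambda>x. f x - g x)"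
  using assms unfolding continuous_map_tendsto by (blast intro: tendsto_diff)

lemma continuous_map_group_sum:
  fixes f :: "'j \<Rightarrow> 'z \<Rightarrow> 'a::topological_ab_group_add"
  assumes "\<And>i. i \<in> I \<Longrightarrow> continuous_map X euclidean (f i)"
  shows "continuous_map X euclidean (\<lambda>x. \<Sum>i\<in>I. f i x)"
  using assms unfolding continuous_map_tendsto by (blast intro: tendsto_sum)

text \<open>The group of integers is discrete, so that the factor \<open>c\<close> is locally constant.\<close>

lemma continuous_map_zmul:
  fixes f :: "'z \<Rightarrow> 'a::topological_ab_group_add"
  assumes "continuous_map X euclidean c" "continuous_map X euclidean f"
  shows "continuous_map X euclidean (\<lambda>x. zmul (c x) (f x))"
  unfolding continuous_map_tendsto
proof
  fix x assume x: "x \<in> topspace X"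
  have "continuous_map X euclidean (\<lambda>x. zmul (c x') (f x))" for x'
  proof (cases "0 \<le> c x'")
    case True
    then show ?thesis using assms by (simp add: zmul_def continuous_map_group_sum)
  next
    case False
    have "continuous_map X euclidean (\<lambda>x. 0 - (\<Sum>_<nat (- c x'). f x))"
      using assms by (intro continuous_map_group_minus continuous_map_group_sum) auto
    then show ?thesis using False by (simp add: zmul_def)
  qed
  then have "((\<lambda>y. zmul (c x) (f y)) \<longlongrightarrow> zmul (c x) (f x)) (atin X x)"
    using x by (simp add: continuous_map_tendsto)
  moreover have "(c \<longlongrightarrow> c x) (atin X x)"
    using x assms by (simp add: continuous_map_tendsto)
  then have "\<forall>\<^sub>F y in atin X x. c y = c x"
    by (simp add: nhds_discrete filterlim_principal)
  then have "\<forall>\<^sub>F y in atin X x. zmul (c x) (f y) = zmul (c y) (f y)"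
    by (rule eventually_mono) simp
  ultimately show "((\<lambda>y. zmul (c y) (f y)) \<longlongrightarrow> zmul (c x) (f x)) (atin X x)"
    by (rule Lim_transform_eventually)
qed


section \<open>Lifting continuous functions\<close>

text \<open>On a single overlap, exactness of the cochain groups is a lifting property: of \<open>\<int> \<rightarrow> \<real>\<close> against
  the functions in the kernel of \<open>\<real> \<rightarrow> \<real>/\<int>\<close>, and of \<open>\<real> \<rightarrow> \<real>/\<int>\<close> against all functions.\<close>

definition lifts :: "'z topology \<Rightarrow> ('a::topological_space \<Rightarrow> 'b::topological_space) \<Rightarrow>
    'a set \<Rightarrow> 'b set \<Rightarrow> bool" where
  "lifts X h A B \<longleftrightarrow> (\<forall>f. continuous_map X euclidean f \<longrightarrow> f ` topspace X \<subseteq> B \<longrightarrow>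
     (\<exists>g. continuous_map X euclidean g \<and> g ` topspace X \<subseteq> A \<and> (\<forall>x\<in>topspace X. h (g x) = f x)))"

lemma liftsE:
  assumes "lifts X h A B" "continuous_map X euclidean f" "f ` topspace X \<subseteq> B"
  obtains g where "continuous_map X euclidean g" "g ` topspace X \<subseteq> A"
    "\<And>x. x \<in> topspace X \<Longrightarrow> h (g x) = f x"
proof -
  have "\<exists>g. continuous_map X euclidean g \<and> g ` topspace X \<subseteq> A \<and> (\<forall>x\<in>topspace X. h (g x) = f x)"
    using assms by (simp add: lifts_def)
  then show thesis
    using that by (elim exE conjE) simp
qed

lemma lifts_zero: "h 0 = 0 \<Longrightarrow> lifts X h {0} {0}"
  unfolding lifts_def by (intro allI impI exI [of _ "\<lambda>_. 0"]) (auto simp: image_subset_iff)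

text \<open>Functions into a product are continuous if their components are, so that the components can be
  lifted independently.\<close>

lemma lifts_fun:
  fixes X :: "'z topology" and h :: "'a::topological_space \<Rightarrow> 'b::topological_space"
  assumes "\<And>i :: 'j. lifts X h (A i) (B i)"
  shows "lifts X (\<lambda>v i. h (v i)) {v. \<forall>i. v i \<in> A i} {v. \<forall>i. v i \<in> B i}"
  unfolding lifts_def
proof (intro allI impI)
  fix f :: "'z \<Rightarrow> 'j \<Rightarrow> 'b"
  assume f: "continuous_map X euclidean f" "f ` topspace X \<subseteq> {v. \<forall>i. v i \<in> B i}"
  have "\<exists>g. continuous_map X euclidean g \<and> g ` topspace X \<subseteq> A i \<and>
      (\<forall>x\<in>topspace X. h (g x) = f x i)" for i
  proof -
    have "continuous_map X euclidean (\<lambda>x. f x i)" "(\<lambda>x. f x i) ` topspace X \<subseteq> B i"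
      using f by (auto simp: continuous_map_fun_iff)
    then show ?thesis
      using assms [of i] unfolding lifts_def by blast
  qed
  then obtain g where "\<And>i. continuous_map X euclidean (g i)"
    "\<And>i. g i ` topspace X \<subseteq> A i" "\<And>i x. x \<in> topspace X \<Longrightarrow> h (g i x) = f x i"
    by metis
  then show "\<exists>g. continuous_map X euclidean g \<and> g ` topspace X \<subseteq> {v. \<forall>i. v i \<in> A i} \<and>
      (\<forall>x\<in>topspace X. (\<lambda>i. h (g x i)) = f x)"
    by (intro exI [of _ "\<lambda>x i. g i x"]) (auto simp: continuous_map_fun_iff)
qed

text \<open>The lift is the floor of \<open>f\<close>. It is continuous because a value of \<open>f\<close> at distance less than \<open>1\<close>
  from another one is equal to it.\<close>

lemma lifts_int:
  fixes X :: "'z topology"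
  shows "lifts X real_of_int UNIV \<int>"
  unfolding lifts_def
proof (intro allI impI)
  fix f :: "'z \<Rightarrow> real"
  assume f: "continuous_map X euclidean f" "f ` topspace X \<subseteq> \<int>"
  have fl: "real_of_int \<lfloor>f x\<rfloor> = f x" if "x \<in> topspace X" for x
    using f that by (auto elim!: Ints_cases)
  have "((\<lambda>x. \<lfloor>f x\<rfloor>) \<longlongrightarrow> \<lfloor>f x\<rfloor>) (atin X x)" if x: "x \<in> topspace X" for x
  proof -
    have "\<forall>\<^sub>F y in atin X x. dist (f y) (f x) < 1"
      using f x by (simp add: continuous_map_tendsto tendsto_iff)
    moreover have "\<forall>\<^sub>F y in atin X x. y \<in> topspace X"
      using x by (auto simp: eventually_atin)
    ultimately have "\<forall>\<^sub>F y in atin X x. \<lfloor>f y\<rfloor> = \<lfloor>f x\<rfloor>"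
    proof eventually_elim
      case (elim y)
      then have "\<bar>real_of_int \<lfloor>f y\<rfloor> - real_of_int \<lfloor>f x\<rfloor>\<bar> < 1"
        unfolding fl [OF x] fl [OF elim(2)] by (simp add: dist_real_def)
      then show ?case by linarith
    qed
    then show ?thesis by (rule tendsto_eventually)
  qed
  then show "\<exists>g. continuous_map X euclidean g \<and> g ` topspace X \<subseteq> UNIV \<and>
      (\<forall>x\<in>topspace X. real_of_int (g x) = f x)"
    using fl by (intro exI [of _ "\<lambda>x. \<lfloor>f x\<rfloor>"]) (auto simp: continuous_map_tendsto)
qed

text \<open>The embedding of \<open>\<real>/\<int>\<close> as the unit circle of the complex plane gives access to continuous
  logarithms.\<close>

lift_definition circle_exp :: "circle \<Rightarrow> complex" is "\<lambda>x. exp (\<i> * of_real (2 * pi * x))"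
proof -
  fix x y :: real assume "x - y \<in> \<int>"
  then obtain n :: int where "x = y + of_int n"
    by (metis Ints_cases add_diff_cancel_left' add_diff_eq)
  then show "exp (\<i> * of_real (2 * pi * x)) = exp (\<i> * of_real (2 * pi * y))"
    by (auto simp: exp_eq algebra_simps intro!: exI [of _ n])
qed

lemma circle_exp_eq_iff: "circle_exp a = circle_exp b \<longleftrightarrow> a = b"
proof
  assume *: "circle_exp a = circle_exp b"
  obtain r s where rs: "a = circle_of r" "b = circle_of s"
    by (metis circle_of_surj)
  then obtain n :: int where "\<i> * of_real (2 * pi * r) = \<i> * of_real (2 * pi * s) + of_int (2 * n) * of_real pi * \<i>"
    using * by (auto simp: circle_exp.abs_eq exp_eq)
  then have "2 * pi * r = 2 * pi * s + 2 * n * pi"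
    by (simp add: complex_eq_iff)
  then have "2 * pi * (r - s) = 2 * pi * of_int n"
    by (simp add: algebra_simps)
  then have "r - s = of_int n"
    by simp
  then show "a = b"
    by (simp add: rs circle_of_eq_iff)
qed simp

lemma continuous_on_circle_exp: "continuous_on A circle_exp"
proof -
  have "continuous_on UNIV (\<lambda>x. circle_exp (circle_of x))"
    unfolding circle_exp.abs_eq by (intro continuous_intros)
  then have "continuous_on UNIV circle_exp"
    by (auto simp: continuous_on_open_vimage open_circle_def vimage_def)
  then show ?thesis
    by (rule continuous_on_subset) simp
qed

text \<open>A continuous logarithm of the path in the complex plane is purely imaginary, and its imaginary
  part divided by \<open>2\<pi>\<close> is a lift. A translation by an integer adjusts the end point.\<close>

lemma circle_path_lift:
  assumes p: "continuous_on {0..1} (p :: real \<Rightarrow> circle)" and r: "circle_of r = p 1"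
  obtains L where "continuous_on {0..1} L" "\<And>t. t \<in> {0..1} \<Longrightarrow> circle_of (L t) = p t" "L 1 = r"
proof -
  have nz: "circle_exp c \<noteq> 0" and norm: "norm (circle_exp c) = 1" for c
    by (cases rule: circle_of_surj [of c], simp add: circle_exp.abs_eq)+
  have "continuous_on {0..1} (\<lambda>t. circle_exp (p t))"
    using continuous_on_compose2 [OF continuous_on_circle_exp p] by blast
  then obtain g where g: "continuous_on {0..1} g" "\<And>t. t \<in> {0..1} \<Longrightarrow> circle_exp (p t) = exp (g t)"
    using continuous_logarithm_on_cball [of "1/2 :: real" "1/2" "\<lambda>t. circle_exp (p t)"] nz
    by (auto simp: cball_eq_atLeastAtMost)
  define L where "L t = Im (g t) / (2 * pi)" for t
  have L: "circle_of (L t) = p t" if t: "t \<in> {0..1}" for t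
  proof -
    have "exp (Re (g t)) = 1"
      using norm [of "p t"] g(2) [OF t] by (metis norm_exp_eq_Re)
    then have "g t = \<i> * of_real (2 * pi * L t)"
      by (simp add: L_def complex_eq_iff)
    then show ?thesis
      using g(2) [OF t] by (metis circle_exp.abs_eq circle_exp_eq_iff)
  qed
  have "circle_of (L t + (r - L 1)) = p t" if "t \<in> {0..1}" for t
    using L [of 1] L [OF that] r by (simp add: circle_of_add circle_of_diff)
  moreover have "continuous_on {0..1} (\<lambda>t. L t + (r - L 1))"
    unfolding L_def by (intro continuous_intros g) simp
  ultimately show thesis
    by (intro that [of "\<lambda>t. L t + (r - L 1)"]) simp_all
qed

text \<open>A contracting homotopy turns every point \<open>x\<close> into a path in the circle from \<open>f x\<close> to a base
  point. The lift of this path that ends at a fixed real number starts at the required value at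
  \<open>x\<close>. It depends continuously on \<open>x\<close>: by the tube lemma the paths of nearby points are uniformly
  close, and the difference of their lifts, being \<open>0\<close> at the end point and always near an integer,
  stays small.\<close>

lemma lifts_circle:
  fixes X :: "'z topology"
  assumes "contractible_space X"
  shows "lifts X circle_of UNIV UNIV"
  unfolding lifts_def
proof (intro allI impI)
  fix f :: "'z \<Rightarrow> circle"
  assume f: "continuous_map X euclidean f"
  obtain a h where h: "continuous_map (prod_topology (top_of_set {0..1::real}) X) X h"
    "\<And>x. h (0, x) = x" "\<And>x. h (1, x) = a"
    using assms by (auto simp: contractible_space_def homotopic_with_def)
  define q where "q z = f (h z)" for z
  have q: "continuous_map (prod_topology (top_of_set {0..1}) X) euclidean q"
    unfolding q_def using continuous_map_compose [OF h(1) f] by (simp add: o_def)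
  have q_path: "continuous_map (prod_topology (top_of_set {0..1}) X) euclidean (\<lambda>z. q (fst z, x))"
    and path: "continuous_on {0..1} (\<lambda>t. q (t, x))"
    if x: "x \<in> topspace X" for x
  proof -
    have "continuous_map (top_of_set {0..1}) (prod_topology (top_of_set {0..1}) X) (\<lambda>t. (t, x))"
      using x by (simp add: continuous_map_pairwise o_def)
    then have *: "continuous_map (top_of_set {0..1}) euclidean (\<lambda>t. q (t, x))"
      using continuous_map_compose [OF _ q] by (fastforce simp: o_def)
    then show "continuous_on {0..1} (\<lambda>t. q (t, x))"
      by simp
    show "continuous_map (prod_topology (top_of_set {0..1}) X) euclidean (\<lambda>z. q (fst z, x))"
      using continuous_map_compose [OF continuous_map_fst *] by (simp add: o_def)
  qed
  obtain r where r: "f a = circle_of r"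
    by (rule circle_of_surj)
  have "\<exists>L. continuous_on {0..1} L \<and> (\<forall>t\<in>{0..1}. circle_of (L t) = q (t, x)) \<and> L 1 = r"
    if x: "x \<in> topspace X" for x
    using circle_path_lift [OF path [OF x], of r] r h by (metis q_def)
  then obtain L where L: "\<And>x. x \<in> topspace X \<Longrightarrow> continuous_on {0..1} (L x)"
    "\<And>x t. x \<in> topspace X \<Longrightarrow> t \<in> {0..1} \<Longrightarrow> circle_of (L x t) = q (t, x)"
    "\<And>x. x \<in> topspace X \<Longrightarrow> L x 1 = r"
    by metis
  have "((\<lambda>x. L x 0) \<longlongrightarrow> L x 0) (atin X x)" if x: "x \<in> topspace X" for x
    unfolding tendsto_iff
  proof (intro allI impI)
    fix \<epsilon>' :: real assume "\<epsilon>' > 0"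
    \<comment> \<open>With a radius below \<open>1/2\<close>, no point at distance \<open>\<epsilon>\<close> from \<open>0\<close> is within \<open>\<epsilon>\<close> of an integer.\<close>
    define \<epsilon> where "\<epsilon> = min \<epsilon>' (1/3)"
    have \<epsilon>: "\<epsilon> > 0" "\<epsilon> \<le> \<epsilon>'" "\<epsilon> < 1/2"
      using \<open>\<epsilon>' > 0\<close> by (auto simp: \<epsilon>_def)
    let ?P = "prod_topology (top_of_set {0..1}) X"
    let ?T = "{z \<in> topspace ?P. q z - q (fst z, x) \<in> circle_of ` ball 0 \<epsilon>}"
    have op: "openin ?P ?T"
      using continuous_map_group_minus [OF q q_path [OF x]] open_circle_of_image [OF open_ball]
      by (intro openin_continuous_map_preimage [where Y = euclidean]) simp_all
    have comp: "compactin (top_of_set {0..1::real}) {0..1}"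
      by (simp add: compactin_subtopology)
    have "0 \<in> circle_of ` ball 0 \<epsilon>"
      using \<epsilon> by (intro image_eqI [of _ _ 0]) (simp_all add: circle_of_eq_0_iff eq_commute [of 0])
    then have "{0..1} \<times> {x} \<subseteq> ?T"
      using x by auto
    from tube_lemma_left [OF op comp x this]
    obtain U V where UV: "openin X V" "x \<in> V" "{0..1} \<subseteq> U" "U \<times> V \<subseteq> ?T"
      by (elim exE conjE)
    have "dist (L y 0) (L x 0) < \<epsilon>" if y: "y \<in> V" for y
    proof (rule ccontr)
      assume far: "\<not> dist (L y 0) (L x 0) < \<epsilon>"
      have yX: "y \<in> topspace X"
        using y UV openin_subset by blast
      have "continuous_on {0..1} (\<lambda>t. \<bar>L y t - L x t\<bar>)"
        using L(1) x yX by (intro continuous_intros) auto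
      then obtain t where t: "t \<in> {0..1}" "\<bar>L y t - L x t\<bar> = \<epsilon>"
        using IVT2' [of "\<lambda>t. \<bar>L y t - L x t\<bar>" 1 \<epsilon> 0] far \<epsilon> L(3) [OF x] L(3) [OF yX]
        by (auto simp: dist_real_def)
      have "(t, y) \<in> ?T"
        using t UV y by blast
      then have "circle_of (L y t - L x t) \<in> circle_of ` ball 0 \<epsilon>"
        using L(2) [OF x t(1)] L(2) [OF yX t(1)] by (simp add: circle_of_diff)
      then obtain e where e: "\<bar>e\<bar> < \<epsilon>" "L y t - L x t - e \<in> \<int>"
        by (auto simp: circle_of_eq_iff)
      then obtain n :: int where n: "L y t - L x t - e = of_int n"
        by (auto elim: Ints_cases)
      then have "\<bar>real_of_int n\<bar> < 1"
        using e t \<epsilon> by linarith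
      then have "n = 0" by linarith
      then show False
        using n e t by linarith
    qed
    then show "\<forall>\<^sub>F y in atin X x. dist (L y 0) (L x 0) < \<epsilon>'"
      unfolding eventually_atin using UV(1,2) \<epsilon>(2)
      by (intro disjI2 exI [of _ V]) (auto intro: less_le_trans)
  qed
  moreover have "circle_of (L x 0) = f x" if "x \<in> topspace X" for x
    using L(2) [OF that, of 0] h by (simp add: q_def)
  ultimately show "\<exists>g. continuous_map X euclidean g \<and> g ` topspace X \<subseteq> UNIV \<and>
      (\<forall>x\<in>topspace X. circle_of (g x) = f x)"
    by (intro exI [of _ "\<lambda>x. L x 0"]) (auto simp: continuous_map_tendsto)
qed


section \<open>The Cech differential and the cup product with an integral cochain\<close>

lemma zmul_apply: "zmul m f x = zmul m (f x)" for f :: "'j \<Rightarrow> 'g::ab_group_add"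
  by (rule additive_zmul [where h = "\<lambda>f. f x"]) simp

lemma sum_apply: "(\<Sum>i\<in>I. f i) x = (\<Sum>i\<in>I. f i x)" for f :: "'j \<Rightarrow> 'k \<Rightarrow> 'g::ab_group_add"
  by (induction I rule: infinite_finite_induct) simp_all

lemma omit_Nil [simp]: "omit i [] = []"
  and omit_0_Cons [simp]: "omit 0 (x # xs) = xs"
  and omit_Suc_Cons [simp]: "omit (Suc i) (x # xs) = x # omit i xs"
  by (simp_all add: omit_def)

lemma length_omit: "i < length ls \<Longrightarrow> length (omit i ls) = length ls - 1"
  by (simp add: omit_def)

lemma set_omit: "set (omit i ls) \<subseteq> set ls"
  unfolding omit_def using set_take_subset [of i ls] set_drop_subset [of "Suc i" ls] by auto

lemma omit_omit: "i \<le> j \<Longrightarrow> omit j (omit i ls) = omit i (omit (Suc j) ls)"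
proof (induction ls arbitrary: i j)
  case (Cons x xs)
  show ?case using Cons.prems Cons.IH [of "i - 1" "j - 1"] by (cases i; cases j) simp_all
qed simp

lemma overlap_mono: "ks \<noteq> [] \<Longrightarrow> set ks \<subseteq> set ls \<Longrightarrow> overlap \<Lambda> W ls \<subseteq> overlap \<Lambda> W ks"
  unfolding overlap_def by (simp add: INT_anti_mono) (meson order_trans)

lemma overlap_omit:
  assumes "i < length ls" "2 \<le> length ls"
  shows "overlap \<Lambda> W ls \<subseteq> overlap \<Lambda> W (omit i ls)"
proof (rule overlap_mono [OF _ set_omit])
  show "omit i ls \<noteq> []"
    using assms length_omit [of i ls] by auto
qed

lemma overlap_Nil [simp]: "overlap \<Lambda> W [] = {}"
  by (simp add: overlap_def)

lemma overlap_take: "0 < m \<Longrightarrow> z \<in> overlap \<Lambda> W ls \<Longrightarrow> z \<in> overlap \<Lambda> W (take m ls)"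
  using overlap_mono [of "take m ls" ls \<Lambda> W] set_take_subset [of m ls] by (cases "ls = []") auto

lemma overlap_drop: "m < length ls \<Longrightarrow> z \<in> overlap \<Lambda> W ls \<Longrightarrow> z \<in> overlap \<Lambda> W (drop m ls)"
  using overlap_mono [of "drop m ls" ls \<Lambda> W] set_drop_subset [of m ls] by auto

lemma cech_d_diff: "cech_d \<Lambda> W (\<phi> - \<psi>) = cech_d \<Lambda> W \<phi> - cech_d \<Lambda> W \<psi>"
  by (auto simp: cech_d_def fun_eq_iff zmul_diff_right sum_subtractf)

lemma cech_d_0: "cech_d \<Lambda> W 0 = 0"
  using cech_d_diff [of \<Lambda> W 0 0] by simp

lemma cech_d_add: "cech_d \<Lambda> W (\<phi> + \<psi>) = cech_d \<Lambda> W \<phi> + cech_d \<Lambda> W \<psi>"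
  by (auto simp: cech_d_def fun_eq_iff zmul_add_right sum.distrib)

lemma cech_d_zmul: "cech_d \<Lambda> W (zmul m \<phi>) = zmul m (cech_d \<Lambda> W \<phi>)"
  by (rule additive_zmul [where h = "cech_d \<Lambda> W"]) (rule cech_d_add)

lemma cech_d_sum: "cech_d \<Lambda> W (\<Sum>i\<in>I. f i) = (\<Sum>i\<in>I. cech_d \<Lambda> W (f i))"
  by (rule additive.sum [of "cech_d \<Lambda> W", OF additive.intro [of "cech_d \<Lambda> W", OF cech_d_add]])

lemma cech_d_component: "cech_d \<Lambda> W (\<lambda>ls z. \<phi> ls z l) ls z = cech_d \<Lambda> W \<phi> ls z l"
  by (simp add: cech_d_def zmul_apply sum_apply)

text \<open>The terms of \<open>(i, j)\<close> with \<open>i \<le> j\<close> and of \<open>(j + 1, i)\<close> are equal up to sign, and their signs are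
  opposite.\<close>

lemma alternating_sum_eq_0:
  fixes g :: "nat \<Rightarrow> nat \<Rightarrow> 'g::ab_group_add"
  assumes "\<And>i j. i \<le> j \<Longrightarrow> j < m \<Longrightarrow> g (Suc j) i = g i j"
  shows "(\<Sum>i<Suc m. \<Sum>j<m. zmul (msign (int i + int j)) (g i j)) = 0"
proof -
  define h where "h = (\<lambda>(i, j). zmul (msign (int i + int j)) (g i j))"
  have g: "g j (i - 1) = g i j" if "j < i" "i < Suc m" for i j
    using assms [of j "i - 1"] that by simp
  let ?A = "{(i, j). i \<le> j \<and> j < m}" and ?B = "{(i, j). j < i \<and> i < Suc m}"
  have fin: "finite ?A" "finite ?B"
    by (rule finite_subset [of _ "{..m} \<times> {..m}"]; auto)+
  have "(\<Sum>i<Suc m. \<Sum>j<m. zmul (msign (int i + int j)) (g i j)) = sum h ({..<Suc m} \<times> {..<m})"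
    by (simp add: h_def sum.cartesian_product)
  also have "{..<Suc m} \<times> {..<m} = ?A \<union> ?B"
    by auto
  also have "sum h (?A \<union> ?B) = sum h ?A + sum h ?B"
    by (rule sum.union_disjoint [OF fin]) auto
  also have "sum h ?B = (\<Sum>(i, j)\<in>?A. - zmul (msign (int i + int j)) (g i j))"
    by (rule sum.reindex_bij_witness [where i = "\<lambda>(i, j). (Suc j, i)" and j = "\<lambda>(i, j). (j, i - 1)"])
       (auto simp: h_def g [unfolded One_nat_def] zmul_msign)
  also have "sum h ?A + \<dots> = 0"
    by (simp add: h_def sum.distrib [symmetric] case_prod_beta)
  finally show ?thesis .
qed

lemma cech_d_cech_d: "cech_d \<Lambda> W (cech_d \<Lambda> W \<phi>) = 0"
proof (intro ext)
  fix ls z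
  show "cech_d \<Lambda> W (cech_d \<Lambda> W \<phi>) ls z = 0 ls z"
  proof (cases "z \<in> overlap \<Lambda> W ls \<and> 2 \<le> length ls")
    case True
    then obtain m where m: "length ls = Suc m" "0 < m"
      by (metis Suc_le_D Suc_le_mono numeral_2_eq_2 less_eq_Suc_le One_nat_def)
    have "cech_d \<Lambda> W (cech_d \<Lambda> W \<phi>) ls z =
        (\<Sum>i<Suc m. zmul (msign (int i)) (cech_d \<Lambda> W \<phi> (omit i ls) z))"
      using True m by (simp add: cech_d_def)
    also have "\<dots> = (\<Sum>i<Suc m. \<Sum>j<m. zmul (msign (int i + int j)) (\<phi> (omit j (omit i ls)) z))"
    proof (rule sum.cong [OF refl])
      fix i assume "i \<in> {..<Suc m}"
      then have "z \<in> overlap \<Lambda> W (omit i ls)" "length (omit i ls) = m"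
        using True m overlap_omit [of i ls \<Lambda> W] by (auto simp: length_omit)
      then show "zmul (msign (int i)) (cech_d \<Lambda> W \<phi> (omit i ls) z) =
          (\<Sum>j<m. zmul (msign (int i + int j)) (\<phi> (omit j (omit i ls)) z))"
        by (simp add: cech_d_def zmul_sum_right zmul_zmul msign_add)
    qed
    also have "\<dots> = 0"
      by (rule alternating_sum_eq_0) (simp add: omit_omit)
    finally show ?thesis by simp
  next
    case False
    \<comment> \<open>The only face of a list of length one is the empty list, whose overlap is empty.\<close>
    then consider "z \<notin> overlap \<Lambda> W ls" | "length ls = 1"
      by (cases ls) (auto simp: Suc_le_eq)
    then show ?thesis
      by cases (auto simp: cech_d_def length_Suc_conv)
  qed
qed

text \<open>The common form of the three products: each of their components is a sum of products of a
  component of a cochain with an integral \<open>q\<close>-cochain, with \<open>q = 2\<close> or \<open>q = 3\<close>.\<close>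

definition cup :: "'i set \<Rightarrow> ('i \<Rightarrow> 'z set) \<Rightarrow> nat \<Rightarrow> ('i, 'z, int) cochain \<Rightarrow>
    ('i, 'z, 'g::ab_group_add) cochain \<Rightarrow> ('i, 'z, 'g) cochain" where
  "cup \<Lambda> W q c \<phi> = (\<lambda>ls z. if z \<in> overlap \<Lambda> W ls
     then zmul (c (drop (length ls - Suc q) ls) z) (\<phi> (take (length ls - q) ls) z) else 0)"

text \<open>Vanishing outside degree \<open>p\<close> is all that the algebraic identities need to know of a cochain.\<close>

definition homogeneous :: "int \<Rightarrow> ('i, 'z, 'a::zero) cochain \<Rightarrow> bool" where
  "homogeneous p \<phi> \<longleftrightarrow> (\<forall>ls z. p < 0 \<or> int (length ls) \<noteq> p + 1 \<longrightarrow> \<phi> ls z = 0)"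

lemma homogeneous_component:
  "homogeneous p \<phi> \<Longrightarrow> homogeneous p (\<lambda>ls z. \<phi> ls z l)"
  by (simp add: homogeneous_def)

lemma homogeneous_Nil: "homogeneous p \<phi> \<Longrightarrow> \<phi> [] z = 0"
  unfolding homogeneous_def by (cases "p < 0") auto

text \<open>The Leibniz rule: omitting one of the indices of the first factor gives the first summand,
  omitting one of those of the second factor gives the second one, and the two contributions of
  the common index cancel.\<close>

lemma cech_d_cup:
  assumes "homogeneous p \<phi>"
  shows "cech_d \<Lambda> W (cup \<Lambda> W q c \<phi>) =
    cup \<Lambda> W q c (cech_d \<Lambda> W \<phi>) + zmul (msign p) (cup \<Lambda> W (Suc q) (cech_d \<Lambda> W c) \<phi>)"
proof (intro ext)
  fix ls z
  let ?lhs = "cech_d \<Lambda> W (cup \<Lambda> W q c \<phi>) ls z"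
  show "?lhs = (cup \<Lambda> W q c (cech_d \<Lambda> W \<phi>) +
      zmul (msign p) (cup \<Lambda> W (Suc q) (cech_d \<Lambda> W c) \<phi>)) ls z"
  proof (cases "z \<in> overlap \<Lambda> W ls \<and> 0 \<le> p \<and> length ls = nat p + q + 2")
    case False
    \<comment> \<open>Outside the total degree both sides vanish, because \<open>\<phi>\<close> is evaluated outside degree \<open>p\<close>.\<close>
    have van: "\<phi> ks z = 0"
      if z: "z \<in> overlap \<Lambda> W ls" and ks: "ks = [] \<or> length ks + Suc q = length ls" for ks
    proof (cases "ks = [] \<or> p < 0")
      case True
      then show ?thesis using homogeneous_Nil [OF assms] assms unfolding homogeneous_def by metis
    next
      case nonempty: False
      then have "length ks + Suc q = length ls" "length ls \<noteq> nat p + q + 2" "0 \<le> p"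
        using False ks z by simp_all
      then have "int (length ks) \<noteq> p + 1"
        by linarith
      then show ?thesis using assms unfolding homogeneous_def by metis
    qed
    have 1: "cup \<Lambda> W q c \<phi> (omit i ls) z = 0" if "z \<in> overlap \<Lambda> W ls" "i < length ls" for i
    proof -
      let ?ks = "take (length (omit i ls) - q) (omit i ls)"
      have "?ks = [] \<or> length ?ks + Suc q = length ls"
        using that by (auto simp: length_omit)
      then have "\<phi> ?ks z = 0"
        using van that(1) by blast
      then show ?thesis by (simp add: cup_def)
    qed
    have 2: "cech_d \<Lambda> W \<phi> (take (length ls - q) ls) z = 0" if "z \<in> overlap \<Lambda> W ls"
    proof -
      let ?ts = "take (length ls - q) ls"
      have "\<phi> (omit i ?ts) z = 0" if "i < length ?ts" for i
      proof -
        have "length (omit i ?ts) + Suc q = length ls"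
          using that by (subst length_omit [OF that]) simp
        then show ?thesis
          using van \<open>z \<in> overlap \<Lambda> W ls\<close> by blast
      qed
      then show ?thesis by (simp add: cech_d_def)
    qed
    have 3: "\<phi> (take (length ls - Suc q) ls) z = 0" if "z \<in> overlap \<Lambda> W ls"
    proof -
      have "take (length ls - Suc q) ls = [] \<or> length (take (length ls - Suc q) ls) + Suc q = length ls"
        by (cases ls) auto
      then show ?thesis
        using van that by blast
    qed
    show ?thesis
    proof (cases "z \<in> overlap \<Lambda> W ls")
      case True
      then have "?lhs = 0" by (simp add: cech_d_def 1)
      with True 2 3 show ?thesis by (simp add: cup_def zmul_apply)
    qed (simp add: cech_d_def cup_def zmul_apply)
  next
    case True
    define m where "m = nat p"
    have z: "z \<in> overlap \<Lambda> W ls" and p: "p = int m" and len: "length ls = m + q + 2"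
      using True by (auto simp: m_def)
    let ?f = "\<lambda>i. zmul (msign (int i)) (cup \<Lambda> W q c \<phi> (omit i ls) z)"
    let ?t = "zmul (c (drop (Suc m) ls) z) (\<phi> (take (Suc m) ls) z)"
    have cup_omit: "cup \<Lambda> W q c \<phi> (omit i ls) z =
        zmul (c (drop m (omit i ls)) z) (\<phi> (take (Suc m) (omit i ls)) z)" if "i < m + q + 2" for i
      using that z len overlap_omit [of i ls \<Lambda> W] by (auto simp: cup_def length_omit)
    have low: "?f i = zmul (c (drop (Suc m) ls) z)
        (zmul (msign (int i)) (\<phi> (omit i (take (m + 2) ls)) z))" if "i < Suc m" for i
    proof -
      have "drop m (omit i ls) = drop (Suc m) ls"
        "take (Suc m) (omit i ls) = omit i (take (m + 2) ls)"
        using that len by (auto simp: omit_def min_def drop_take)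
      then show ?thesis
        using that by (simp add: cup_omit zmul_zmul mult.commute)
    qed
    have high: "?f (Suc m + i) = zmul (msign p) (zmul (msign (int (Suc i)) *
        c (omit (Suc i) (drop m ls)) z) (\<phi> (take (Suc m) ls) z))" if "i < Suc q" for i
    proof -
      have "drop m (omit (Suc m + i) ls) = omit (Suc i) (drop m ls)"
        "take (Suc m) (omit (Suc m + i) ls) = take (Suc m) ls"
        using that len by (auto simp: omit_def min_def drop_take add.commute)
      moreover have "msign (int (Suc m + i)) = msign p * msign (int (Suc i))"
        by (simp add: p msign_def)
      ultimately show ?thesis
        using that by (simp add: cup_omit zmul_zmul mult.assoc)
    qed
    have "cup \<Lambda> W q c (cech_d \<Lambda> W \<phi>) ls z =
        zmul (c (drop (Suc m) ls) z)
          (\<Sum>i<Suc (Suc m). zmul (msign (int i)) (\<phi> (omit i (take (m + 2) ls)) z))"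
      using z len overlap_take [of "m + 2" z \<Lambda> W ls] by (simp add: cup_def cech_d_def)
    also have "\<dots> = (\<Sum>i<Suc m. ?f i) - zmul (msign p) ?t"
    proof -
      have "omit (Suc m) (take (m + 2) ls) = take (Suc m) ls"
        using len by (simp add: omit_def min_def)
      moreover have "msign (int (Suc m)) = - msign p"
        by (simp add: p msign_def)
      moreover have "(\<Sum>i<Suc m. ?f i) = zmul (c (drop (Suc m) ls) z)
          (\<Sum>i<Suc m. zmul (msign (int i)) (\<phi> (omit i (take (m + 2) ls)) z))"
        unfolding zmul_sum_right by (rule sum.cong [OF refl]) (simp only: low lessThan_iff)
      ultimately show ?thesis
        unfolding sum.lessThan_Suc [of _ "Suc m"] zmul_add_right
        by (simp only: zmul_zmul) (simp add: zmul_minus_left mult.commute)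
    qed
    finally have A: "cup \<Lambda> W q c (cech_d \<Lambda> W \<phi>) ls z = (\<Sum>i<Suc m. ?f i) - zmul (msign p) ?t" .
    have "cup \<Lambda> W (Suc q) (cech_d \<Lambda> W c) \<phi> ls z =
        zmul (\<Sum>i<Suc (Suc q). msign (int i) * c (omit i (drop m ls)) z) (\<phi> (take (Suc m) ls) z)"
      using z len overlap_drop [of m ls z \<Lambda> W] by (simp add: cup_def cech_d_def)
    also have "\<dots> = ?t + (\<Sum>i<Suc q. zmul (msign (int (Suc i)) *
        c (omit (Suc i) (drop m ls)) z) (\<phi> (take (Suc m) ls) z))"
    proof -
      have "omit 0 (drop m ls) = drop (Suc m) ls"
        by (simp add: omit_def)
      moreover have "msign 0 = 1"
        by (simp add: msign_def)
      ultimately show ?thesis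
        unfolding sum.lessThan_Suc_shift [of _ "Suc q"] zmul_add_left zmul_sum_left by simp
    qed
    finally have B: "cup \<Lambda> W (Suc q) (cech_d \<Lambda> W c) \<phi> ls z = ?t + (\<Sum>i<Suc q.
        zmul (msign (int (Suc i)) * c (omit (Suc i) (drop m ls)) z) (\<phi> (take (Suc m) ls) z))" .
    have "(\<Sum>i<Suc q. ?f (Suc m + i)) = (\<Sum>i<Suc q. zmul (msign p) (zmul (msign (int (Suc i)) *
        c (omit (Suc i) (drop m ls)) z) (\<phi> (take (Suc m) ls) z)))"
      by (rule sum.cong [OF refl]) (simp only: high lessThan_iff)
    then have "zmul (msign p) (cup \<Lambda> W (Suc q) (cech_d \<Lambda> W c) \<phi> ls z) =
        zmul (msign p) ?t + (\<Sum>i<Suc q. ?f (Suc m + i))"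
      by (simp only: B zmul_add_right zmul_sum_right)
    moreover have "?lhs = (\<Sum>i<Suc m + Suc q. ?f i)"
      using z len by (simp add: cech_d_def)
    then have "?lhs = (\<Sum>i<Suc m. ?f i) + (\<Sum>i<Suc q. ?f (Suc m + i))"
      using sum.atLeastLessThan_concat [of 0 "Suc m" "Suc m + Suc q" ?f]
        sum.shift_bounds_nat_ivl [of ?f 0 "Suc m" "Suc q"]
      by (simp add: atLeast0LessThan add.commute del: sum.lessThan_Suc)
    ultimately show ?thesis
      by (simp only: plus_fun_apply zmul_apply A) simp
  qed
qed


section \<open>Products with a 2-cocycle\<close>

abbreviation upairs :: "nat \<Rightarrow> (nat \<times> nat) set" where
  "upairs n \<equiv> {(i, j). 1 \<le> i \<and> i < j \<and> j \<le> n}"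

lemma cech_d_cup_cocycle:
  assumes "homogeneous p \<phi>" "cech_d \<Lambda> W c = 0"
  shows "cech_d \<Lambda> W (cup \<Lambda> W q c \<phi>) = cup \<Lambda> W q c (cech_d \<Lambda> W \<phi>)"
proof -
  have "cup \<Lambda> W (Suc q) 0 \<phi> = 0"
    by (simp add: cup_def fun_eq_iff)
  then show ?thesis
    using cech_d_cup [OF assms(1), of \<Lambda> W q c] assms(2) by simp
qed

lemma cup1_vec_eq:
  "cup1_vec n \<Lambda> W F \<phi> = (\<Sum>l\<in>{1..n}. cup \<Lambda> W 2 (\<lambda>ls z. F ls z l) (\<lambda>ls z. \<phi> ls z l))"
proof (intro ext)
  fix ls z
  show "cup1_vec n \<Lambda> W F \<phi> ls z =
      (\<Sum>l\<in>{1..n}. cup \<Lambda> W 2 (\<lambda>ls z. F ls z l) (\<lambda>ls z. \<phi> ls z l)) ls z"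
    by (cases "z \<in> overlap \<Lambda> W ls") (simp_all add: cup1_vec_def cup_def sum_apply)
qed

lemma cup2_eq:
  "cup2 n \<Lambda> W C \<phi> = (\<Sum>p\<in>upairs n. cup \<Lambda> W 3 (\<lambda>ls z. C ls z (fst p) (snd p))
     (\<lambda>ls z. \<phi> ls z (fst p) (snd p)))"
proof (intro ext)
  fix ls z
  show "cup2 n \<Lambda> W C \<phi> ls z = (\<Sum>p\<in>upairs n. cup \<Lambda> W 3 (\<lambda>ls z. C ls z (fst p) (snd p))
     (\<lambda>ls z. \<phi> ls z (fst p) (snd p))) ls z"
    by (cases "z \<in> overlap \<Lambda> W ls") (simp_all add: cup2_def cup_def sum_apply case_prod_beta')
qed

text \<open>The integral 2-cochain by which the entry \<open>p = (i, j)\<close> of a matrix contributes to the \<open>l\<close>-th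
  component of its product with \<open>F\<close>.\<close>

definition mat_coeff :: "('i, 'z, nat \<Rightarrow> int) cochain \<Rightarrow> nat \<Rightarrow> nat \<times> nat \<Rightarrow> ('i, 'z, int) cochain" where
  "mat_coeff F l p = (\<lambda>ls z. F ls z (fst p) * std_basis l (snd p) - std_basis l (fst p) * F ls z (snd p))"

lemma cup1_mat_component:
  "(\<lambda>ls z. cup1_mat n \<Lambda> W F \<phi> ls z l) = (if l \<in> {1..n}
     then \<Sum>p\<in>upairs n. cup \<Lambda> W 2 (mat_coeff F l p) (\<lambda>ls z. \<phi> ls z (fst p) (snd p)) else 0)"
proof (intro ext)
  fix ls z
  show "cup1_mat n \<Lambda> W F \<phi> ls z l = (if l \<in> {1..n}
     then \<Sum>p\<in>upairs n. cup \<Lambda> W 2 (mat_coeff F l p) (\<lambda>ls z. \<phi> ls z (fst p) (snd p)) else 0) ls z"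
    by (cases "z \<in> overlap \<Lambda> W ls"; cases "l \<in> {1..n}")
       (simp_all add: cup1_mat_def cup_def mat_coeff_def sum_apply case_prod_beta'
         del: atLeastAtMost_iff)
qed

lemma cech_d_matrix_component:
  "cech_d \<Lambda> W (\<lambda>ls z. \<phi> ls z i j) = (\<lambda>ls z. cech_d \<Lambda> W \<phi> ls z i j)"
proof (intro ext)
  fix ls z
  show "cech_d \<Lambda> W (\<lambda>ls z. \<phi> ls z i j) ls z = cech_d \<Lambda> W \<phi> ls z i j"
    using cech_d_component [of \<Lambda> W "\<lambda>ls z. \<phi> ls z i" j ls z] cech_d_component [of \<Lambda> W \<phi> i ls z]
    by simp
qed

lemma cech_d_vector_component:
  "cech_d \<Lambda> W (\<lambda>ls z. \<phi> ls z l) = (\<lambda>ls z. cech_d \<Lambda> W \<phi> ls z l)"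
  by (intro ext) (rule cech_d_component)

lemma cup1_vec_diff: "cup1_vec n \<Lambda> W F (\<phi> - \<psi>) = cup1_vec n \<Lambda> W F \<phi> - cup1_vec n \<Lambda> W F \<psi>"
  by (auto simp: cup1_vec_def fun_eq_iff zmul_diff_right sum_subtractf)

lemma cup1_mat_diff: "cup1_mat n \<Lambda> W F (\<phi> - \<psi>) = cup1_mat n \<Lambda> W F \<phi> - cup1_mat n \<Lambda> W F \<psi>"
  by (auto simp: cup1_mat_def fun_eq_iff zmul_diff_right sum_subtractf case_prod_beta')

lemma cup2_diff: "cup2 n \<Lambda> W C (\<phi> - \<psi>) = cup2 n \<Lambda> W C \<phi> - cup2 n \<Lambda> W C \<psi>"
  by (auto simp: cup2_def fun_eq_iff zmul_diff_right sum_subtractf case_prod_beta')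

lemma cup1_vec_add: "cup1_vec n \<Lambda> W F (\<phi> + \<psi>) = cup1_vec n \<Lambda> W F \<phi> + cup1_vec n \<Lambda> W F \<psi>"
  by (auto simp: cup1_vec_def fun_eq_iff zmul_add_right sum.distrib)

lemma cup1_vec_zmul: "cup1_vec n \<Lambda> W F (zmul m \<phi>) = zmul m (cup1_vec n \<Lambda> W F \<phi>)"
  by (rule additive_zmul [where h = "cup1_vec n \<Lambda> W F"]) (rule cup1_vec_add)

lemma msign_small: "msign 0 = 1" "msign 1 = - 1" "msign 2 = 1" "msign 3 = - 1" "msign 4 = 1"
  by (simp_all add: msign_def)

lemma cocycle_triple:
  assumes F: "cech_d \<Lambda> W F = 0" and z: "z \<in> overlap \<Lambda> W [w, x, y, v]"
  shows "F [x, y, v] z i = F [w, y, v] z i - F [w, x, v] z i + (F [w, x, y] z i :: int)"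
proof -
  have "cech_d \<Lambda> W F [w, x, y, v] z i = 0"
    by (simp add: F)
  then have "F [x, y, v] z i - F [w, y, v] z i + F [w, x, v] z i - F [w, x, y] z i = 0"
    using z by (simp add: cech_d_def lessThan_nat_numeral lessThan_Suc msign_small
        zmul_minus_left zmul_apply)
  then show ?thesis by simp
qed

text \<open>The cochain \<open>C(F)\<close> is, up to sign, a Steenrod \<open>\<union>\<^sub>1\<close>-product of the components of \<open>F\<close>: its
  coboundary is the commutator of their cup products. The identity follows by expressing all
  values of the two cocycles through those on triples that contain the first index.\<close>

lemma cech_d_C_of:
  assumes F: "cech_d \<Lambda> W F = 0" and z: "z \<in> overlap \<Lambda> W [a, b, c, d, e]"
    and ij: "1 \<le> i" "i < j" "j \<le> n"
  shows "cech_d \<Lambda> W (\<lambda>ls z. C_of n \<Lambda> W F ls z i j) [a, b, c, d, e] z =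
    F [a, b, c] z i * F [c, d, e] z j - F [a, b, c] z j * F [c, d, e] z i"
proof -
  have sub: "z \<in> overlap \<Lambda> W ks" if "ks \<noteq> []" "set ks \<subseteq> {a, b, c, d, e}" for ks
    using overlap_mono [of ks "[a, b, c, d, e]" \<Lambda> W] that z by auto
  have C: "C_of n \<Lambda> W F [w, x, y, v] z i j =
      F [w, x, y] z i * F [w, y, v] z j - F [x, y, v] z i * F [w, x, v] z j"
    if "set [w, x, y, v] \<subseteq> {a, b, c, d, e}" for w x y v
    using that ij sub by (simp add: C_of_def numeral_eq_Suc)
  have tri: "F [x, y, v] z l = F [a, y, v] z l - F [a, x, v] z l + F [a, x, y] z l"
    if "set [x, y, v] \<subseteq> {a, b, c, d, e}" for x y v l
    by (rule cocycle_triple [OF F sub]) (use that in auto)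
  have "cech_d \<Lambda> W (\<lambda>ls z. C_of n \<Lambda> W F ls z i j) [a, b, c, d, e] z =
      C_of n \<Lambda> W F [b, c, d, e] z i j - C_of n \<Lambda> W F [a, c, d, e] z i j
      + C_of n \<Lambda> W F [a, b, d, e] z i j - C_of n \<Lambda> W F [a, b, c, e] z i j
      + C_of n \<Lambda> W F [a, b, c, d] z i j"
    using z by (simp add: cech_d_def lessThan_nat_numeral lessThan_Suc msign_small)
  also have "\<dots> = F [a, b, c] z i * F [c, d, e] z j - F [a, b, c] z j * F [c, d, e] z i"
    by (simp add: C tri [of b c d] tri [of b c e] tri [of b d e] tri [of c d e])
       (simp add: algebra_simps)
  finally show ?thesis .
qed

text \<open>The pairing behind the double product with \<open>F\<close>: the Kronecker deltas select \<open>l = j\<close> in the first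
  and \<open>l = i\<close> in the second summand.\<close>

lemma sum_commutator:
  fixes x :: "nat \<times> nat \<Rightarrow> 'g::ab_group_add"
  shows "(\<Sum>l\<in>{1..n}. zmul (f l) (\<Sum>p\<in>upairs n.
      zmul (g (fst p) * std_basis l (snd p) - std_basis l (fst p) * g (snd p)) (x p))) =
    (\<Sum>p\<in>upairs n. zmul (g (fst p) * f (snd p) - g (snd p) * f (fst p)) (x p))"
proof -
  have "(\<Sum>l\<in>{1..n}. zmul (f l) (\<Sum>p\<in>upairs n.
      zmul (g (fst p) * std_basis l (snd p) - std_basis l (fst p) * g (snd p)) (x p))) =
    (\<Sum>p\<in>upairs n. zmul (\<Sum>l\<in>{1..n}.
      f l * (g (fst p) * std_basis l (snd p) - std_basis l (fst p) * g (snd p))) (x p))"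
    unfolding zmul_sum_right zmul_sum_left zmul_zmul by (rule sum.swap)
  also have "\<dots> = (\<Sum>p\<in>upairs n. zmul (g (fst p) * f (snd p) - g (snd p) * f (fst p)) (x p))"
  proof (rule sum.cong [OF refl])
    fix p assume "p \<in> upairs n"
    then have "(\<Sum>l\<in>{1..n}. if snd p = l then f l * g (fst p) else 0) = f (snd p) * g (fst p)"
      "(\<Sum>l\<in>{1..n}. if fst p = l then f l * g (snd p) else 0) = f (fst p) * g (snd p)"
      by (auto simp: sum.delta)
    moreover have "(\<Sum>l\<in>{1..n}.
        f l * (g (fst p) * std_basis l (snd p) - std_basis l (fst p) * g (snd p))) =
      (\<Sum>l\<in>{1..n}. (if snd p = l then f l * g (fst p) else 0) - (if fst p = l then f l * g (snd p) else 0))"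
      by (rule sum.cong) (auto simp: std_basis_def algebra_simps)
    ultimately show "zmul (\<Sum>l\<in>{1..n}.
        f l * (g (fst p) * std_basis l (snd p) - std_basis l (fst p) * g (snd p))) (x p) =
      zmul (g (fst p) * f (snd p) - g (snd p) * f (fst p)) (x p)"
      by (simp add: sum_subtractf mult.commute)
  qed
  finally show ?thesis .
qed

context
  fixes \<Lambda> :: "'i set" and W :: "'i \<Rightarrow> 'z set" and n :: nat and F :: "('i, 'z, nat \<Rightarrow> int) cochain"
  assumes F: "cech_d \<Lambda> W F = 0"
begin

lemma cech_d_cup1_vec:
  assumes "homogeneous p \<phi>"
  shows "cech_d \<Lambda> W (cup1_vec n \<Lambda> W F \<phi>) = cup1_vec n \<Lambda> W F (cech_d \<Lambda> W \<phi>)"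
proof -
  have "cech_d \<Lambda> W (\<lambda>ls z. F ls z l) = 0" for l
    unfolding cech_d_vector_component F by (simp add: fun_eq_iff)
  then show ?thesis
    unfolding cup1_vec_eq cech_d_sum cech_d_vector_component [symmetric]
    by (intro sum.cong refl cech_d_cup_cocycle [OF homogeneous_component [OF assms]])
qed

lemma cech_d_mat_coeff: "cech_d \<Lambda> W (mat_coeff F l p) = 0"
proof -
  have F': "cech_d \<Lambda> W (\<lambda>ls z. F ls z l) = 0" for l
    unfolding cech_d_vector_component F by (simp add: fun_eq_iff)
  have "mat_coeff F l p = zmul (std_basis l (snd p)) (\<lambda>ls z. F ls z (fst p))
      - zmul (std_basis l (fst p)) (\<lambda>ls z. F ls z (snd p))"
    by (simp add: mat_coeff_def fun_eq_iff zmul_apply mult.commute)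
  then show ?thesis
    by (simp only: cech_d_diff cech_d_zmul F' zmul_0_right) simp
qed

lemma cech_d_cup1_mat:
  assumes "homogeneous p \<phi>"
  shows "cech_d \<Lambda> W (cup1_mat n \<Lambda> W F \<phi>) = cup1_mat n \<Lambda> W F (cech_d \<Lambda> W \<phi>)"
proof -
  have comp: "(\<lambda>ls z. cech_d \<Lambda> W (cup1_mat n \<Lambda> W F \<phi>) ls z l) =
      (\<lambda>ls z. cup1_mat n \<Lambda> W F (cech_d \<Lambda> W \<phi>) ls z l)" for l
  proof (cases "l \<in> {1..n}")
    case True
    have "cech_d \<Lambda> W (\<Sum>q\<in>upairs n. cup \<Lambda> W 2 (mat_coeff F l q) (\<lambda>ls z. \<phi> ls z (fst q) (snd q))) =
      (\<Sum>q\<in>upairs n. cup \<Lambda> W 2 (mat_coeff F l q) (cech_d \<Lambda> W (\<lambda>ls z. \<phi> ls z (fst q) (snd q))))"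
      unfolding cech_d_sum
      by (intro sum.cong refl cech_d_mat_coeff
          cech_d_cup_cocycle [OF homogeneous_component [OF homogeneous_component [OF assms]]])
    then show ?thesis
      using True
      unfolding cech_d_vector_component [symmetric] cup1_mat_component cech_d_matrix_component
      by simp
  next
    case False
    then show ?thesis
      unfolding cech_d_vector_component [symmetric] cup1_mat_component by (simp only: if_False cech_d_0)
  qed
  show ?thesis
  proof (intro ext)
    fix ls z l
    show "cech_d \<Lambda> W (cup1_mat n \<Lambda> W F \<phi>) ls z l = cup1_mat n \<Lambda> W F (cech_d \<Lambda> W \<phi>) ls z l"
      using fun_cong [OF fun_cong [OF comp [of l], of ls], of z] by simp
  qed
qed

text \<open>The failure of the product with \<open>C(F)\<close> to commute with the differential is the double product
  with \<open>F\<close>; this is what makes \<open>D\<^sub>F\<close> a differential.\<close>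

lemma cech_d_cup2:
  assumes "homogeneous p \<phi>"
  shows "cech_d \<Lambda> W (cup2 n \<Lambda> W (C_of n \<Lambda> W F) \<phi>) =
    cup2 n \<Lambda> W (C_of n \<Lambda> W F) (cech_d \<Lambda> W \<phi>) +
    zmul (msign p) (cup1_vec n \<Lambda> W F (cup1_mat n \<Lambda> W F \<phi>))"
proof -
  let ?C = "\<lambda>q ls z. C_of n \<Lambda> W F ls z (fst q) (snd q)"
  let ?\<phi> = "\<lambda>q ls z. \<phi> ls z (fst q) (snd q)"
  have hom: "homogeneous p (?\<phi> q)" for q
    by (rule homogeneous_component [OF homogeneous_component [OF assms]])
  have "(\<Sum>q\<in>upairs n. cup \<Lambda> W 4 (cech_d \<Lambda> W (?C q)) (?\<phi> q)) ls z =
      cup1_vec n \<Lambda> W F (cup1_mat n \<Lambda> W F \<phi>) ls z" for ls z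
  proof (cases "z \<in> overlap \<Lambda> W ls")
    case False
    then show ?thesis
      by (simp add: sum_apply cup_def cup1_vec_def)
  next
    case z: True
    show ?thesis
    proof (cases "length ls < 5")
      case True
      then have nil: "length ls - 4 = 0"
        by simp
      moreover have nil2: "take (length (take (length ls - 2) ls) - 2) (take (length ls - 2) ls) = []"
        using True by simp
      have "cup1_mat n \<Lambda> W F \<phi> (take (length ls - 2) ls) z l = 0" for l
        unfolding cup1_mat_def nil2 by (simp add: homogeneous_Nil [OF assms] case_prod_beta')
      ultimately show ?thesis
        using homogeneous_Nil [OF assms, of z] by (simp add: sum_apply cup_def cup1_vec_def)
    next
      case False
      define us where "us = take (length ls - 5) ls"
      have "\<exists>a b c d e. vs = [a, b, c, d, e]" if "length vs = 5" for vs :: "'i list"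
        using that by (auto simp: numeral_eq_Suc length_Suc_conv)
      moreover have "length (drop (length ls - 5) ls) = 5"
        using False by simp
      ultimately obtain a b c d e where "drop (length ls - 5) ls = [a, b, c, d, e]"
        by blast
      then have ls: "ls = us @ [a, b, c, d, e]"
        unfolding us_def by (metis append_take_drop_id)
      have z3: "z \<in> overlap \<Lambda> W (us @ [a, b, c])" and z5: "z \<in> overlap \<Lambda> W [a, b, c, d, e]"
        using z overlap_mono [of "us @ [a, b, c]" ls \<Lambda> W] overlap_mono [of "[a, b, c, d, e]" ls \<Lambda> W]
        by (auto simp: ls)
      have "(\<Sum>q\<in>upairs n. cup \<Lambda> W 4 (cech_d \<Lambda> W (?C q)) (?\<phi> q)) ls z =
          (\<Sum>q\<in>upairs n. zmul (cech_d \<Lambda> W (?C q) [a, b, c, d, e] z) (?\<phi> q (us @ [a]) z))"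
        using z by (simp add: sum_apply cup_def ls)
      also have "\<dots> = (\<Sum>q\<in>upairs n. zmul (F [a, b, c] z (fst q) * F [c, d, e] z (snd q)
          - F [a, b, c] z (snd q) * F [c, d, e] z (fst q)) (?\<phi> q (us @ [a]) z))"
        by (rule sum.cong [OF refl]) (auto simp: cech_d_C_of [OF F z5])
      also have "\<dots> = (\<Sum>l\<in>{1..n}. zmul (F [c, d, e] z l) (\<Sum>q\<in>upairs n.
          zmul (F [a, b, c] z (fst q) * std_basis l (snd q) - std_basis l (fst q) * F [a, b, c] z (snd q))
            (?\<phi> q (us @ [a]) z)))"
        by (rule sum_commutator [symmetric])
      also have "\<dots> = cup1_vec n \<Lambda> W F (cup1_mat n \<Lambda> W F \<phi>) ls z"
        using z z3 by (simp add: cup1_vec_def cup1_mat_def ls case_prod_beta')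
      finally show ?thesis .
    qed
  qed
  then have double: "(\<Sum>q\<in>upairs n. cup \<Lambda> W 4 (cech_d \<Lambda> W (?C q)) (?\<phi> q)) =
      cup1_vec n \<Lambda> W F (cup1_mat n \<Lambda> W F \<phi>)"
    by blast
  have "cech_d \<Lambda> W (cup2 n \<Lambda> W (C_of n \<Lambda> W F) \<phi>) =
      (\<Sum>q\<in>upairs n. cup \<Lambda> W 3 (?C q) (cech_d \<Lambda> W (?\<phi> q)) +
        zmul (msign p) (cup \<Lambda> W (Suc 3) (cech_d \<Lambda> W (?C q)) (?\<phi> q)))"
    unfolding cup2_eq cech_d_sum by (intro sum.cong refl cech_d_cup hom)
  also have "\<dots> = (\<Sum>q\<in>upairs n. cup \<Lambda> W 3 (?C q) (cech_d \<Lambda> W (?\<phi> q))) +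
      zmul (msign p) (\<Sum>q\<in>upairs n. cup \<Lambda> W 4 (cech_d \<Lambda> W (?C q)) (?\<phi> q))"
    by (simp only: sum.distrib zmul_sum_right Suc_numeral semiring_norm)
  finally show ?thesis
    unfolding double unfolding cup2_eq cech_d_matrix_component .
qed

end

section \<open>Cochains\<close>

definition additive_subgrp :: "'a::ab_group_add set \<Rightarrow> bool" where
  "additive_subgrp A \<longleftrightarrow> 0 \<in> A \<and> (\<forall>x\<in>A. \<forall>y\<in>A. x - y \<in> A)"

lemma additive_subgrp_UNIV: "additive_subgrp UNIV"
  by (simp add: additive_subgrp_def)

lemma additive_subgrp_0: "additive_subgrp {0}"
  by (simp add: additive_subgrp_def)

lemma additive_subgrp_fun:
  "(\<And>l. additive_subgrp (A l)) \<Longrightarrow> additive_subgrp {v. \<forall>l. v l \<in> A l}"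
  by (simp add: additive_subgrp_def)

lemma vecs_eq: "vecs n = {v. \<forall>l. v l \<in> (if l \<in> {1..n} then UNIV else {0})}"
  by (auto simp: vecs_def)

lemma upper_mats_eq:
  "upper_mats n = {m. \<forall>i. m i \<in> {v. \<forall>j. v j \<in> (if 1 \<le> i \<and> i < j \<and> j \<le> n then UNIV else {0})}}"
  by (auto simp: upper_mats_def)

lemma additive_subgrp_vecs: "additive_subgrp (vecs n)"
  unfolding vecs_eq
  by (intro additive_subgrp_fun) (simp add: additive_subgrp_UNIV additive_subgrp_0)

lemma additive_subgrp_upper_mats: "additive_subgrp (upper_mats n)"
  unfolding upper_mats_eq
  by (intro additive_subgrp_fun) (simp add: additive_subgrp_UNIV additive_subgrp_0)

lemma additive_subgrp_add:
  assumes "additive_subgrp A" "x \<in> A" "y \<in> A"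
  shows "x + y \<in> A"
proof -
  have "0 - y \<in> A"
    using assms unfolding additive_subgrp_def by blast
  then have "x - (0 - y) \<in> A"
    using assms unfolding additive_subgrp_def by blast
  then show ?thesis by simp
qed

lemma additive_subgrp_sum:
  assumes "additive_subgrp A" "\<And>i. i \<in> I \<Longrightarrow> f i \<in> A"
  shows "sum f I \<in> A"
  using assms(2)
proof (induction I rule: infinite_finite_induct)
  case (insert x I)
  then show ?case using additive_subgrp_add [OF assms(1)] by simp
qed (use assms(1) in \<open>simp_all add: additive_subgrp_def\<close>)

lemma additive_subgrp_zmul:
  assumes "additive_subgrp A" "x \<in> A"
  shows "zmul m x \<in> A"
proof -
  have sum: "(\<Sum>_<k. x) \<in> A" for k :: nat
    by (rule additive_subgrp_sum) (use assms in auto)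
  then have "0 - (\<Sum>_<k. x) \<in> A" for k :: nat
    using assms unfolding additive_subgrp_def by blast
  with sum show ?thesis by (simp add: zmul_def)
qed

text \<open>Cochains are extended by zero, so that the conditions hold on all lists and at all points.\<close>

lemma cochains_iff:
  assumes "0 \<in> A"
  shows "\<phi> \<in> cochains Z \<Lambda> W p A \<longleftrightarrow> homogeneous p \<phi> \<and>
    (\<forall>ls. continuous_map (subtopology Z (overlap \<Lambda> W ls)) euclidean (\<phi> ls)) \<and>
    (\<forall>ls z. \<phi> ls z \<in> A) \<and> (\<forall>ls z. z \<notin> overlap \<Lambda> W ls \<longrightarrow> \<phi> ls z = 0)" (is "?L \<longleftrightarrow> ?R")
proof
  assume L: ?L
  have 0: "\<phi> ls = (\<lambda>z. 0)" if "\<not> (0 \<le> p \<and> int (length ls) = p + 1)" for ls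
    using L that unfolding cochains_def by auto
  have 1: "continuous_map (subtopology Z (overlap \<Lambda> W ls)) euclidean (\<phi> ls)"
    "\<And>z. z \<in> overlap \<Lambda> W ls \<Longrightarrow> \<phi> ls z \<in> A"
    "\<And>z. z \<notin> overlap \<Lambda> W ls \<Longrightarrow> \<phi> ls z = 0" if "0 \<le> p \<and> int (length ls) = p + 1" for ls
    using L that unfolding cochains_def by auto
  have "homogeneous p \<phi>"
    using 0 unfolding homogeneous_def by (metis linorder_not_less)
  moreover have "continuous_map (subtopology Z (overlap \<Lambda> W ls)) euclidean (\<phi> ls)" for ls
    using 0 [of ls] 1(1) [of ls] by (cases "0 \<le> p \<and> int (length ls) = p + 1") simp_all
  moreover have "\<phi> ls z \<in> A" for ls z
    using 0 [of ls] 1(2,3) [of ls z] assms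
    by (cases "0 \<le> p \<and> int (length ls) = p + 1"; cases "z \<in> overlap \<Lambda> W ls") simp_all
  moreover have "\<phi> ls z = 0" if "z \<notin> overlap \<Lambda> W ls" for ls z
    using 0 [of ls] 1(3) [of ls z] that
    by (cases "0 \<le> p \<and> int (length ls) = p + 1") simp_all
  ultimately show ?R by blast
next
  assume R: ?R
  show ?L
    unfolding cochains_def mem_Collect_eq
  proof
    fix ls
    have "\<phi> ls z = 0" if "\<not> (0 \<le> p \<and> int (length ls) = p + 1)" for z
      using R that unfolding homogeneous_def by (metis linorder_not_less)
    with R show "if 0 \<le> p \<and> int (length ls) = p + 1
     then continuous_map (subtopology Z (overlap \<Lambda> W ls)) euclidean (\<phi> ls) \<and>
          (\<forall>z \<in> overlap \<Lambda> W ls. \<phi> ls z \<in> A) \<and> (\<forall>z. z \<notin> overlap \<Lambda> W ls \<longrightarrow> \<phi> ls z = 0)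
     else (\<forall>z. \<phi> ls z = 0)"
      by simp
  qed
qed

lemmas cochains_subgrp_iff = cochains_iff [OF conjunct1 [OF iffD1 [OF additive_subgrp_def]]]

lemma cochains_homogeneous:
  "additive_subgrp A \<Longrightarrow> \<phi> \<in> cochains Z \<Lambda> W p A \<Longrightarrow> homogeneous p \<phi>"
  by (simp add: cochains_subgrp_iff)

lemma cochains_fun_iff:
  assumes "\<And>l. 0 \<in> A l"
  shows "\<phi> \<in> cochains Z \<Lambda> W p {v. \<forall>l. v l \<in> A l} \<longleftrightarrow>
    (\<forall>l. (\<lambda>ls z. \<phi> ls z l) \<in> cochains Z \<Lambda> W p (A l))"
proof -
  have zero: "0 \<in> {v. \<forall>l. v l \<in> A l}"
    using assms by simp
  have hom: "homogeneous p \<phi> \<longleftrightarrow> (\<forall>l. homogeneous p (\<lambda>ls z. \<phi> ls z l))"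
    unfolding homogeneous_def fun_eq_iff zero_fun_apply by blast
  show ?thesis
    unfolding cochains_iff [OF assms] cochains_iff [OF zero] hom
      continuous_map_fun_iff [where f = "\<phi> _"] fun_eq_iff [where f = "\<phi> _ _"] mem_Collect_eq
      zero_fun_apply
    by blast
qed

lemma cochains_0: "additive_subgrp A \<Longrightarrow> 0 \<in> cochains Z \<Lambda> W p A"
  by (simp add: cochains_subgrp_iff homogeneous_def additive_subgrp_def)
     (simp add: zero_fun_def)

lemma cochains_diff:
  fixes A :: "'a::topological_ab_group_add set"
  assumes "additive_subgrp A" "\<phi> \<in> cochains Z \<Lambda> W p A" "\<psi> \<in> cochains Z \<Lambda> W p A"
  shows "\<phi> - \<psi> \<in> cochains Z \<Lambda> W p A"
proof -
  note [simp] = cochains_subgrp_iff [OF assms(1)]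
  have "continuous_map (subtopology Z (overlap \<Lambda> W ls)) euclidean ((\<phi> - \<psi>) ls)" for ls
    using continuous_map_group_minus [of _ "\<phi> ls" "\<psi> ls"] assms by (simp add: fun_diff_def)
  moreover have "homogeneous p (\<phi> - \<psi>)"
    using assms by (simp add: homogeneous_def)
  moreover have "(\<phi> - \<psi>) ls z \<in> A" for ls z
    using assms by (simp add: additive_subgrp_def)
  ultimately show ?thesis
    using assms by simp
qed

lemma additive_subgrp_cochains:
  fixes A :: "'a::topological_ab_group_add set"
  assumes "additive_subgrp A"
  shows "additive_subgrp (cochains Z \<Lambda> W p A)"
  unfolding additive_subgrp_def using cochains_0 [OF assms] cochains_diff [OF assms] by blast

lemma cochain_continuous_face:
  assumes "additive_subgrp A" "\<phi> \<in> cochains Z \<Lambda> W p A" "set ks \<subseteq> set ls"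
  shows "continuous_map (subtopology Z (overlap \<Lambda> W ls)) euclidean (\<phi> ks)"
proof (cases "ks = []")
  case True
  then have "\<phi> ks = (\<lambda>z. 0)"
    using homogeneous_Nil [OF cochains_homogeneous [OF assms(1,2)]] by auto
  then show ?thesis by simp
next
  case False
  then show ?thesis
    using assms overlap_mono [OF False assms(3)] continuous_map_from_subtopology_mono
    by (metis cochains_subgrp_iff)
qed

lemma cech_d_cochain:
  fixes A :: "'a::topological_ab_group_add set" and \<phi> :: "('i, 'z, 'a) cochain"
  assumes A: "additive_subgrp A" and \<phi>: "\<phi> \<in> cochains Z \<Lambda> W p A"
  shows "cech_d \<Lambda> W \<phi> \<in> cochains Z \<Lambda> W (p + 1) A"
  unfolding cochains_subgrp_iff [OF A]
proof (intro conjI allI impI)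
  show "homogeneous (p + 1) (cech_d \<Lambda> W \<phi>)"
    unfolding homogeneous_def
  proof (intro allI impI)
    fix ls :: "'i list" and z assume *: "p + 1 < 0 \<or> int (length ls) \<noteq> p + 1 + 1"
    have "\<phi> (omit i ls) z = 0" if "i < length ls" for i
      using cochains_homogeneous [OF A \<phi>] * that length_omit [OF that]
      unfolding homogeneous_def by auto
    then show "cech_d \<Lambda> W \<phi> ls z = 0"
      by (simp add: cech_d_def)
  qed
  fix ls :: "'i list" and z
  have "continuous_map (subtopology Z (overlap \<Lambda> W ls)) euclidean
      (\<lambda>z. \<Sum>i<length ls. zmul (msign (int i)) (\<phi> (omit i ls) z))"
    by (intro continuous_map_group_sum continuous_map_zmul
        cochain_continuous_face [OF A \<phi> set_omit]) simp
  then show "continuous_map (subtopology Z (overlap \<Lambda> W ls)) euclidean (cech_d \<Lambda> W \<phi> ls)"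
    by (rule continuous_map_eq) (simp add: cech_d_def)
  show "cech_d \<Lambda> W \<phi> ls z \<in> A"
    using A \<phi> by (auto simp: cech_d_def cochains_subgrp_iff additive_subgrp_def
        intro!: additive_subgrp_sum additive_subgrp_zmul)
qed (simp add: cech_d_def)

lemma cup_cochain:
  fixes \<phi> :: "('i, 'z, 'g::topological_ab_group_add) cochain"
  assumes c: "c \<in> cochains Z \<Lambda> W (int q) UNIV" and \<phi>: "\<phi> \<in> cochains Z \<Lambda> W p UNIV"
  shows "cup \<Lambda> W q c \<phi> \<in> cochains Z \<Lambda> W (p + int q) UNIV"
  unfolding cochains_iff [OF UNIV_I]
proof (intro conjI allI impI)
  note hom = cochains_homogeneous [OF additive_subgrp_UNIV \<phi>]
  show "homogeneous (p + int q) (cup \<Lambda> W q c \<phi>)"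
    unfolding homogeneous_def
  proof (intro allI impI)
    fix ls :: "'i list" and z assume *: "p + int q < 0 \<or> int (length ls) \<noteq> p + int q + 1"
    have "\<phi> (take (length ls - q) ls) z = 0"
    proof (cases "length ls \<le> q")
      case True
      then show ?thesis using homogeneous_Nil [OF hom] by simp
    next
      case False
      then have "p < 0 \<or> int (length (take (length ls - q) ls)) \<noteq> p + 1"
        using * by auto
      then show ?thesis using hom unfolding homogeneous_def by blast
    qed
    then show "cup \<Lambda> W q c \<phi> ls z = 0"
      by (simp add: cup_def)
  qed
  fix ls :: "'i list" and z
  have "continuous_map (subtopology Z (overlap \<Lambda> W ls)) euclidean
      (\<lambda>z. zmul (c (drop (length ls - Suc q) ls) z) (\<phi> (take (length ls - q) ls) z))"
    by (intro continuous_map_zmul cochain_continuous_face [OF additive_subgrp_UNIV c set_drop_subset]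
        cochain_continuous_face [OF additive_subgrp_UNIV \<phi> set_take_subset])
  then show "continuous_map (subtopology Z (overlap \<Lambda> W ls)) euclidean (cup \<Lambda> W q c \<phi> ls)"
    by (rule continuous_map_eq) (simp add: cup_def)
qed (simp_all add: cup_def)


section \<open>The three complexes\<close>

lemma cochains_mono:
  assumes "0 \<in> A" "A \<subseteq> B" "\<phi> \<in> cochains Z \<Lambda> W p A"
  shows "\<phi> \<in> cochains Z \<Lambda> W p B"
  using assms(3) subsetD [OF assms(2)] unfolding cochains_iff [OF assms(1)]
    cochains_iff [OF subsetD [OF assms(2,1)]] by blast

lemma cochains_component:
  assumes "0 \<in> A" "\<phi> \<in> cochains Z \<Lambda> W p A"
  shows "(\<lambda>ls z. \<phi> ls z l) \<in> cochains Z \<Lambda> W p UNIV"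
proof -
  have "\<phi> \<in> cochains Z \<Lambda> W p {v. \<forall>l. v l \<in> UNIV}"
    using cochains_mono [OF assms(1) _ assms(2)] by simp
  then show ?thesis
    by (subst (asm) cochains_fun_iff) auto
qed

lemma zero_in_vecs: "0 \<in> vecs n"
  by (simp add: vecs_def)

lemma zero_in_upper_mats: "0 \<in> upper_mats n"
  by (simp add: upper_mats_def)

lemma cochains_matrix_component:
  assumes "0 \<in> A" "\<phi> \<in> cochains Z \<Lambda> W p A"
  shows "(\<lambda>ls z. \<phi> ls z i j) \<in> cochains Z \<Lambda> W p UNIV"
  using cochains_component [OF UNIV_I cochains_component [OF assms, of i], of j] by simp

lemma complex_cech:
  "complex (cech_complex Z \<Lambda> W :: ('i, 'z, 'g::topological_ab_group_add) cochain cochain_complex)"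
  by standard (simp_all add: cech_complex_def cochains_0 cochains_diff additive_subgrp_UNIV
      cech_d_cochain cech_d_diff cech_d_cech_d)

lemma F_product_msign: "F_product n \<Lambda> W F (msign s) x = zmul (msign s) (F_product n \<Lambda> W F 1 x)"
  by (simp add: F_product_def case_prod_beta' zmul_add_right)

lemma F_product_minus:
  "F_product n \<Lambda> W F s (x - y) = F_product n \<Lambda> W F s x - F_product n \<Lambda> W F s y"
  by (simp add: F_product_def case_prod_beta' cup1_vec_diff cup2_diff zmul_diff_right)

lemma F_product_0: "F_product n \<Lambda> W F s 0 = 0"
  using F_product_minus [of n \<Lambda> W F s 0 0] by simp

text \<open>The twisted complex is the mapping cone of the product with \<open>F\<close>.\<close>

lemma obj_twisted:
  "obj (twisted_complex Z \<Lambda> W n F) k = cochains Z \<Lambda> W k UNIV \<times> obj (reduced_complex Z \<Lambda> W n F) (k - 1)"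
  by (simp add: twisted_complex_def reduced_complex_def)

lemma diff_twisted:
  "diff (twisted_complex Z \<Lambda> W n F) k y =
    (cech_d \<Lambda> W (fst y) + F_product n \<Lambda> W F (msign (k + 1)) (snd y),
     diff (reduced_complex Z \<Lambda> W n F) (k - 1) (snd y))"
  by (simp add: twisted_complex_def reduced_complex_def case_prod_beta')

locale twisting =
  fixes Z :: "'z topology" and \<Lambda> :: "'i set" and W :: "'i \<Rightarrow> 'z set"
    and n :: nat and F :: "('i, 'z, nat \<Rightarrow> int) cochain"
  assumes F_cochain: "F \<in> cochains Z \<Lambda> W 2 (vecs n)" and F_cocycle: "cech_d \<Lambda> W F = 0"
begin

abbreviation cech :: "('i, 'z, 'g::topological_ab_group_add) cochain cochain_complex" where
  "cech \<equiv> cech_complex Z \<Lambda> W"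

abbreviation twisted :: "('i, 'z, 'g::topological_ab_group_add) triple_cochain cochain_complex" where
  "twisted \<equiv> twisted_complex Z \<Lambda> W n F"

abbreviation reduced :: "('i, 'z, 'g::topological_ab_group_add) pair_cochain cochain_complex" where
  "reduced \<equiv> reduced_complex Z \<Lambda> W n F"

abbreviation Fprod :: "int \<Rightarrow> ('i, 'z, 'g::ab_group_add) pair_cochain \<Rightarrow> ('i, 'z, 'g) cochain" where
  "Fprod \<equiv> F_product n \<Lambda> W F"

lemma F_component: "(\<lambda>ls z. F ls z l) \<in> cochains Z \<Lambda> W 2 UNIV"
  by (rule cochains_component [OF zero_in_vecs F_cochain])

lemma C_of_component: "(\<lambda>ls z. C_of n \<Lambda> W F ls z i j) \<in> cochains Z \<Lambda> W 3 UNIV"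
  unfolding cochains_iff [OF UNIV_I]
proof (intro conjI allI impI)
  fix ls :: "'i list" and z
  show "continuous_map (subtopology Z (overlap \<Lambda> W ls)) euclidean (\<lambda>z. C_of n \<Lambda> W F ls z i j)"
  proof (cases "length ls = 4 \<and> 1 \<le> i \<and> i < j \<and> j \<le> n")
    case True
    have "continuous_map (subtopology Z (overlap \<Lambda> W ls)) euclidean
      (\<lambda>z. zmul (F [ls!0, ls!1, ls!2] z i) (F [ls!0, ls!2, ls!3] z j)
        - zmul (F [ls!1, ls!2, ls!3] z i) (F [ls!0, ls!1, ls!3] z j))"
      by (intro continuous_map_group_minus continuous_map_zmul
          cochain_continuous_face [OF additive_subgrp_UNIV F_component]) (use True in auto)
    then show ?thesis
      by (rule continuous_map_eq) (use True in \<open>simp add: C_of_def\<close>)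
  qed (auto simp: C_of_def)
qed (simp_all add: C_of_def homogeneous_def)

lemma mat_coeff_cochain: "mat_coeff F l p \<in> cochains Z \<Lambda> W 2 UNIV"
proof -
  have "mat_coeff F l p = zmul (std_basis l (snd p)) (\<lambda>ls z. F ls z (fst p))
      - zmul (std_basis l (fst p)) (\<lambda>ls z. F ls z (snd p))"
    by (simp add: mat_coeff_def fun_eq_iff zmul_apply mult.commute)
  then show ?thesis
    by (simp only: cochains_diff additive_subgrp_UNIV
        additive_subgrp_zmul [OF additive_subgrp_cochains [OF additive_subgrp_UNIV] F_component])
qed

lemma cup1_vec_cochain:
  fixes \<phi> :: "('i, 'z, nat \<Rightarrow> 'g::topological_ab_group_add) cochain"
  assumes "\<phi> \<in> cochains Z \<Lambda> W p (vecs n)"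
  shows "cup1_vec n \<Lambda> W F \<phi> \<in> cochains Z \<Lambda> W (p + 2) UNIV"
  unfolding cup1_vec_eq
proof (rule additive_subgrp_sum [OF additive_subgrp_cochains [OF additive_subgrp_UNIV]])
  fix l
  show "cup \<Lambda> W 2 (\<lambda>ls z. F ls z l) (\<lambda>ls z. \<phi> ls z l) \<in> cochains Z \<Lambda> W (p + 2) UNIV"
    using cup_cochain [where q = 2, OF _ cochains_component [OF zero_in_vecs assms], of _ l] F_component
    by simp
qed

lemma cup1_mat_cochain:
  fixes \<phi> :: "('i, 'z, nat \<Rightarrow> nat \<Rightarrow> 'g::topological_ab_group_add) cochain"
  assumes "\<phi> \<in> cochains Z \<Lambda> W p (upper_mats n)"
  shows "cup1_mat n \<Lambda> W F \<phi> \<in> cochains Z \<Lambda> W (p + 2) (vecs n)"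
proof -
  have "cup \<Lambda> W 2 (mat_coeff F l q) (\<lambda>ls z. \<phi> ls z (fst q) (snd q)) \<in> cochains Z \<Lambda> W (p + 2) UNIV"
    for l q
    using cup_cochain [where q = 2, OF _ cochains_matrix_component [OF zero_in_upper_mats assms]]
      mat_coeff_cochain by simp
  then have "(\<Sum>q\<in>upairs n. cup \<Lambda> W 2 (mat_coeff F l q) (\<lambda>ls z. \<phi> ls z (fst q) (snd q)))
      \<in> cochains Z \<Lambda> W (p + 2) UNIV" for l
    by (intro additive_subgrp_sum [OF additive_subgrp_cochains [OF additive_subgrp_UNIV]])
  then have "(\<lambda>ls z. cup1_mat n \<Lambda> W F \<phi> ls z l)
      \<in> cochains Z \<Lambda> W (p + 2) (if l \<in> {1..n} then UNIV else {0})" for l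
    unfolding cup1_mat_component by (simp add: cochains_0 additive_subgrp_0)
  then show ?thesis
    unfolding vecs_eq by (subst cochains_fun_iff) simp_all
qed

lemma cup2_cochain:
  fixes \<phi> :: "('i, 'z, nat \<Rightarrow> nat \<Rightarrow> 'g::topological_ab_group_add) cochain"
  assumes "\<phi> \<in> cochains Z \<Lambda> W p (upper_mats n)"
  shows "cup2 n \<Lambda> W (C_of n \<Lambda> W F) \<phi> \<in> cochains Z \<Lambda> W (p + 3) UNIV"
  unfolding cup2_eq
proof (rule additive_subgrp_sum [OF additive_subgrp_cochains [OF additive_subgrp_UNIV]])
  fix q :: "nat \<times> nat"
  show "cup \<Lambda> W 3 (\<lambda>ls z. C_of n \<Lambda> W F ls z (fst q) (snd q)) (\<lambda>ls z. \<phi> ls z (fst q) (snd q))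
      \<in> cochains Z \<Lambda> W (p + 3) UNIV"
    using cup_cochain [where q = 3, OF _ cochains_matrix_component [OF zero_in_upper_mats assms]]
      C_of_component by simp
qed

lemma in_reduced:
  "x \<in> obj reduced m \<longleftrightarrow> fst x \<in> cochains Z \<Lambda> W m (vecs n) \<and>
     snd x \<in> cochains Z \<Lambda> W (m - 1) (upper_mats n)"
  by (simp add: reduced_complex_def mem_Times_iff)

lemma diff_reduced:
  "diff reduced m x = (cech_d \<Lambda> W (fst x) + zmul (msign (m + 1)) (cup1_mat n \<Lambda> W F (snd x)),
     cech_d \<Lambda> W (snd x))"
  by (simp add: reduced_complex_def case_prod_beta')

lemma F_product_cochain:
  fixes x :: "('i, 'z, 'g::topological_ab_group_add) pair_cochain"
  assumes "x \<in> obj reduced m"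
  shows "Fprod s x \<in> cochains Z \<Lambda> W (m + 2) UNIV"
proof -
  have "cup1_vec n \<Lambda> W F (fst x) \<in> cochains Z \<Lambda> W (m + 2) UNIV"
    "cup2 n \<Lambda> W (C_of n \<Lambda> W F) (snd x) \<in> cochains Z \<Lambda> W (m + 2) UNIV"
    using assms cup1_vec_cochain [of "fst x" m] cup2_cochain [of "snd x" "m - 1"]
    by (simp_all add: in_reduced add.commute)
  then show ?thesis
    unfolding F_product_def case_prod_beta'
    by (intro additive_subgrp_add additive_subgrp_zmul additive_subgrp_cochains additive_subgrp_UNIV)
qed

lemma complex_reduced: "complex (reduced :: ('i, 'z, 'g::topological_ab_group_add) pair_cochain cochain_complex)"
proof
  fix m :: int and x y :: "('i, 'z, 'g) pair_cochain"
  note subgrps = additive_subgrp_vecs additive_subgrp_upper_mats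
  show "0 \<in> obj reduced m"
    by (simp add: in_reduced cochains_0 subgrps)
  assume x: "x \<in> obj reduced m"
  then have hom: "homogeneous m (fst x)" "homogeneous (m - 1) (snd x)"
    using cochains_homogeneous subgrps unfolding in_reduced by blast+
  have "cup1_mat n \<Lambda> W F (snd x) \<in> cochains Z \<Lambda> W (m + 1) (vecs n)"
    using x cup1_mat_cochain [of "snd x" "m - 1"] by (simp add: in_reduced add.commute)
  then have "zmul (msign (m + 1)) (cup1_mat n \<Lambda> W F (snd x)) \<in> cochains Z \<Lambda> W (m + 1) (vecs n)"
    by (intro additive_subgrp_zmul additive_subgrp_cochains subgrps)
  moreover have "cech_d \<Lambda> W (fst x) \<in> cochains Z \<Lambda> W (m + 1) (vecs n)"
    "cech_d \<Lambda> W (snd x) \<in> cochains Z \<Lambda> W (m - 1 + 1) (upper_mats n)"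
    using x unfolding in_reduced by (blast intro: cech_d_cochain subgrps)+
  ultimately show "diff reduced m x \<in> obj reduced (m + 1)"
    unfolding in_reduced diff_reduced fst_conv snd_conv
    by (simp add: in_reduced diff_reduced additive_subgrp_add additive_subgrp_cochains subgrps)
  show "diff reduced (m + 1) (diff reduced m x) = 0"
    using cech_d_cup1_mat [OF F_cocycle hom(2)]
    by (simp add: diff_reduced cech_d_add cech_d_zmul cech_d_cech_d zero_prod_def)
       (simp add: zmul_msign)
  assume y: "y \<in> obj reduced m"
  show "x - y \<in> obj reduced m"
    using x y by (simp add: in_reduced cochains_diff subgrps)
  show "diff reduced m (x - y) = diff reduced m x - diff reduced m y"
    by (simp add: diff_reduced cech_d_diff cup1_mat_diff zmul_diff_right minus_prod_def)
qed

lemma cech_d_F_product: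
  fixes x :: "('i, 'z, 'g::topological_ab_group_add) pair_cochain"
  assumes "x \<in> obj reduced m"
  shows "cech_d \<Lambda> W (Fprod s x) = Fprod s (diff reduced m x)"
proof -
  have hom: "homogeneous m (fst x)" "homogeneous (m - 1) (snd x)"
    using assms cochains_homogeneous additive_subgrp_vecs additive_subgrp_upper_mats
    unfolding in_reduced by blast+
  have "msign (m - 1) = msign (m + 1)"
    by (simp add: msign_def)
  then show ?thesis
    unfolding F_product_def case_prod_beta' diff_reduced fst_conv snd_conv cech_d_add cech_d_zmul
      cech_d_cup1_vec [OF F_cocycle hom(1)] cech_d_cup2 [OF F_cocycle hom(2)]
      cup1_vec_add cup1_vec_zmul zmul_add_right
    by (simp only: add.assoc add.commute add.left_commute)
qed

lemma complex_twisted: "complex (twisted :: ('i, 'z, 'g::topological_ab_group_add) triple_cochain cochain_complex)"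
proof
  interpret R: complex "reduced :: ('i, 'z, 'g) pair_cochain cochain_complex"
    by (rule complex_reduced)
  note U = additive_subgrp_UNIV
  fix k :: int and x y :: "('i, 'z, 'g) triple_cochain"
  show "0 \<in> obj (twisted :: ('i, 'z, 'g) triple_cochain cochain_complex) k"
    by (simp add: obj_twisted mem_Times_iff cochains_0 U R.zero_mem)
  assume x: "x \<in> obj twisted k"
  then have x': "fst x \<in> cochains Z \<Lambda> W k UNIV" "snd x \<in> obj reduced (k - 1)"
    by (simp_all add: obj_twisted mem_Times_iff)
  have "Fprod (msign (k + 1)) (snd x) \<in> cochains Z \<Lambda> W (k + 1) UNIV"
    using F_product_cochain [OF x'(2), of "msign (k + 1)"] by (simp add: add.commute)
  then show "diff twisted k x \<in> obj twisted (k + 1)"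
    using x' R.diff_mem [OF x'(2)]
    by (simp add: obj_twisted diff_twisted additive_subgrp_add additive_subgrp_cochains U
        cech_d_cochain)
  show "diff twisted (k + 1) (diff twisted k x) = 0"
  proof -
    have "cech_d \<Lambda> W (Fprod (msign (k + 1)) (snd x)) =
        Fprod (msign (k + 1)) (diff reduced (k - 1) (snd x))"
      by (rule cech_d_F_product [OF x'(2)])
    moreover have "diff reduced k (diff reduced (k - 1) (snd x)) = 0"
      using R.diff_diff [OF x'(2)] by simp
    ultimately show ?thesis
      by (simp add: diff_twisted cech_d_add cech_d_cech_d F_product_msign zmul_msign zero_prod_def)
  qed
  assume y: "y \<in> obj twisted k"
  then have y': "fst y \<in> cochains Z \<Lambda> W k UNIV" "snd y \<in> obj reduced (k - 1)"
    by (simp_all add: obj_twisted mem_Times_iff)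
  show "x - y \<in> obj twisted k"
    using x' y' by (simp add: obj_twisted mem_Times_iff cochains_diff U R.minus_mem)
  show "diff twisted k (x - y) = diff twisted k x - diff twisted k y"
    using x' y' by (simp add: prod_eq_iff diff_twisted cech_d_diff F_product_minus R.diff_minus)
qed

lemma cohomology_map_F_product:
  "cohomology_map (reduced :: ('i, 'z, 'g::topological_ab_group_add) pair_cochain cochain_complex) cech
     m (m + 2) (Fprod s)"
proof (intro cohomology_map.intro cohomology_map_axioms.intro complex_reduced complex_cech)
  interpret R: complex "reduced :: ('i, 'z, 'g) pair_cochain cochain_complex"
    by (rule complex_reduced)
  fix x y :: "('i, 'z, 'g) pair_cochain"
  show "Fprod s x \<in> obj cech (m + 2)" if "x \<in> obj reduced m"
    using F_product_cochain [OF that] by (simp add: cech_complex_def)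
  show "Fprod s (x - y) = Fprod s x - Fprod s y"
    by (rule F_product_minus)
  show "diff cech (m + 2) (Fprod s x) = 0" if "x \<in> obj reduced m" "diff reduced m x = 0"
    using cech_d_F_product [OF that(1), of s] that(2) by (simp add: cech_complex_def F_product_0)
  show "Fprod s (diff reduced (m - 1) x) \<in> coboundaries cech (m + 2)" if "x \<in> obj reduced (m - 1)"
    using F_product_cochain [OF that, of s] cech_d_F_product [OF that, of s]
    by (auto simp: coboundaries_def cech_complex_def intro!: image_eqI [of _ _ "Fprod s x"])
qed

end


section \<open>The rows\<close>

text \<open>The reduced complex of degree \<open>k - 1\<close> is the quotient of the twisted complex of degree \<open>k\<close>.\<close>

definition shift_complex :: "'c cochain_complex \<Rightarrow> 'c cochain_complex" where
  "shift_complex D = \<lparr>obj = (\<lambda>k. obj D (k - 1)), diff = (\<lambda>k. diff D (k - 1))\<rparr>"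

lemma coboundaries_shift: "coboundaries (shift_complex D) k = coboundaries D (k - 1)"
  by (simp add: coboundaries_def shift_complex_def)

lemma cocycle_group_shift: "cocycle_group (shift_complex D) k = cocycle_group D (k - 1)"
  by (simp add: cocycle_group_def shift_complex_def)

lemma cohomology_shift: "cohomology (shift_complex D) k = cohomology D (k - 1)"
  by (simp add: cohomology_def coboundaries_shift cocycle_group_shift)

lemma coh_class_shift: "coh_class (shift_complex D) k x = coh_class D (k - 1) x"
  by (simp add: coh_class_def coboundaries_shift cocycle_group_shift)

lemma coh_map_shift: "coh_map (shift_complex D) k f X = coh_map D (k - 1) f X"
  by (simp add: coh_map_def coh_class_shift)

lemma (in complex) complex_shift: "complex (shift_complex D)"
proof
  show "diff (shift_complex D) k x \<in> obj (shift_complex D) (k + 1)"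
    if "x \<in> obj (shift_complex D) k" for k x
    using that diff_mem [of x "k - 1"] by (simp add: shift_complex_def)
  show "diff (shift_complex D) (k + 1) (diff (shift_complex D) k x) = 0"
    if "x \<in> obj (shift_complex D) k" for k x
    using that diff_diff [of x "k - 1"] by (simp add: shift_complex_def)
qed (simp_all add: shift_complex_def zero_mem minus_mem diff_minus)

lemma cohomology_map_unshift:
  assumes "cohomology_map C (shift_complex D) k m f" "complex D"
  shows "cohomology_map C D k (m - 1) f"
proof -
  interpret cohomology_map C "shift_complex D" k m f by fact
  show ?thesis
    by (intro cohomology_map.intro cohomology_map_axioms.intro assms(2) C.complex_axioms)
       (use map_mem map_minus map_cocycle map_coboundary in
         \<open>simp_all add: shift_complex_def coboundaries_shift [unfolded shift_complex_def]\<close>)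
qed

lemma exact_at_cong:
  assumes "exact_at A B C f g" "\<And>x. x \<in> carrier A \<Longrightarrow> f' x = f x" "\<And>x. x \<in> carrier B \<Longrightarrow> g' x = g x"
  shows "exact_at A B C f' g'"
proof -
  have f: "group_hom A B f" and g: "group_hom B C g" and ex: "kernel B C g = f ` carrier A"
    using assms(1) by (simp_all add: exact_at_def)
  interpret f: group_hom A B f by (rule f)
  interpret g: group_hom B C g by (rule g)
  have "group_hom A B f'"
    by (intro group_hom.intro group_hom_axioms.intro homI f.is_group f.H.is_group)
       (simp_all add: assms(2))
  moreover have "group_hom B C g'"
    by (intro group_hom.intro group_hom_axioms.intro homI g.is_group g.H.is_group)
       (simp_all add: assms(3))
  moreover have "f' ` carrier A = f ` carrier A"
    using assms(2) by (intro image_cong refl) simp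
  moreover have "kernel B C g' = kernel B C g"
    using assms(3) by (auto simp: kernel_def)
  ultimately show ?thesis
    using ex by (simp add: exact_at_def)
qed

context twisting
begin

definition row_seq :: "(('i, 'z, 'g::topological_ab_group_add) cochain, ('i, 'z, 'g) triple_cochain,
    ('i, 'z, 'g) pair_cochain) coefficient_sequence" where
  "row_seq = \<lparr>sub_cx = cech, mid_cx = twisted, quo_cx = shift_complex reduced,
     inc = (\<lambda>\<phi>. (\<phi>, 0, 0)), prj = (\<lambda>(\<phi>0, \<phi>1, \<phi>2). (\<phi>1, \<phi>2))\<rparr>"

lemma row_seq_simps:
  "sub_cx row_seq = cech" "mid_cx row_seq = twisted" "quo_cx row_seq = shift_complex reduced"
  "inc row_seq \<phi> = (\<phi>, 0)" "prj row_seq y = snd y"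
  by (simp_all add: row_seq_def zero_prod_def case_prod_beta')

lemma short_exact_row:
  "short_exact (row_seq :: (('i, 'z, 'g::topological_ab_group_add) cochain, _, _) coefficient_sequence)"
    (is "short_exact ?S")
proof -
  interpret R: complex "reduced :: ('i, 'z, 'g) pair_cochain cochain_complex"
    by (rule complex_reduced)
  show ?thesis
  proof (intro short_exact.intro short_exact_axioms.intro)
    show "complex (sub_cx ?S)" "complex (mid_cx ?S)" "complex (quo_cx ?S)"
      by (simp_all add: row_seq_simps complex_cech complex_twisted R.complex_shift)
    show "a = 0" if "a \<in> obj (sub_cx ?S) k" "inc ?S a = 0" for a k
      using that by (simp add: row_seq_simps zero_prod_def)
    show "\<exists>b\<in>obj (mid_cx row_seq) k. prj row_seq b = c"
      if "c \<in> obj (quo_cx row_seq) k" for c :: "('i, 'z, 'g) pair_cochain" and k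
      using that by (intro bexI [of _ "(0, c)"])
        (simp_all add: row_seq_simps shift_complex_def obj_twisted cochains_0 additive_subgrp_UNIV)
    show "\<exists>a\<in>obj (sub_cx row_seq) k. inc row_seq a = b"
      if "b \<in> obj (mid_cx row_seq) k" "prj row_seq b = 0" for b :: "('i, 'z, 'g) triple_cochain" and k
      using that
      by (intro bexI [of _ "fst b"]) (auto simp: row_seq_simps cech_complex_def obj_twisted prod_eq_iff)
  qed (auto simp: row_seq_simps shift_complex_def cech_complex_def obj_twisted diff_twisted
      R.zero_mem R.diff_0 F_product_0 minus_prod_def zero_prod_def [symmetric])
qed

text \<open>The connecting map multiplies by \<open>(-1)\<^sup>k\<^sup>+\<^sup>1\<close> and the cup product by \<open>(-1)\<^sup>k\<^sup>+\<^sup>2\<close>. They differ by the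
  sign \<open>-1\<close> in every degree, whence the constant odd exponent \<open>1\<close>.\<close>

lemma cup_F_eq_conn:
  fixes X :: "('i, 'z, 'g::topological_ab_group_add) pair_cochain set"
  assumes "X \<in> carrier (cohomology reduced (k - 1))"
  shows "cup_F Z \<Lambda> W n F k X = conn_coh row_seq 1 k X"
proof -
  interpret E: short_exact "row_seq :: (('i, 'z, 'g) cochain, _, _) coefficient_sequence"
    by (rule short_exact_row)
  interpret P: cohomology_map "reduced :: ('i, 'z, 'g) pair_cochain cochain_complex" cech "k - 1"
    "k - 1 + 2" "Fprod (msign (k + 2))"
    by (rule cohomology_map_F_product)
  obtain x where x: "x \<in> obj reduced (k - 1)" "diff reduced (k - 1) x = 0"
    "X = coh_class reduced (k - 1) x"
    using assms by (rule P.C.cohomology_classE)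
  \<comment> \<open>The cocycle \<open>x\<close> lifts to \<open>(0, x)\<close>, whose differential has only a first component.\<close>
  have "E.connects k x (0, x) (Fprod (msign (k + 1)) x)"
    using x F_product_cochain [OF x(1), of "msign (k + 1)"]
    by (simp add: E.connects_def row_seq_simps obj_twisted diff_twisted cech_complex_def cech_d_0
        cochains_0 additive_subgrp_UNIV shift_complex_def add.commute)
  then have "conn_coh row_seq 1 k X = coh_class cech (k + 1) (zmul (msign 1) (Fprod (msign (k + 1)) x))"
    using E.conn_class [of k x "(0, x)" _ 1] x by (simp add: row_seq_simps coh_class_shift)
  also have "zmul (msign 1) (Fprod (msign (k + 1)) x) = Fprod (msign (k + 2)) x"
    by (simp add: F_product_msign zmul_msign)
  also have "coh_class cech (k + 1) \<dots> = cup_F Z \<Lambda> W n F k X"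
    using P.coh_map_class [OF x(1,2)] x by (simp add: cup_F_def add.commute)
  finally show ?thesis ..
qed

lemma pi_up_eq: "pi_up Z \<Lambda> W n F k X = inc_coh row_seq k X"
  by (simp add: pi_up_def inc_coh_def row_seq_def)

lemma pi_down_eq: "pi_down Z \<Lambda> W n F k X = prj_coh row_seq k X"
  by (simp add: pi_down_def prj_coh_def row_seq_def coh_map_shift)

lemma row_exact: "row_exact TYPE('g::topological_ab_group_add) Z \<Lambda> W n F"
proof -
  interpret E: short_exact "row_seq :: (('i, 'z, 'g) cochain, _, _) coefficient_sequence"
    by (rule short_exact_row)
  show ?thesis
    unfolding row_exact_def Let_def
  proof (intro allI conjI)
    fix k
    show "exact_at (cohomology (cech :: ('i, 'z, 'g) cochain cochain_complex) k)
        (cohomology twisted k) (cohomology reduced (k - 1)) (pi_up Z \<Lambda> W n F k) (pi_down Z \<Lambda> W n F k)"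
      using E.exact_at_mid [of k] unfolding row_seq_simps cohomology_shift
      by (rule exact_at_cong) (simp_all add: pi_up_eq pi_down_eq)
    show "exact_at (cohomology (twisted :: ('i, 'z, 'g) triple_cochain cochain_complex) k)
        (cohomology reduced (k - 1)) (cohomology cech (k + 1)) (pi_down Z \<Lambda> W n F k) (cup_F Z \<Lambda> W n F k)"
      using E.exact_at_quo [of k 1] unfolding row_seq_simps cohomology_shift
      by (rule exact_at_cong) (simp_all add: pi_down_eq cup_F_eq_conn)
    show "exact_at (cohomology (reduced :: ('i, 'z, 'g) pair_cochain cochain_complex) (k - 1))
        (cohomology cech (k + 1)) (cohomology twisted (k + 1)) (cup_F Z \<Lambda> W n F k) (pi_up Z \<Lambda> W n F (k + 1))"
      using E.exact_at_sub [of k 1] unfolding row_seq_simps cohomology_shift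
      by (rule exact_at_cong) (simp_all add: pi_up_eq cup_F_eq_conn)
  qed
qed

lemma cohomology_map_pi_up:
  "cohomology_map (cech :: ('i, 'z, 'g::topological_ab_group_add) cochain cochain_complex) twisted
     k k (\<lambda>\<phi>. (\<phi>, 0, 0))"
proof -
  interpret E: short_exact "row_seq :: (('i, 'z, 'g) cochain, _, _) coefficient_sequence"
    by (rule short_exact_row)
  show ?thesis
    using E.inc.cohomology_map_axioms by (simp add: row_seq_def)
qed

lemma cohomology_map_pi_down:
  "cohomology_map (twisted :: ('i, 'z, 'g::topological_ab_group_add) triple_cochain cochain_complex)
     reduced k (k - 1) (\<lambda>(\<phi>0, \<phi>1, \<phi>2). (\<phi>1, \<phi>2))"
proof -
  interpret E: short_exact "row_seq :: (('i, 'z, 'g) cochain, _, _) coefficient_sequence"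
    by (rule short_exact_row)
  show ?thesis
    using cohomology_map_unshift [OF _ complex_reduced, of _ k k] E.prj.cohomology_map_axioms [of k]
    unfolding row_seq_def by simp
qed

end


section \<open>Change of coefficients\<close>

lemma coeff_pair_eq: "coeff_pair h x = (coeff0 (\<lambda>v l. h (v l)) (fst x), coeff0 (\<lambda>m i j. h (m i j)) (snd x))"
  by (simp add: coeff_pair_def coeff0_def case_prod_beta')

lemma coeff_triple_eq: "coeff_triple h y = (coeff0 h (fst y), coeff_pair h (snd y))"
  by (simp add: coeff_triple_def case_prod_beta')

locale coefficient_hom = additive h
  for h :: "'g::topological_ab_group_add \<Rightarrow> 'h::topological_ab_group_add"
begin

lemma zmul: "h (zmul m x) = zmul m (h x)"
  by (rule additive_zmul [OF add])

lemma coeff0_add: "coeff0 h (\<phi> + \<psi>) = coeff0 h \<phi> + coeff0 h \<psi>"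
  by (simp add: coeff0_def fun_eq_iff add)

lemma coeff0_diff: "coeff0 h (\<phi> - \<psi>) = coeff0 h \<phi> - coeff0 h \<psi>"
  by (simp add: coeff0_def fun_eq_iff diff)

lemma coeff0_zmul: "coeff0 h (zmul m \<phi>) = zmul m (coeff0 h \<phi>)"
  by (simp add: coeff0_def fun_eq_iff zmul_apply zmul)

lemma coeff0_cech_d: "coeff0 h (cech_d \<Lambda> W \<phi>) = cech_d \<Lambda> W (coeff0 h \<phi>)"
  by (simp add: coeff0_def cech_d_def fun_eq_iff sum zmul zero)

lemma coefficient_hom_fun: "coefficient_hom (\<lambda>(v :: 'j \<Rightarrow> 'g) l. h (v l))"
  by standard (simp add: fun_eq_iff add)

lemma coeff0_cup1_vec:
  "coeff0 h (cup1_vec n \<Lambda> W F \<phi>) = cup1_vec n \<Lambda> W F (coeff0 (\<lambda>v l. h (v l)) \<phi>)"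
  by (simp add: coeff0_def cup1_vec_def fun_eq_iff sum zmul zero)

lemma coeff0_cup1_mat:
  "coeff0 (\<lambda>v l. h (v l)) (cup1_mat n \<Lambda> W F \<phi>) = cup1_mat n \<Lambda> W F (coeff0 (\<lambda>m i j. h (m i j)) \<phi>)"
  by (simp add: coeff0_def cup1_mat_def fun_eq_iff sum zmul zero case_prod_beta')

lemma coeff0_cup2:
  "coeff0 h (cup2 n \<Lambda> W C \<phi>) = cup2 n \<Lambda> W C (coeff0 (\<lambda>m i j. h (m i j)) \<phi>)"
  by (simp add: coeff0_def cup2_def fun_eq_iff sum zmul zero case_prod_beta')

lemma coeff0_F_product:
  "coeff0 h (F_product n \<Lambda> W F s x) = F_product n \<Lambda> W F s (coeff_pair h x)"
  by (simp add: F_product_def case_prod_beta' coeff_pair_eq coeff0_add coeff0_zmul coeff0_cup1_vec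
      coeff0_cup2)

lemma coeff_pair_diff: "coeff_pair h (x - y) = coeff_pair h x - coeff_pair h y"
proof -
  interpret v: coefficient_hom "\<lambda>(v :: nat \<Rightarrow> 'g) l. h (v l)"
    by (rule coefficient_hom_fun)
  interpret m: coefficient_hom "\<lambda>(m :: nat \<Rightarrow> nat \<Rightarrow> 'g) i j. h (m i j)"
    by (rule v.coefficient_hom_fun)
  show ?thesis
    by (simp add: coeff_pair_eq prod_eq_iff v.coeff0_diff m.coeff0_diff)
qed

lemma coeff_pair_zero: "coeff_pair h 0 = 0"
  using coeff_pair_diff [of 0 0] by simp

lemma coeff_pair_reduced:
  "coeff_pair h (diff (reduced_complex Z \<Lambda> W n F) m x) =
    diff (reduced_complex Z \<Lambda> W n F) m (coeff_pair h x)"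
proof -
  interpret v: coefficient_hom "\<lambda>(v :: nat \<Rightarrow> 'g) l. h (v l)"
    by (rule coefficient_hom_fun)
  interpret m: coefficient_hom "\<lambda>(m :: nat \<Rightarrow> nat \<Rightarrow> 'g) i j. h (m i j)"
    by (rule v.coefficient_hom_fun)
  show ?thesis
    by (simp add: reduced_complex_def case_prod_beta' coeff_pair_eq v.coeff0_add v.coeff0_zmul
        v.coeff0_cech_d m.coeff0_cech_d coeff0_cup1_mat)
qed

lemma coeff_triple_diff: "coeff_triple h (x - y) = coeff_triple h x - coeff_triple h y"
  by (simp add: coeff_triple_eq prod_eq_iff coeff_pair_diff coeff0_diff)

lemma coeff_triple_twisted:
  "coeff_triple h (diff (twisted_complex Z \<Lambda> W n F) k y) =
    diff (twisted_complex Z \<Lambda> W n F) k (coeff_triple h y)"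
  by (simp add: coeff_triple_eq diff_twisted coeff0_add coeff0_cech_d coeff0_F_product
      coeff_pair_reduced)

end

text \<open>The lifting conditions carry exactness from the coefficient groups \<open>A\<close>, \<open>B\<close>, \<open>C\<close> to the groups
  of cochains.\<close>

locale coefficient_extension =
  i: coefficient_hom i + p: coefficient_hom p
  for i :: "'a::topological_ab_group_add \<Rightarrow> 'b::topological_ab_group_add"
    and p :: "'b \<Rightarrow> 'c::topological_ab_group_add" +
  fixes Z :: "'z topology" and \<Lambda> :: "'i set" and W :: "'i \<Rightarrow> 'z set"
    and A :: "'a set" and B :: "'b set" and C :: "'c set"
  assumes subgrp: "additive_subgrp A" "additive_subgrp B" "additive_subgrp C"
    and cont: "continuous_on UNIV i" "continuous_on UNIV p"
    and i_mem: "x \<in> A \<Longrightarrow> i x \<in> B" and p_mem: "y \<in> B \<Longrightarrow> p y \<in> C"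
    and i_inj: "i x = 0 \<Longrightarrow> x = 0" and p_i: "p (i x) = 0"
    and open_cover: "\<And>l. l \<in> \<Lambda> \<Longrightarrow> W l \<subseteq> topspace Z"
    and lifts_i: "lifts (subtopology Z (overlap \<Lambda> W ls)) i A {y \<in> B. p y = 0}"
    and lifts_p: "lifts (subtopology Z (overlap \<Lambda> W ls)) p B C"

lemma (in coefficient_extension) coefficient_extension_zero:
  "coefficient_extension i p Z \<Lambda> W {0} {0} {0}"
proof
  have "{y \<in> {0}. p y = 0} = {0}"
    using p.zero by auto
  then show "lifts (subtopology Z (overlap \<Lambda> W ls)) i {0} {y \<in> {0}. p y = 0}" for ls
    by (simp add: lifts_zero i.zero)
  show "lifts (subtopology Z (overlap \<Lambda> W ls)) p {0} {0}" for ls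
    by (rule lifts_zero [of p, OF p.zero])
qed (use cont i_inj p_i open_cover in \<open>simp_all add: additive_subgrp_0 i.zero p.zero\<close>)

text \<open>Vectors and strictly upper triangular matrices are products of copies of the coefficients and of
  zero groups, so that their extensions arise from that of numbers by one or two such products.\<close>

lemma coefficient_extension_fun:
  fixes A :: "'j \<Rightarrow> 'a::topological_ab_group_add set"
  assumes "\<And>l. coefficient_extension i p Z \<Lambda> W (A l) (B l) (C l)"
  shows "coefficient_extension (\<lambda>v l. i (v l)) (\<lambda>v l. p (v l)) Z \<Lambda> W
    {v. \<forall>l. v l \<in> A l} {v. \<forall>l. v l \<in> B l} {v. \<forall>l. v l \<in> C l}"
proof -
  interpret E: coefficient_extension i p Z \<Lambda> W "A l" "B l" "C l" for l
    by (rule assms)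
  have cont: "continuous_on UNIV (\<lambda>v l. h (v l))" if "continuous_on UNIV h"
    for h :: "'x::topological_space \<Rightarrow> 'y::topological_space"
    by (intro continuous_on_coordinatewise_then_product continuous_on_compose2 [OF that]
        continuous_on_product_coordinates) auto
  show ?thesis
  proof (intro coefficient_extension.intro coefficient_extension_axioms.intro
      E.i.coefficient_hom_fun E.p.coefficient_hom_fun additive_subgrp_fun E.subgrp cont E.cont)
    fix ls
    have "{v \<in> {v. \<forall>l. v l \<in> B l}. (\<lambda>l. p (v l)) = 0} = {v. \<forall>l. v l \<in> {y \<in> B l. p y = 0}}"
      by (auto simp: fun_eq_iff)
    then show "lifts (subtopology Z (overlap \<Lambda> W ls)) (\<lambda>v l. i (v l)) {v. \<forall>l. v l \<in> A l}
        {v \<in> {v. \<forall>l. v l \<in> B l}. (\<lambda>l. p (v l)) = 0}"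
      using lifts_fun [OF E.lifts_i] by simp
    show "lifts (subtopology Z (overlap \<Lambda> W ls)) (\<lambda>v l. p (v l)) {v. \<forall>l. v l \<in> B l}
        {v. \<forall>l. v l \<in> C l}"
      by (rule lifts_fun [OF E.lifts_p])
  qed (use E.i_mem E.p_mem E.i_inj E.p_i E.open_cover in \<open>auto simp: fun_eq_iff\<close>)
qed

lemma coeff0_cochain:
  assumes "continuous_on UNIV h" "h 0 = 0" "0 \<in> A" "\<And>x. x \<in> A \<Longrightarrow> h x \<in> B"
    and \<phi>: "\<phi> \<in> cochains Z \<Lambda> W k A"
  shows "coeff0 h \<phi> \<in> cochains Z \<Lambda> W k B"
proof -
  have B: "0 \<in> B"
    using assms(2-4) by metis
  note \<phi> = \<phi> [unfolded cochains_iff [OF assms(3)]]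
  have "continuous_map (subtopology Z (overlap \<Lambda> W ls)) euclidean (\<lambda>z. h (\<phi> ls z))" for ls
    using continuous_map_compose [of _ euclidean "\<phi> ls" euclidean h] \<phi> assms(1) by (simp add: o_def)
  moreover have "homogeneous k (coeff0 h \<phi>)"
    using \<phi> assms(2) unfolding homogeneous_def coeff0_def by metis
  moreover have "h (\<phi> ls z) = 0" if "z \<notin> overlap \<Lambda> W ls" for ls z
    using \<phi> assms(2) that by simp
  ultimately show ?thesis
    using \<phi> assms(4) unfolding cochains_iff [OF B] by (simp add: coeff0_def)
qed

text \<open>The lifts on the overlaps can be chosen independently, as no compatibility is required between the
  functions of a cochain.\<close>

lemma cochain_lift:
  assumes lift: "\<And>ls. lifts (subtopology Z (overlap \<Lambda> W ls)) h A B"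
    and top: "\<And>l. l \<in> \<Lambda> \<Longrightarrow> W l \<subseteq> topspace Z"
    and zero: "0 \<in> A" "0 \<in> B" "h 0 = 0" and \<psi>: "\<psi> \<in> cochains Z \<Lambda> W k B"
  obtains \<phi> where "\<phi> \<in> cochains Z \<Lambda> W k A" "coeff0 h \<phi> = \<psi>"
proof -
  note \<psi> = \<psi> [unfolded cochains_iff [OF zero(2)]]
  have top: "topspace (subtopology Z (overlap \<Lambda> W ls)) = overlap \<Lambda> W ls" for ls
  proof -
    have "overlap \<Lambda> W ls \<subseteq> topspace Z"
      using top by (cases ls) (auto simp: overlap_def)
    then show ?thesis by auto
  qed
  have "\<exists>g. continuous_map (subtopology Z (overlap \<Lambda> W ls)) euclidean g \<and> (\<forall>z\<in>overlap \<Lambda> W ls. g z \<in> A) \<and>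
      (\<forall>z\<in>overlap \<Lambda> W ls. h (g z) = \<psi> ls z)" for ls
  proof -
    have "\<psi> ls ` topspace (subtopology Z (overlap \<Lambda> W ls)) \<subseteq> B"
      using \<psi> by auto
    then obtain g where "continuous_map (subtopology Z (overlap \<Lambda> W ls)) euclidean g"
      "g ` topspace (subtopology Z (overlap \<Lambda> W ls)) \<subseteq> A"
      "\<And>z. z \<in> topspace (subtopology Z (overlap \<Lambda> W ls)) \<Longrightarrow> h (g z) = \<psi> ls z"
      using liftsE [OF lift [of ls], of "\<psi> ls"] \<psi> by metis
    then show ?thesis
      unfolding top by (intro exI [of _ g]) auto
  qed
  then obtain g where g: "\<And>ls. continuous_map (subtopology Z (overlap \<Lambda> W ls)) euclidean (g ls)"
    "\<And>ls z. z \<in> overlap \<Lambda> W ls \<Longrightarrow> g ls z \<in> A"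
    "\<And>ls z. z \<in> overlap \<Lambda> W ls \<Longrightarrow> h (g ls z) = \<psi> ls z"
    by metis
  define \<phi> where "\<phi> ls z =
    (if 0 \<le> k \<and> int (length ls) = k + 1 \<and> z \<in> overlap \<Lambda> W ls then g ls z else 0)" for ls z
  have "continuous_map (subtopology Z (overlap \<Lambda> W ls)) euclidean (\<phi> ls)" for ls
  proof (cases "0 \<le> k \<and> int (length ls) = k + 1")
    case True
    then show ?thesis
      by (intro continuous_map_eq [OF g(1)]) (simp add: \<phi>_def)
  next
    case False
    then have "\<phi> ls = (\<lambda>z. 0)"
      by (auto simp: \<phi>_def)
    then show ?thesis by simp
  qed
  moreover have "homogeneous k \<phi>"
    by (auto simp: homogeneous_def \<phi>_def)
  ultimately have "\<phi> \<in> cochains Z \<Lambda> W k A"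
    unfolding cochains_iff [OF zero(1)] using g(2) zero(1) by (simp add: \<phi>_def)
  moreover have "coeff0 h \<phi> ls z = \<psi> ls z" for ls z
  proof (cases "0 \<le> k \<and> int (length ls) = k + 1 \<and> z \<in> overlap \<Lambda> W ls")
    case True
    then show ?thesis by (simp add: coeff0_def \<phi>_def g(3))
  next
    case False
    then have "\<psi> ls z = 0"
      using \<psi> unfolding homogeneous_def by (metis linorder_not_less)
    with False zero show ?thesis by (auto simp: coeff0_def \<phi>_def)
  qed
  then have "coeff0 h \<phi> = \<psi>"
    by blast
  ultimately show thesis by (rule that)
qed

context coefficient_extension
begin

lemma zero_mem: "0 \<in> A" "0 \<in> B" "0 \<in> C"
  using subgrp by (simp_all add: additive_subgrp_def)

lemma coeff0_i_cochain: "\<phi> \<in> cochains Z \<Lambda> W k A \<Longrightarrow> coeff0 i \<phi> \<in> cochains Z \<Lambda> W k B"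
  using coeff0_cochain [OF cont(1) i.zero zero_mem(1), of B] i_mem by blast

lemma coeff0_p_cochain: "\<phi> \<in> cochains Z \<Lambda> W k B \<Longrightarrow> coeff0 p \<phi> \<in> cochains Z \<Lambda> W k C"
  using coeff0_cochain [OF cont(2) p.zero zero_mem(2), of C] p_mem by blast

lemma coeff0_i_inj: "coeff0 i \<phi> = 0 \<Longrightarrow> \<phi> = 0"
  using i_inj by (simp add: coeff0_def fun_eq_iff)

lemma coeff0_p_i: "coeff0 p (coeff0 i \<phi>) = 0"
  by (simp add: coeff0_def fun_eq_iff p_i)

lemma coeff0_p_surj:
  assumes "\<psi> \<in> cochains Z \<Lambda> W k C"
  obtains \<phi> where "\<phi> \<in> cochains Z \<Lambda> W k B" "coeff0 p \<phi> = \<psi>"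
  by (rule cochain_lift [OF lifts_p open_cover zero_mem(2,3) p.zero assms])

lemma coeff0_p_kernel:
  assumes "\<psi> \<in> cochains Z \<Lambda> W k B" "coeff0 p \<psi> = 0"
  obtains \<phi> where "\<phi> \<in> cochains Z \<Lambda> W k A" "coeff0 i \<phi> = \<psi>"
proof -
  have zero: "0 \<in> {y \<in> B. p y = 0}"
    using zero_mem p.zero by simp
  have "p (\<psi> ls z) = 0" for ls z
    using assms(2) by (metis coeff0_def zero_fun_apply)
  then have "\<psi> \<in> cochains Z \<Lambda> W k {y \<in> B. p y = 0}"
    using assms(1) unfolding cochains_iff [OF zero] cochains_iff [OF zero_mem(2)] by blast
  from cochain_lift [OF lifts_i open_cover zero_mem(1) zero i.zero this] that
  show thesis by blast
qed

end

text \<open>Contractibility of the overlaps gives the lifts of functions with values in the circle; an empty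
  overlap is no exception, as the empty space is contractible in the sense used here.\<close>

lemma real_extension:
  assumes "good_open_cover Z \<Lambda> W"
  shows "coefficient_extension real_of_int circle_of Z \<Lambda> W UNIV UNIV UNIV"
proof
  fix ls
  have "{y \<in> UNIV. circle_of y = 0} = \<int>"
    by (simp add: circle_of_eq_0_iff)
  then show "lifts (subtopology Z (overlap \<Lambda> W ls)) real_of_int UNIV {y \<in> UNIV. circle_of y = 0}"
    by (simp only: lifts_int)
  have "contractible_space (subtopology Z (overlap \<Lambda> W ls))"
    using assms by (cases "overlap \<Lambda> W ls = {}") (simp_all add: good_open_cover_def)
  then show "lifts (subtopology Z (overlap \<Lambda> W ls)) circle_of UNIV UNIV"
    by (rule lifts_circle)
next
  show "continuous_on UNIV circle_of"
    by (simp add: continuous_on_eq_continuous_at isCont_circle_of)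
  show "W l \<subseteq> topspace Z" if "l \<in> \<Lambda>" for l
    using assms that openin_subset unfolding good_open_cover_def by blast
qed (simp_all add: circle_of_add additive_subgrp_UNIV circle_of_eq_0_iff)

lemma coefficient_extension_vecs:
  assumes "coefficient_extension i p Z \<Lambda> W UNIV UNIV UNIV"
  shows "coefficient_extension (\<lambda>v l. i (v l)) (\<lambda>v l. p (v l)) Z \<Lambda> W (vecs n) (vecs n) (vecs n)"
  unfolding vecs_eq
  by (rule coefficient_extension_fun)
     (use assms coefficient_extension.coefficient_extension_zero [OF assms] in simp)

lemma coefficient_extension_upper_mats:
  assumes "coefficient_extension i p Z \<Lambda> W UNIV UNIV UNIV"
  shows "coefficient_extension (\<lambda>m k l. i (m k l)) (\<lambda>m k l. p (m k l)) Z \<Lambda> W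
    (upper_mats n) (upper_mats n) (upper_mats n)"
  unfolding upper_mats_eq
  by (intro coefficient_extension_fun)
     (use assms coefficient_extension.coefficient_extension_zero [OF assms] in simp)


section \<open>The columns\<close>

locale good_twisting = twisting Z \<Lambda> W n F
  for Z :: "'z topology" and \<Lambda> :: "'i set" and W :: "'i \<Rightarrow> 'z set"
    and n :: nat and F :: "('i, 'z, nat \<Rightarrow> int) cochain" +
  assumes cover: "good_open_cover Z \<Lambda> W"
begin

sublocale e0: coefficient_extension real_of_int circle_of Z \<Lambda> W UNIV UNIV UNIV
  by (rule real_extension [OF cover])

sublocale e1: coefficient_extension "\<lambda>v l. real_of_int (v l)" "\<lambda>v l. circle_of (v l)" Z \<Lambda> W
  "vecs n" "vecs n" "vecs n"
  by (rule coefficient_extension_vecs) (rule e0.coefficient_extension_axioms)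

sublocale e2: coefficient_extension "\<lambda>m k l. real_of_int (m k l)" "\<lambda>m k l. circle_of (m k l)" Z \<Lambda> W
  "upper_mats n" "upper_mats n" "upper_mats n"
  by (rule coefficient_extension_upper_mats) (rule e0.coefficient_extension_axioms)

lemma short_exact_cech: "short_exact (cech_seq Z \<Lambda> W)"
proof (intro short_exact.intro short_exact_axioms.intro)
  show "\<exists>b\<in>obj (mid_cx (cech_seq Z \<Lambda> W)) k. prj (cech_seq Z \<Lambda> W) b = c"
    if "c \<in> obj (quo_cx (cech_seq Z \<Lambda> W)) k" for c k
    using that e0.coeff0_p_surj [of c k] by (auto simp: cech_seq_def cech_complex_def)
  show "\<exists>a\<in>obj (sub_cx (cech_seq Z \<Lambda> W)) k. inc (cech_seq Z \<Lambda> W) a = b"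
    if "b \<in> obj (mid_cx (cech_seq Z \<Lambda> W)) k" "prj (cech_seq Z \<Lambda> W) b = 0" for b k
    using that e0.coeff0_p_kernel [of b k] by (auto simp: cech_seq_def cech_complex_def)
qed (auto simp: cech_seq_def complex_cech, auto simp: cech_complex_def e0.coeff0_i_cochain
    e0.coeff0_p_cochain e0.i.coeff0_diff e0.p.coeff0_diff e0.i.coeff0_cech_d e0.p.coeff0_cech_d
    e0.coeff0_i_inj e0.coeff0_p_i)

lemma reduced_inc_mem: "x \<in> obj reduced m \<Longrightarrow> coeff_pair real_of_int x \<in> obj reduced m"
  by (simp add: in_reduced coeff_pair_eq e1.coeff0_i_cochain e2.coeff0_i_cochain)

lemma reduced_prj_mem: "x \<in> obj reduced m \<Longrightarrow> coeff_pair circle_of x \<in> obj reduced m"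
  by (simp add: in_reduced coeff_pair_eq e1.coeff0_p_cochain e2.coeff0_p_cochain)

lemma reduced_inc_inj: "coeff_pair real_of_int x = 0 \<Longrightarrow> x = 0"
  using e1.coeff0_i_inj [of "fst x"] e2.coeff0_i_inj [of "snd x"]
  by (simp add: coeff_pair_eq prod_eq_iff)

lemma reduced_prj_inc: "coeff_pair circle_of (coeff_pair real_of_int x) = 0"
  using e1.coeff0_p_i [of "fst x"] e2.coeff0_p_i [of "snd x"]
  by (simp add: coeff_pair_eq prod_eq_iff)

lemma reduced_prj_surj:
  assumes "c \<in> obj reduced m"
  obtains b where "b \<in> obj reduced m" "coeff_pair circle_of b = c"
proof -
  obtain b1 where "b1 \<in> cochains Z \<Lambda> W m (vecs n)" "coeff0 (\<lambda>v l. circle_of (v l)) b1 = fst c"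
    using assms e1.coeff0_p_surj unfolding in_reduced by blast
  moreover obtain b2 where "b2 \<in> cochains Z \<Lambda> W (m - 1) (upper_mats n)"
    "coeff0 (\<lambda>m k l. circle_of (m k l)) b2 = snd c"
    using assms e2.coeff0_p_surj unfolding in_reduced by blast
  ultimately show thesis
    by (intro that [of "(b1, b2)"]) (simp_all add: in_reduced coeff_pair_eq)
qed

lemma reduced_prj_kernel:
  assumes "b \<in> obj reduced m" "coeff_pair circle_of b = 0"
  obtains a where "a \<in> obj reduced m" "coeff_pair real_of_int a = b"
proof -
  have "coeff0 (\<lambda>v l. circle_of (v l)) (fst b) = 0" "coeff0 (\<lambda>m k l. circle_of (m k l)) (snd b) = 0"
    using assms(2) by (simp_all add: coeff_pair_eq prod_eq_iff)
  then obtain a1 a2 where "a1 \<in> cochains Z \<Lambda> W m (vecs n)" "coeff0 (\<lambda>v l. real_of_int (v l)) a1 = fst b"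
    "a2 \<in> cochains Z \<Lambda> W (m - 1) (upper_mats n)" "coeff0 (\<lambda>m k l. real_of_int (m k l)) a2 = snd b"
    using assms(1) e1.coeff0_p_kernel e2.coeff0_p_kernel unfolding in_reduced by metis
  then show thesis
    by (intro that [of "(a1, a2)"]) (simp_all add: in_reduced coeff_pair_eq)
qed

lemma short_exact_reduced: "short_exact (reduced_seq Z \<Lambda> W n F)"
proof (intro short_exact.intro short_exact_axioms.intro)
  show "\<exists>b\<in>obj (mid_cx (reduced_seq Z \<Lambda> W n F)) k. prj (reduced_seq Z \<Lambda> W n F) b = c"
    if "c \<in> obj (quo_cx (reduced_seq Z \<Lambda> W n F)) k" for c k
    using that reduced_prj_surj [of c k] by (auto simp: reduced_seq_def)
  show "\<exists>a\<in>obj (sub_cx (reduced_seq Z \<Lambda> W n F)) k. inc (reduced_seq Z \<Lambda> W n F) a = b"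
    if "b \<in> obj (mid_cx (reduced_seq Z \<Lambda> W n F)) k" "prj (reduced_seq Z \<Lambda> W n F) b = 0" for b k
    using that reduced_prj_kernel [of b k] by (auto simp: reduced_seq_def)
qed (simp_all add: reduced_seq_def complex_reduced reduced_inc_mem reduced_prj_mem reduced_inc_inj
    reduced_prj_inc e0.i.coeff_pair_diff e0.p.coeff_pair_diff e0.i.coeff_pair_reduced
    e0.p.coeff_pair_reduced)

lemma twisted_inc_mem: "y \<in> obj twisted k \<Longrightarrow> coeff_triple real_of_int y \<in> obj twisted k"
  by (simp add: obj_twisted mem_Times_iff coeff_triple_eq e0.coeff0_i_cochain reduced_inc_mem)

lemma twisted_prj_mem: "y \<in> obj twisted k \<Longrightarrow> coeff_triple circle_of y \<in> obj twisted k"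
  by (simp add: obj_twisted mem_Times_iff coeff_triple_eq e0.coeff0_p_cochain reduced_prj_mem)

lemma short_exact_twisted: "short_exact (twisted_seq Z \<Lambda> W n F)"
proof (intro short_exact.intro short_exact_axioms.intro)
  show "\<exists>b\<in>obj (mid_cx (twisted_seq Z \<Lambda> W n F)) k. prj (twisted_seq Z \<Lambda> W n F) b = c"
    if "c \<in> obj (quo_cx (twisted_seq Z \<Lambda> W n F)) k" for c k
  proof -
    have c: "fst c \<in> cochains Z \<Lambda> W k UNIV" "snd c \<in> obj reduced (k - 1)"
      using that by (simp_all add: twisted_seq_def obj_twisted mem_Times_iff)
    obtain b0 where "b0 \<in> cochains Z \<Lambda> W k UNIV" "coeff0 circle_of b0 = fst c"
      using e0.coeff0_p_surj [OF c(1)] .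
    moreover obtain b where "b \<in> obj reduced (k - 1)" "coeff_pair circle_of b = snd c"
      using reduced_prj_surj [OF c(2)] .
    ultimately show ?thesis
      by (intro bexI [of _ "(b0, b)"]) (simp_all add: twisted_seq_def coeff_triple_eq obj_twisted)
  qed
  show "\<exists>a\<in>obj (sub_cx (twisted_seq Z \<Lambda> W n F)) k. inc (twisted_seq Z \<Lambda> W n F) a = b"
    if "b \<in> obj (mid_cx (twisted_seq Z \<Lambda> W n F)) k" "prj (twisted_seq Z \<Lambda> W n F) b = 0" for b k
  proof -
    have b: "fst b \<in> cochains Z \<Lambda> W k UNIV" "snd b \<in> obj reduced (k - 1)"
      "coeff0 circle_of (fst b) = 0" "coeff_pair circle_of (snd b) = 0"
      using that by (simp_all add: twisted_seq_def obj_twisted mem_Times_iff coeff_triple_eq prod_eq_iff)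
    obtain a0 where "a0 \<in> cochains Z \<Lambda> W k UNIV" "coeff0 real_of_int a0 = fst b"
      using e0.coeff0_p_kernel [OF b(1,3)] .
    moreover obtain a where "a \<in> obj reduced (k - 1)" "coeff_pair real_of_int a = snd b"
      using reduced_prj_kernel [OF b(2,4)] .
    ultimately show ?thesis
      by (intro bexI [of _ "(a0, a)"]) (simp_all add: twisted_seq_def coeff_triple_eq obj_twisted)
  qed
  show "a = 0" if "inc (twisted_seq Z \<Lambda> W n F) a = 0" for a
    using that e0.coeff0_i_inj [of "fst a"] reduced_inc_inj [of "snd a"]
    by (simp add: twisted_seq_def coeff_triple_eq prod_eq_iff)
  show "prj (twisted_seq Z \<Lambda> W n F) (inc (twisted_seq Z \<Lambda> W n F) a) = 0" for a
    by (simp add: twisted_seq_def coeff_triple_eq prod_eq_iff e0.coeff0_p_i reduced_prj_inc)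
qed (simp_all add: twisted_seq_def complex_twisted twisted_inc_mem twisted_prj_mem
    e0.i.coeff_triple_diff e0.p.coeff_triple_diff e0.i.coeff_triple_twisted
    e0.p.coeff_triple_twisted)

end


section \<open>The squares\<close>

context twisting
begin

text \<open>The products with \<open>F\<close> are integral, hence commute with every homomorphism of coefficients.\<close>

lemma coefficient_squares:
  assumes h: "coefficient_hom h"
    and "\<And>k. cohomology_map cech cech k k (coeff0 h)"
    and "\<And>k. cohomology_map twisted twisted k k (coeff_triple h)"
    and "\<And>k. cohomology_map reduced reduced k k (coeff_pair h)"
  shows "square_commutes (cohomology cech k) (pi_up Z \<Lambda> W n F k) (coh_map twisted k (coeff_triple h))
      (coh_map cech k (coeff0 h)) (pi_up Z \<Lambda> W n F k)"
    and "square_commutes (cohomology twisted k)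
      (pi_down Z \<Lambda> W n F k) (coh_map reduced (k - 1) (coeff_pair h))
      (coh_map twisted k (coeff_triple h)) (pi_down Z \<Lambda> W n F k)"
    and "square_commutes (cohomology reduced (k - 1))
      (cup_F Z \<Lambda> W n F k) (coh_map cech (k + 1) (coeff0 h))
      (coh_map reduced (k - 1) (coeff_pair h)) (cup_F Z \<Lambda> W n F k)"
proof -
  interpret coefficient_hom h by (rule h)
  have cup: "cohomology_map reduced cech (k - 1) (k + 1) (Fprod (msign (k + 2)))"
    using cohomology_map_F_product [of "k - 1" "msign (k + 2)"] by (simp add: add.commute)
  show "square_commutes (cohomology cech k) (pi_up Z \<Lambda> W n F k) (coh_map twisted k (coeff_triple h))
      (coh_map cech k (coeff0 h)) (pi_up Z \<Lambda> W n F k)"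
    unfolding pi_up_def
    by (rule square_commutes_coh_map [OF cohomology_map_pi_up assms(3,2) cohomology_map_pi_up])
       (simp add: coeff_triple_eq zero_prod_def [symmetric] coeff_pair_zero)
  show "square_commutes (cohomology twisted k)
      (pi_down Z \<Lambda> W n F k) (coh_map reduced (k - 1) (coeff_pair h))
      (coh_map twisted k (coeff_triple h)) (pi_down Z \<Lambda> W n F k)"
    unfolding pi_down_def
    by (rule square_commutes_coh_map [OF cohomology_map_pi_down assms(4,3) cohomology_map_pi_down])
       (simp add: coeff_triple_eq case_prod_beta')
  show "square_commutes (cohomology reduced (k - 1))
      (cup_F Z \<Lambda> W n F k) (coh_map cech (k + 1) (coeff0 h))
      (coh_map reduced (k - 1) (coeff_pair h)) (cup_F Z \<Lambda> W n F k)"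
    unfolding cup_F_def
    by (rule square_commutes_coh_map [OF cup assms(2,4) cup]) (simp add: coeff0_F_product)
qed

end

lemma cech_seq_simps:
  "sub_cx (cech_seq Z \<Lambda> W) = cech_complex Z \<Lambda> W" "mid_cx (cech_seq Z \<Lambda> W) = cech_complex Z \<Lambda> W"
  "quo_cx (cech_seq Z \<Lambda> W) = cech_complex Z \<Lambda> W"
  "inc (cech_seq Z \<Lambda> W) = coeff0 real_of_int" "prj (cech_seq Z \<Lambda> W) = coeff0 circle_of"
  by (simp_all add: cech_seq_def)

lemma twisted_seq_simps:
  "sub_cx (twisted_seq Z \<Lambda> W n F) = twisted_complex Z \<Lambda> W n F"
  "mid_cx (twisted_seq Z \<Lambda> W n F) = twisted_complex Z \<Lambda> W n F"
  "quo_cx (twisted_seq Z \<Lambda> W n F) = twisted_complex Z \<Lambda> W n F"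
  "inc (twisted_seq Z \<Lambda> W n F) = coeff_triple real_of_int"
  "prj (twisted_seq Z \<Lambda> W n F) = coeff_triple circle_of"
  by (simp_all add: twisted_seq_def)

lemma reduced_seq_simps:
  "sub_cx (reduced_seq Z \<Lambda> W n F) = reduced_complex Z \<Lambda> W n F"
  "mid_cx (reduced_seq Z \<Lambda> W n F) = reduced_complex Z \<Lambda> W n F"
  "quo_cx (reduced_seq Z \<Lambda> W n F) = reduced_complex Z \<Lambda> W n F"
  "inc (reduced_seq Z \<Lambda> W n F) = coeff_pair real_of_int"
  "prj (reduced_seq Z \<Lambda> W n F) = coeff_pair circle_of"
  by (simp_all add: reduced_seq_def)

context good_twisting
begin

lemma conn_pi_up:
  "square_commutes (cohomology (quo_cx (cech_seq Z \<Lambda> W)) k)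
     (pi_up Z \<Lambda> W n F k) (conn_coh (twisted_seq Z \<Lambda> W n F) k k)
     (conn_coh (cech_seq Z \<Lambda> W) k k) (pi_up Z \<Lambda> W n F (k + 1))"
proof -
  let ?S = "cech_seq Z \<Lambda> W" and ?T = "twisted_seq Z \<Lambda> W n F"
  have "square_commutes (cohomology (quo_cx ?S) k)
      (coh_map (quo_cx ?T) k (\<lambda>\<phi>. (\<phi>, 0, 0))) (conn_coh ?T k k)
      (conn_coh ?S k k) (coh_map (sub_cx ?T) (k + 1) (\<lambda>\<phi>. (\<phi>, 0, 0)))"
  proof (rule square_commutes_conn [OF short_exact_cech short_exact_twisted,
        where g = "\<lambda>\<phi>. (\<phi>, 0, 0)"])
    show "cohomology_map (quo_cx ?S) (quo_cx ?T) k k (\<lambda>\<phi>. (\<phi>, 0, 0))"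
      "cohomology_map (sub_cx ?S) (sub_cx ?T) (k + 1) (k + 1) (\<lambda>\<phi>. (\<phi>, 0, 0))"
      unfolding cech_seq_simps twisted_seq_simps by (rule cohomology_map_pi_up)+
    show "(b, 0, 0) \<in> obj (mid_cx ?T) k" if "b \<in> obj (mid_cx ?S) k" for b
      using that unfolding cech_seq_simps twisted_seq_simps
      by (rule cohomology_map.map_mem [OF cohomology_map_pi_up])
    show "prj ?T (b, 0, 0) = (prj ?S b, 0, 0)" for b
      by (simp add: cech_seq_simps twisted_seq_simps coeff_triple_eq
          zero_prod_def [symmetric] e0.p.coeff_pair_zero)
    show "inc ?T (a, 0, 0) = zmul (msign (k + k)) (diff (mid_cx ?T) k (b, 0, 0))"
      if "inc ?S a = diff (mid_cx ?S) k b" for a b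
      using that complex.diff_0 [OF complex_reduced]
      by (simp add: cech_seq_simps twisted_seq_simps coeff_triple_eq diff_twisted zmul_msign
          zero_prod_def [symmetric] e0.i.coeff_pair_zero F_product_0 cech_complex_def)
  qed
  then show ?thesis
    by (simp add: pi_up_def twisted_seq_simps)
qed

lemma conn_pi_down:
  "square_commutes (cohomology (quo_cx (twisted_seq Z \<Lambda> W n F)) k)
     (pi_down Z \<Lambda> W n F k) (conn_coh (reduced_seq Z \<Lambda> W n F) k (k - 1))
     (conn_coh (twisted_seq Z \<Lambda> W n F) k k) (pi_down Z \<Lambda> W n F (k + 1))"
proof -
  let ?S = "twisted_seq Z \<Lambda> W n F" and ?T = "reduced_seq Z \<Lambda> W n F"
  let ?f = "\<lambda>(\<phi>0, \<phi>1, \<phi>2). (\<phi>1, \<phi>2)"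
  have "square_commutes (cohomology (quo_cx ?S) k)
      (coh_map (quo_cx ?T) (k - 1) ?f) (conn_coh ?T k (k - 1))
      (conn_coh ?S k k) (coh_map (sub_cx ?T) (k - 1 + 1) ?f)"
  proof (rule square_commutes_conn [OF short_exact_twisted short_exact_reduced, where g = ?f])
    show "cohomology_map (quo_cx ?S) (quo_cx ?T) k (k - 1) ?f"
      unfolding twisted_seq_simps reduced_seq_simps by (rule cohomology_map_pi_down)
    show "cohomology_map (sub_cx ?S) (sub_cx ?T) (k + 1) (k - 1 + 1) ?f"
      using cohomology_map_pi_down [of "k + 1"] by (simp add: twisted_seq_simps reduced_seq_simps)
    show "?f b \<in> obj (mid_cx ?T) (k - 1)" if "b \<in> obj (mid_cx ?S) k" for b
      using that unfolding reduced_seq_simps twisted_seq_simps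
      by (rule cohomology_map.map_mem [OF cohomology_map_pi_down])
    show "prj ?T (?f b) = ?f (prj ?S b)" for b
      by (simp add: twisted_seq_simps reduced_seq_simps coeff_triple_eq case_prod_beta')
    show "inc ?T (?f a) = zmul (msign (k + k)) (diff (mid_cx ?T) (k - 1) (?f b))"
      if "inc ?S a = diff (mid_cx ?S) k b" for a b
      using that
      by (simp add: twisted_seq_simps reduced_seq_simps coeff_triple_eq diff_twisted zmul_msign
          case_prod_beta')
  qed
  then show ?thesis
    by (simp add: pi_down_def reduced_seq_simps)
qed

lemma conn_cup_F:
  "square_commutes (cohomology (quo_cx (reduced_seq Z \<Lambda> W n F)) (k - 1))
     (cup_F Z \<Lambda> W n F k) (conn_coh (cech_seq Z \<Lambda> W) (k + 1) (k + 1))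
     (conn_coh (reduced_seq Z \<Lambda> W n F) k (k - 1)) (cup_F Z \<Lambda> W n F (k + 1))"
proof -
  let ?S = "reduced_seq Z \<Lambda> W n F" and ?T = "cech_seq Z \<Lambda> W"
  have "square_commutes (cohomology (quo_cx ?S) (k - 1))
      (coh_map (quo_cx ?T) (k + 1) (Fprod (msign (k + 2)))) (conn_coh ?T (k + 1) (k + 1))
      (conn_coh ?S k (k - 1)) (coh_map (sub_cx ?T) (k + 1 + 1) (Fprod (msign (k + 1 + 2))))"
  proof (rule square_commutes_conn [OF short_exact_reduced short_exact_cech,
        where g = "Fprod (msign (k + 2))"])
    show "cohomology_map (quo_cx ?S) (quo_cx ?T) (k - 1) (k + 1) (Fprod (msign (k + 2)))"
      using cohomology_map_F_product [of "k - 1" "msign (k + 2)"]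
      by (simp add: cech_seq_simps reduced_seq_simps add.commute)
    show "cohomology_map (sub_cx ?S) (sub_cx ?T) (k - 1 + 1) (k + 1 + 1) (Fprod (msign (k + 1 + 2)))"
      using cohomology_map_F_product [of k "msign (k + 1 + 2)"]
      by (simp add: cech_seq_simps reduced_seq_simps add.commute)
    show "Fprod (msign (k + 2)) b \<in> obj (mid_cx ?T) (k + 1)" if "b \<in> obj (mid_cx ?S) (k - 1)" for b
      using F_product_cochain [of b "k - 1" "msign (k + 2)"] that
      by (simp add: cech_seq_simps reduced_seq_simps cech_complex_def add.commute)
    show "prj ?T (Fprod (msign (k + 2)) b) = Fprod (msign (k + 2)) (prj ?S b)" for b
      by (simp add: cech_seq_simps reduced_seq_simps e0.p.coeff0_F_product)
    \<comment> \<open>The cup product changes its sign with the degree, and so does the connecting map.\<close>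
    show "inc ?T (Fprod (msign (k + 1 + 2)) a) =
        zmul (msign (k + (k + 1))) (diff (mid_cx ?T) (k + 1) (Fprod (msign (k + 2)) b))"
      if "b \<in> obj (mid_cx ?S) (k - 1)" "inc ?S a = diff (mid_cx ?S) (k - 1) b" for a b
    proof -
      have "inc ?T (Fprod (msign (k + 1 + 2)) a) = Fprod (msign (k + 1 + 2)) (diff reduced (k - 1) b)"
        using that(2) by (simp add: cech_seq_simps reduced_seq_simps e0.i.coeff0_F_product)
      also have "\<dots> = - Fprod (msign (k + 2)) (diff reduced (k - 1) b)"
        by (simp add: F_product_msign zmul_msign)
      also have "\<dots> = - cech_d \<Lambda> W (Fprod (msign (k + 2)) b)"
        using that(1) by (simp add: reduced_seq_simps cech_d_F_product)
      finally show ?thesis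
        by (simp add: zmul_msign cech_seq_simps cech_complex_def)
    qed
  qed
  then show ?thesis
    by (simp add: cup_F_def cech_seq_simps)
qed

end

theorem theorem4p1:
  fixes Z :: "'z topology" and d n :: nat
    and \<A> :: "('z set \<times> ('z \<Rightarrow> (nat \<Rightarrow> real))) set"
    and \<Lambda> :: "'i set" and W :: "'i \<Rightarrow> 'z set"
    and F :: "('i, 'z, nat \<Rightarrow> int) cochain"
  assumes "smooth_manifold d Z \<A>"
    and "good_open_cover Z \<Lambda> W"
    and "F \<in> cech_2_cocycles Z \<Lambda> W n"
  shows
    "row_exact TYPE(real) Z \<Lambda> W n F \<and>
     row_exact TYPE(circle) Z \<Lambda> W n F \<and>
     row_exact TYPE(int) Z \<Lambda> W n F \<and>
     column_exact (cech_seq Z \<Lambda> W) 0 \<and>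
     column_exact (twisted_seq Z \<Lambda> W n F) 0 \<and>
     column_exact (reduced_seq Z \<Lambda> W n F) 1 \<and>
     (let K = cech_seq Z \<Lambda> W; KF = twisted_seq Z \<Lambda> W n F; KR = reduced_seq Z \<Lambda> W n F
      in \<forall>k.
       \<comment> \<open>from integer to real coefficients\<close>
       square_commutes (cohomology (sub_cx K) k)
         (pi_up Z \<Lambda> W n F k) (inc_coh KF k)
         (inc_coh K k) (pi_up Z \<Lambda> W n F k) \<and>
       square_commutes (cohomology (sub_cx KF) k)
         (pi_down Z \<Lambda> W n F k) (inc_coh KR (k - 1))
         (inc_coh KF k) (pi_down Z \<Lambda> W n F k) \<and>
       square_commutes (cohomology (sub_cx KR) (k - 1))
         (cup_F Z \<Lambda> W n F k) (inc_coh K (k + 1))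
         (inc_coh KR (k - 1)) (cup_F Z \<Lambda> W n F k) \<and>
       \<comment> \<open>from real to circle coefficients\<close>
       square_commutes (cohomology (mid_cx K) k)
         (pi_up Z \<Lambda> W n F k) (prj_coh KF k)
         (prj_coh K k) (pi_up Z \<Lambda> W n F k) \<and>
       square_commutes (cohomology (mid_cx KF) k)
         (pi_down Z \<Lambda> W n F k) (prj_coh KR (k - 1))
         (prj_coh KF k) (pi_down Z \<Lambda> W n F k) \<and>
       square_commutes (cohomology (mid_cx KR) (k - 1))
         (cup_F Z \<Lambda> W n F k) (prj_coh K (k + 1))
         (prj_coh KR (k - 1)) (cup_F Z \<Lambda> W n F k) \<and>
       \<comment> \<open>from circle to integer coefficients\<close>
       square_commutes (cohomology (quo_cx K) k)
         (pi_up Z \<Lambda> W n F k) (conn_coh KF k k)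
         (conn_coh K k k) (pi_up Z \<Lambda> W n F (k + 1)) \<and>
       square_commutes (cohomology (quo_cx KF) k)
         (pi_down Z \<Lambda> W n F k) (conn_coh KR k (k - 1))
         (conn_coh KF k k) (pi_down Z \<Lambda> W n F (k + 1)) \<and>
       square_commutes (cohomology (quo_cx KR) (k - 1))
         (cup_F Z \<Lambda> W n F k) (conn_coh K (k + 1) (k + 1))
         (conn_coh KR k (k - 1)) (cup_F Z \<Lambda> W n F (k + 1)))"
proof -
  interpret good_twisting Z \<Lambda> W n F
    using assms(2,3) by unfold_locales (simp_all add: cech_2_cocycles_def)
  interpret K: short_exact "cech_seq Z \<Lambda> W"
    by (rule short_exact_cech)
  interpret KF: short_exact "twisted_seq Z \<Lambda> W n F"
    by (rule short_exact_twisted)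
  interpret KR: short_exact "reduced_seq Z \<Lambda> W n F"
    by (rule short_exact_reduced)
  note maps_inc = K.inc.cohomology_map_axioms KF.inc.cohomology_map_axioms
    KR.inc.cohomology_map_axioms
  note maps_prj = K.prj.cohomology_map_axioms KF.prj.cohomology_map_axioms
    KR.prj.cohomology_map_axioms
  note simps = cech_seq_simps twisted_seq_simps reduced_seq_simps
  note inc_squares = coefficient_squares [OF e0.i.coefficient_hom_axioms maps_inc [unfolded simps]]
  note prj_squares = coefficient_squares [OF e0.p.coefficient_hom_axioms maps_prj [unfolded simps]]
  show ?thesis
    unfolding Let_def inc_coh_def prj_coh_def simps
    by (intro conjI allI row_exact K.column_exact KF.column_exact KR.column_exact inc_squares
        prj_squares conn_pi_up [unfolded simps] conn_pi_down [unfolded simps]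
        conn_cup_F [unfolded simps])
qed


end
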